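(* Let $\Gamma$ be a nonlinear connection on $E=J^1(\mathbb{R},M)$. (a) Under a change of coordinates $\tilde t=\tilde t(t)$, $\tilde x^i=\tilde x^i(x^j)$, $\tilde y_1^i=\frac{\partial\tilde x^i}{\partial x^j}\frac{dt}{d\tilde t}y_1^j$ on $E$, the adapted coefficients of a $\Gamma$-linear connection $\nabla$ on $E$ change by the following rules. $(h_{\mathbb{R}})$: $$\bar G_{11}^1=\tilde{\bar G}_{11}^1\frac{d\tilde t}{dt}+\frac{dt}{d\tilde t}\frac{d^2\tilde t}{dt^2},\qquad G_{i1}^k=\tilde G_{j1}^r\frac{\partial x^k}{\partial\tilde x^r}\frac{\partial\tilde x^j}{\partial x^i}\frac{d\tilde t}{dt},$$ $$G_{(1)(i)1}^{(k)(1)}=\tilde G_{(1)(j)1}^{(p)(1)}\frac{\partial x^k}{\partial\tilde x^p}\frac{\partial\tilde x^j}{\partial x^i}\frac{d\tilde t}{dt}+\delta_i^k\left(\frac{d\tilde t}{dt}\right)^2\frac{d^2t}{d\tilde t^2};$$ $(h_M)$: $$\bar L_{1j}^1=\tilde{\bar L}_{1l}^1\frac{\partial\tilde x^l}{\partial x^j},\qquad L_{ij}^r=\tilde L_{pq}^s\frac{\partial x^r}{\partial\tilde x^s}\frac{\partial\tilde x^p}{\partial x^i}\frac{\partial\tilde x^q}{\partial x^j}+\frac{\partial x^r}{\partial\tilde x^s}\frac{\partial^2\tilde x^s}{\partial x^i\partial x^j},$$ $$L_{(1)(i)j}^{(k)(1)}=\tilde L_{(1)(p)s}^{(r)(1)}\frac{\partial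 x^k}{\partial\tilde x^r}\frac{\partial\tilde x^p}{\partial x^i}\frac{\partial\tilde x^s}{\partial x^j}+\frac{\partial x^k}{\partial\tilde x^r}\frac{\partial^2\tilde x^r}{\partial x^i\partial x^j};$$ $(v)$: $$\bar C_{1(i)}^{1(1)}=\tilde{\bar C}_{1(j)}^{1(1)}\frac{\partial\tilde x^j}{\partial x^i}\frac{dt}{d\tilde t},\qquad C_{i(j)}^{k(1)}=\tilde C_{p(r)}^{s(1)}\frac{\partial x^k}{\partial\tilde x^s}\frac{\partial\tilde x^p}{\partial x^i}\frac{\partial\tilde x^r}{\partial x^j}\frac{dt}{d\tilde t},$$ $$C_{(1)(i)(j)}^{(k)(1)(1)}=\tilde C_{(1)(p)(q)}^{(r)(1)(1)}\frac{\partial x^k}{\partial\tilde x^r}\frac{\partial\tilde x^p}{\partial x^i}\frac{\partial\tilde x^q}{\partial x^j}\frac{dt}{d\tilde t}.$$ (b) Conversely, to give a $\Gamma$-linear connection $\nabla$ on $E$ is equivalent to giving a set of nine adapted local components $$\nabla\Gamma=\left(\bar G_{11}^1,\;G_{i1}^k,\;G_{(1)(j)1}^{(i)(1)},\;\bar L_{1j}^1,\;L_{ij}^k,\;L_{(1)(j)k}^{(i)(1)},\;\bar C_{1(k)}^{1(1)},\;C_{i(k)}^{j(1)},\;C_{(1)(j)(k)}^{(i)(1)(1)}\right)$$ (local functions on the charts of $E$) which transform by the rules described in (a).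
   Context: $M$ is a smooth $n$-dimensional manifold with local coordinates $(x^i)_{i=\overline{1,n}}$, $\mathbb{R}$ is the time manifold with coordinate $t$, and $E=J^1(\mathbb{R},M)\to\mathbb{R}\times M$ is the 1-jet vector bundle, with local coordinates $(t,x^i,y_1^i)$ and the coordinate changes displayed in the claim. Latin indices run over $1,\dots,n$ and repeated Latin indices are summed; the index $1$ refers to the single time direction. A nonlinear connection $\Gamma=\left(M_{(1)1}^{(i)},N_{(1)j}^{(i)}\right)$ on $E$ is a family of local functions on the charts of $E$ transforming by $$\tilde M_{(1)1}^{(k)}=M_{(1)1}^{(j)}\left(\frac{dt}{d\tilde t}\right)^2\frac{\partial\tilde x^k}{\partial x^j}-\frac{dt}{d\tilde t}\frac{\partial\tilde y_1^k}{\partial t},\qquad \tilde N_{(1)l}^{(k)}=N_{(1)i}^{(j)}\frac{dt}{d\tilde t}\frac{\partial x^i}{\partial\tilde x^l}\frac{\partial\tilde x^k}{\partial x^j}-\frac{\partial x^i}{\partial\tilde x^l}\frac{\partial\tilde y_1^k}{\partial x^i}.$$ The adapted basis of vector fields is $$\frac{\delta}{\delta t}=\frac{\partial}{\partial t}-M_{(1)1}^{(j)}\frac{\partial}{\partial y_1^j},\quad \frac{\delta}{\delta x^i}=\frac{\partial}{\partial x^i}-N_{(1)i}^{(j)}\frac{\partial}{\partial y_1^j},\quad \frac{\partial}{\partial y_1^i}.$$ $h_{\mathbb{R}}$, $h_M$, $v$ denote the projections of $\mathcal{X}(E)$ onto the summands locally spanned respectively by $\frac{\delta}{\delta t}$,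 by the $\frac{\delta}{\delta x^i}$, by the $\frac{\partial}{\partial y_1^i}$. A $\Gamma$-linear connection on $E$ is a linear connection $\nabla$ on $E$ with $\nabla h_{\mathbb{R}}=0$, $\nabla h_M=0$, $\nabla v=0$, i.e. $\nabla_X(hY)=h(\nabla_XY)$ for all $X,Y\in\mathcal{X}(E)$ and $h\in\{h_{\mathbb{R}},h_M,v\}$. Its adapted coefficients in a chart are the local functions defined by $$\nabla_{\frac{\delta}{\delta t}}\frac{\delta}{\delta t}=\bar G_{11}^1\frac{\delta}{\delta t},\quad \nabla_{\frac{\delta}{\delta t}}\frac{\delta}{\delta x^i}=G_{i1}^k\frac{\delta}{\delta x^k},\quad \nabla_{\frac{\delta}{\delta t}}\frac{\partial}{\partial y_1^i}=G_{(1)(i)1}^{(k)(1)}\frac{\partial}{\partial y_1^k},$$ $$\nabla_{\frac{\delta}{\delta x^j}}\frac{\delta}{\delta t}=\bar L_{1j}^1\frac{\delta}{\delta t},\quad \nabla_{\frac{\delta}{\delta x^j}}\frac{\delta}{\delta x^i}=L_{ij}^k\frac{\delta}{\delta x^k},\quad \nabla_{\frac{\delta}{\delta x^j}}\frac{\partial}{\partial y_1^i}=L_{(1)(i)j}^{(k)(1)}\frac{\partial}{\partial y_1^k},$$ $$\nabla_{\frac{\partial}{\partial y_1^j}}\frac{\delta}{\delta t}=\bar C_{1(j)}^{1(1)}\frac{\delta}{\delta t},\quad \nabla_{\frac{\partial}{\partial y_1^j}}\frac{\delta}{\delta x^i}=C_{i(j)}^{k(1)}\frac{\delta}{\delta x^k},\quad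 \nabla_{\frac{\partial}{\partial y_1^j}}\frac{\partial}{\partial y_1^i}=C_{(1)(i)(j)}^{(k)(1)(1)}\frac{\partial}{\partial y_1^k}.$$ Quantities with a tilde are the corresponding coefficients in the chart $(\tilde t,\tilde x^i,\tilde y_1^i)$. *)

theory Defs
  imports "HOL-Analysis.Analysis"
begin

section \<open>Smooth functions on open subsets of Euclidean spaces\<close>

text \<open>Both notions are only used for open \<open>S\<close>; smoothness is the existence and continuity of
  all iterated directional derivatives.\<close>

primrec k_smooth_on ::
  "nat \<Rightarrow> 'a::euclidean_space set \<Rightarrow> ('a \<Rightarrow> 'b::real_normed_vector) \<Rightarrow> bool" where
  "k_smooth_on 0 S f \<longleftrightarrow> continuous_on S f"
| "k_smooth_on (Suc k) S f \<longleftrightarrow>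
     (\<forall>x\<in>S. f differentiable (at x)) \<and>
     (\<forall>v. k_smooth_on k S (\<lambda>x. frechet_derivative f (at x) v))"

definition smooth_on :: "'a::euclidean_space set \<Rightarrow> ('a \<Rightarrow> 'b::real_normed_vector) \<Rightarrow> bool" where
  "smooth_on S f \<longleftrightarrow> (\<forall>k. k_smooth_on k S f)"


section \<open>Smooth manifolds\<close>

text \<open>A chart is a pair of its domain and its coordinate map; the values of the map outside the
  domain are irrelevant.  The point set and the topology of a manifold are those determined by its
  atlas.\<close>

type_synonym ('p, 'e) chart = "'p set \<times> ('p \<Rightarrow> 'e)"

definition is_chart :: "('p, 'e::euclidean_space) chart \<Rightarrow> bool" where
  "is_chart c \<longleftrightarrow> inj_on (snd c) (fst c) \<and> open (snd c ` fst c)"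

definition chart_inv :: "('p, 'e::euclidean_space) chart \<Rightarrow> 'e \<Rightarrow> 'p" where
  "chart_inv c = inv_into (fst c) (snd c)"

definition compatible ::
  "('p, 'e::euclidean_space) chart \<Rightarrow> ('p, 'e) chart \<Rightarrow> bool" where
  "compatible c d \<longleftrightarrow>
     open (snd c ` (fst c \<inter> fst d)) \<and> open (snd d ` (fst c \<inter> fst d)) \<and>
     smooth_on (snd c ` (fst c \<inter> fst d)) (\<lambda>u. snd d (chart_inv c u)) \<and>
     smooth_on (snd d ` (fst c \<inter> fst d)) (\<lambda>u. snd c (chart_inv d u))"

definition points :: "('p, 'e) chart set \<Rightarrow> 'p set" where
  "points A = (\<Union>c\<in>A. fst c)"

definition max_atlas :: "('p, 'e::euclidean_space) chart set \<Rightarrow> ('p, 'e) chart set" where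
  "max_atlas A = {c. is_chart c \<and> fst c \<subseteq> points A \<and> (\<forall>d\<in>A. compatible c d)}"

definition atlas_topology :: "('p, 'e::euclidean_space) chart set \<Rightarrow> 'p topology" where
  "atlas_topology A =
     topology (\<lambda>U. U \<subseteq> points A \<and> (\<forall>c\<in>A. open (snd c ` (U \<inter> fst c))))"

lemma openin_atlas_topology:
  assumes "\<And>c. c \<in> A \<Longrightarrow> is_chart c"
  shows "openin (atlas_topology A) U \<longleftrightarrow>
           U \<subseteq> points A \<and> (\<forall>c\<in>A. open (snd c ` (U \<inter> fst c)))"
proof -
  have inter: "open (snd c ` (S \<inter> T \<inter> fst c))"
    if "c \<in> A" "open (snd c ` (S \<inter> fst c))" "open (snd c ` (T \<inter> fst c))" for c S T
  proof -
    have "S \<inter> T \<inter> fst c = (S \<inter> fst c) \<inter> (T \<inter> fst c)" by blast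
    moreover have "snd c ` ((S \<inter> fst c) \<inter> (T \<inter> fst c))
        = snd c ` (S \<inter> fst c) \<inter> snd c ` (T \<inter> fst c)"
      using assms[OF that(1)] by (intro inj_on_image_Int[of _ "fst c"]) (auto simp: is_chart_def)
    ultimately show ?thesis using that by (simp add: open_Int)
  qed
  have union: "open (snd c ` (\<Union>K \<inter> fst c))" if "\<forall>S\<in>K. open (snd c ` (S \<inter> fst c))" for c K
  proof -
    have "snd c ` (\<Union>K \<inter> fst c) = (\<Union>S\<in>K. snd c ` (S \<inter> fst c))" by blast
    then show ?thesis using that by auto
  qed
  have "istopology (\<lambda>U. U \<subseteq> points A \<and> (\<forall>c\<in>A. open (snd c ` (U \<inter> fst c))))"
    unfolding istopology_def
  proof (intro conjI allI impI ballI)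
    fix S T c
    assume S: "S \<subseteq> points A \<and> (\<forall>c\<in>A. open (snd c ` (S \<inter> fst c)))"
      and T: "T \<subseteq> points A \<and> (\<forall>c\<in>A. open (snd c ` (T \<inter> fst c)))"
    show "S \<inter> T \<subseteq> points A" using S by auto
    show "open (snd c ` (S \<inter> T \<inter> fst c))" if "c \<in> A"
      by (rule inter) (use that S T in auto)
  next
    fix K c
    assume K: "\<forall>S\<in>K. S \<subseteq> points A \<and> (\<forall>c\<in>A. open (snd c ` (S \<inter> fst c)))"
    show "\<Union>K \<subseteq> points A" using K by auto
    show "open (snd c ` (\<Union>K \<inter> fst c))" if "c \<in> A"
      by (rule union) (use that K in auto)
  qed
  then show ?thesis by (simp add: atlas_topology_def)
qed

definition smooth_manifold :: "('p, 'e::euclidean_space) chart set \<Rightarrow> bool" where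
  "smooth_manifold A \<longleftrightarrow>
     (\<forall>c\<in>A. is_chart c) \<and> (\<forall>c\<in>A. \<forall>d\<in>A. compatible c d) \<and> A = max_atlas A \<and>
     Hausdorff_space (atlas_topology A) \<and> second_countable (atlas_topology A)"

text \<open>Partial derivatives in a chart, applicable to functions given only near the point.\<close>

definition chart_deriv ::
  "('p, 'e::euclidean_space) chart \<Rightarrow> 'e \<Rightarrow> ('p \<Rightarrow> real) \<Rightarrow> 'p \<Rightarrow> real" where
  "chart_deriv c v f p = frechet_derivative (\<lambda>u. f (chart_inv c u)) (at (snd c p)) v"

definition smooth_in_chart ::
  "('p, 'e::euclidean_space) chart \<Rightarrow> ('p \<Rightarrow> 'b::real_normed_vector) \<Rightarrow> bool" where
  "smooth_in_chart c f \<longleftrightarrow> smooth_on (snd c ` fst c) (\<lambda>u. f (chart_inv c u))"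

definition smooth_functions :: "('p, 'e::euclidean_space) chart set \<Rightarrow> ('p \<Rightarrow> real) set" where
  "smooth_functions A = {f. \<forall>c\<in>A. smooth_in_chart c f}"


section \<open>Vector fields and linear connections\<close>

text \<open>Tangent vectors at a point are operators on the global smooth functions, namely
  the linear combinations of the partial derivatives of a chart around the point.  They are set
  to \<open>0\<close> on functions which are not smooth, and vector fields are set to \<open>0\<close> at objects
  which are not points of the manifold, so that equality of vector fields is equality in HOL.\<close>

type_synonym 'p tangent = "('p \<Rightarrow> real) \<Rightarrow> real"

definition coord_vector ::
  "('p, 'e::euclidean_space) chart set \<Rightarrow> ('p, 'e) chart \<Rightarrow> 'e \<Rightarrow> 'p \<Rightarrow> 'p tangent" where
  "coord_vector A c v p = (\<lambda>f. if f \<in> smooth_functions A then chart_deriv c v f p else 0)"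

definition vector_fields ::
  "('p, 'e::euclidean_space) chart set \<Rightarrow> ('p \<Rightarrow> 'p tangent) set" where
  "vector_fields A =
     {X. (\<forall>p. p \<notin> points A \<longrightarrow> X p = (\<lambda>f. 0)) \<and>
         (\<forall>c\<in>A. \<exists>\<xi>. smooth_in_chart c \<xi> \<and> (\<forall>p\<in>fst c. X p = coord_vector A c (\<xi> p) p))}"

definition linear_connection ::
  "('p, 'e::euclidean_space) chart set \<Rightarrow>
   (('p \<Rightarrow> 'p tangent) \<Rightarrow> ('p \<Rightarrow> 'p tangent) \<Rightarrow> ('p \<Rightarrow> 'p tangent)) \<Rightarrow> bool" where
  "linear_connection A nabla \<longleftrightarrow>
     nabla \<in> vector_fields A \<rightarrow>\<^sub>E vector_fields A \<rightarrow>\<^sub>E vector_fields A \<and>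
     (\<forall>X\<in>vector_fields A. \<forall>X'\<in>vector_fields A. \<forall>Y\<in>vector_fields A.
        nabla (\<lambda>p g. X p g + X' p g) Y = (\<lambda>p g. nabla X Y p g + nabla X' Y p g)) \<and>
     (\<forall>f\<in>smooth_functions A. \<forall>X\<in>vector_fields A. \<forall>Y\<in>vector_fields A.
        nabla (\<lambda>p g. f p * X p g) Y = (\<lambda>p g. f p * nabla X Y p g)) \<and>
     (\<forall>X\<in>vector_fields A. \<forall>Y\<in>vector_fields A. \<forall>Y'\<in>vector_fields A.
        nabla X (\<lambda>p g. Y p g + Y' p g) = (\<lambda>p g. nabla X Y p g + nabla X Y' p g)) \<and>
     (\<forall>f\<in>smooth_functions A. \<forall>X\<in>vector_fields A. \<forall>Y\<in>vector_fields A.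
        nabla X (\<lambda>p g. f p * Y p g) = (\<lambda>p g. X p f * Y p g + f p * nabla X Y p g))"

text \<open>The equation \<open>nabla\<^sub>X Y = Z\<close> on an open set \<open>D\<close> for vector fields \<open>X\<close>, \<open>Y\<close>, \<open>Z\<close> defined only
  on \<open>D\<close>.  As \<open>nabla\<close> acts on global vector fields, it is read through the usual localization:
  \<open>X\<close> and \<open>Y\<close> are replaced by global fields that agree with them on smaller open sets (these
  exist around every point by means of bump functions).\<close>

definition connection_eq_on ::
  "('p, 'e::euclidean_space) chart set \<Rightarrow>
   (('p \<Rightarrow> 'p tangent) \<Rightarrow> ('p \<Rightarrow> 'p tangent) \<Rightarrow> ('p \<Rightarrow> 'p tangent)) \<Rightarrow> 'p set \<Rightarrow>
   ('p \<Rightarrow> 'p tangent) \<Rightarrow> ('p \<Rightarrow> 'p tangent) \<Rightarrow> ('p \<Rightarrow> 'p tangent) \<Rightarrow> bool" where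
  "connection_eq_on A nabla D X Y Z \<longleftrightarrow>
     (\<forall>V. \<forall>X'\<in>vector_fields A. \<forall>Y'\<in>vector_fields A.
        openin (atlas_topology A) V \<and> V \<subseteq> D \<and> (\<forall>p\<in>V. X' p = X p) \<and> (\<forall>p\<in>V. Y' p = Y p)
        \<longrightarrow> (\<forall>p\<in>V. nabla X' Y' p = Z p))"


section \<open>The jet bundle \<open>J\<^sup>1(\<real>, M)\<close>\<close>

text \<open>From here on, \<open>A\<close> is the atlas of \<open>M\<close>.\<close>

type_synonym ('m, 'n) mchart = "('m, real ^ 'n) chart"

definition time_atlas :: "(real, real) chart set" where
  "time_atlas = max_atlas {(UNIV, \<lambda>t. t)}"

definition smooth_near :: "('m, 'e::euclidean_space) chart set \<Rightarrow> real \<Rightarrow> (real \<Rightarrow> 'm) \<Rightarrow> bool" where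
  "smooth_near A t \<gamma> \<longleftrightarrow>
     (\<exists>c\<in>A. \<exists>U. open U \<and> t \<in> U \<and> \<gamma> ` U \<subseteq> fst c \<and> smooth_on U (\<lambda>s. snd c (\<gamma> s)))"

definition same_1jet ::
  "('m, 'e::euclidean_space) chart set \<Rightarrow> real \<Rightarrow> (real \<Rightarrow> 'm) \<Rightarrow> (real \<Rightarrow> 'm) \<Rightarrow> bool" where
  "same_1jet A t \<gamma> \<sigma> \<longleftrightarrow>
     \<gamma> t = \<sigma> t \<and>
     (\<forall>c\<in>A. \<gamma> t \<in> fst c \<longrightarrow>
        vector_derivative (\<lambda>s. snd c (\<gamma> s)) (at t) = vector_derivative (\<lambda>s. snd c (\<sigma> s)) (at t))"

type_synonym 'm jet = "real \<times> (real \<Rightarrow> 'm) set"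

definition jet1 :: "('m, 'e::euclidean_space) chart set \<Rightarrow> real \<Rightarrow> (real \<Rightarrow> 'm) \<Rightarrow> 'm jet" where
  "jet1 A t \<gamma> = (t, {\<sigma>. smooth_near A t \<sigma> \<and> same_1jet A t \<gamma> \<sigma>})"

definition jet_space :: "('m, 'e::euclidean_space) chart set \<Rightarrow> 'm jet set" where
  "jet_space A = {jet1 A t \<gamma> | t \<gamma>. smooth_near A t \<gamma>}"

definition jet_rep :: "'m jet \<Rightarrow> real \<Rightarrow> 'm" where
  "jet_rep p = (SOME \<sigma>. \<sigma> \<in> snd p)"

definition jet_base :: "'m jet \<Rightarrow> 'm" where
  "jet_base p = jet_rep p (fst p)"

text \<open>The chart \<open>(t, x\<^sup>i, y\<^sub>1\<^sup>i)\<close> of the jet bundle induced by a coordinate \<open>t\<close> on the time manifold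
  and a chart \<open>(x\<^sup>i)\<close> of \<open>M\<close>; here \<open>y\<^sub>1\<^sup>i = dx\<^sup>i / dt\<close> along a curve representing the jet, the derivative
  being taken with respect to the chosen coordinate \<open>t\<close>.  This gives
  \<open>y'\<^sub>1\<^sup>i = (\<partial>x'\<^sup>i / \<partial>x\<^sup>j) (dt / dt') y\<^sub>1\<^sup>j\<close> under a change of coordinates.\<close>

type_synonym ('m, 'n) jet_index = "(real, real) chart \<times> ('m, 'n) mchart"

definition jet_indices :: "('m, 'n::finite) mchart set \<Rightarrow> ('m, 'n) jet_index set" where
  "jet_indices A = time_atlas \<times> A"

definition jet_chart ::
  "('m, 'n::finite) mchart set \<Rightarrow> ('m, 'n) jet_index \<Rightarrow>
   ('m jet, real \<times> (real ^ 'n) \<times> (real ^ 'n)) chart" where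
  "jet_chart A k =
     ({p \<in> jet_space A. fst p \<in> fst (fst k) \<and> jet_base p \<in> fst (snd k)},
      \<lambda>p. (snd (fst k) (fst p),
           snd (snd k) (jet_base p),
           vector_derivative (\<lambda>s. snd (snd k) (jet_rep p (chart_inv (fst k) s)))
             (at (snd (fst k) (fst p)))))"

definition jet_dom :: "('m, 'n::finite) mchart set \<Rightarrow> ('m, 'n) jet_index \<Rightarrow> 'm jet set" where
  "jet_dom A k = fst (jet_chart A k)"

definition jet_atlas ::
  "('m, 'n::finite) mchart set \<Rightarrow> ('m jet, real \<times> (real ^ 'n) \<times> (real ^ 'n)) chart set" where
  "jet_atlas A = jet_chart A ` jet_indices A"

definition t_coord :: "('m, 'n::finite) mchart set \<Rightarrow> ('m, 'n) jet_index \<Rightarrow> 'm jet \<Rightarrow> real" where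
  "t_coord A k p = fst (snd (jet_chart A k) p)"

definition x_coord ::
  "('m, 'n::finite) mchart set \<Rightarrow> ('m, 'n) jet_index \<Rightarrow> 'n \<Rightarrow> 'm jet \<Rightarrow> real" where
  "x_coord A k i p = fst (snd (snd (jet_chart A k) p)) $ i"

definition y_coord ::
  "('m, 'n::finite) mchart set \<Rightarrow> ('m, 'n) jet_index \<Rightarrow> 'n \<Rightarrow> 'm jet \<Rightarrow> real" where
  "y_coord A k i p = snd (snd (snd (jet_chart A k) p)) $ i"

definition t_dir :: "real \<times> (real ^ 'n::finite) \<times> (real ^ 'n)" where
  "t_dir = (1, 0, 0)"

definition x_dir :: "'n::finite \<Rightarrow> real \<times> (real ^ 'n) \<times> (real ^ 'n)" where
  "x_dir i = (0, axis i 1, 0)"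

definition y_dir :: "'n::finite \<Rightarrow> real \<times> (real ^ 'n) \<times> (real ^ 'n)" where
  "y_dir i = (0, 0, axis i 1)"

text \<open>Derivatives of the coordinates \<open>(t', x', y')\<close> of the chart \<open>k'\<close> with respect to the
  coordinates \<open>(t, x, y)\<close> of the chart \<open>k\<close>: in this order of arguments,
  \<open>dt'/dt\<close>, \<open>d\<^sup>2t'/dt\<^sup>2\<close>, \<open>\<partial>x'\<^sup>r/\<partial>x\<^sup>i\<close>, \<open>\<partial>\<^sup>2x'\<^sup>r/\<partial>x\<^sup>i\<partial>x\<^sup>j\<close>, \<open>\<partial>y'\<^sup>r/\<partial>t\<close>, \<open>\<partial>y'\<^sup>r/\<partial>x\<^sup>i\<close>.\<close>

definition d_tt where
  "d_tt A k k' p = chart_deriv (jet_chart A k) t_dir (t_coord A k') p"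

definition d2_tt where
  "d2_tt A k k' p = chart_deriv (jet_chart A k) t_dir (d_tt A k k') p"

definition d_xx where
  "d_xx A k k' r i p = chart_deriv (jet_chart A k) (x_dir i) (x_coord A k' r) p"

definition d2_xx where
  "d2_xx A k k' r i j p = chart_deriv (jet_chart A k) (x_dir i) (d_xx A k k' r j) p"

definition d_yt where
  "d_yt A k k' r p = chart_deriv (jet_chart A k) t_dir (y_coord A k' r) p"

definition d_yx where
  "d_yx A k k' r i p = chart_deriv (jet_chart A k) (x_dir i) (y_coord A k' r) p"


section \<open>Nonlinear connections and adapted bases\<close>

text \<open>\<open>M_comp \<Gamma> k j\<close> is \<open>M\<^sup>j\<close> and \<open>N_comp \<Gamma> k j i\<close> is \<open>N\<^sup>j\<^sub>i\<close> in the chart \<open>k\<close>; here and below the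
  upper index comes first.\<close>

record ('m, 'n) nonlinear_comps =
  M_comp :: "('m, 'n) jet_index \<Rightarrow> 'n \<Rightarrow> 'm jet \<Rightarrow> real"
  N_comp :: "('m, 'n) jet_index \<Rightarrow> 'n \<Rightarrow> 'n \<Rightarrow> 'm jet \<Rightarrow> real"

definition nonlinear_connection ::
  "('m, 'n::finite) mchart set \<Rightarrow> ('m, 'n) nonlinear_comps \<Rightarrow> bool" where
  "nonlinear_connection A \<Gamma> \<longleftrightarrow>
     (\<forall>k\<in>jet_indices A. \<forall>j i.
        smooth_in_chart (jet_chart A k) (M_comp \<Gamma> k j) \<and>
        smooth_in_chart (jet_chart A k) (N_comp \<Gamma> k j i)) \<and>
     (\<forall>k\<in>jet_indices A. \<forall>k'\<in>jet_indices A. \<forall>p\<in>jet_dom A k \<inter> jet_dom A k'.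
        (\<forall>r. M_comp \<Gamma> k' r p =
           (\<Sum>j\<in>UNIV. M_comp \<Gamma> k j p * (d_tt A k' k p)\<^sup>2 * d_xx A k k' r j p)
           - d_tt A k' k p * d_yt A k k' r p) \<and>
        (\<forall>r l. N_comp \<Gamma> k' r l p =
           (\<Sum>i\<in>UNIV. \<Sum>j\<in>UNIV.
              N_comp \<Gamma> k j i p * d_tt A k' k p * d_xx A k' k i l p * d_xx A k k' r j p)
           - (\<Sum>i\<in>UNIV. d_xx A k' k i l p * d_yx A k k' r i p)))"

definition del_t where
  "del_t A k p = coord_vector (jet_atlas A) (jet_chart A k) t_dir p"

definition del_x where
  "del_x A k i p = coord_vector (jet_atlas A) (jet_chart A k) (x_dir i) p"

definition del_y where
  "del_y A k i p = coord_vector (jet_atlas A) (jet_chart A k) (y_dir i) p"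

definition delta_t ::
  "('m, 'n::finite) mchart set \<Rightarrow> ('m, 'n) nonlinear_comps \<Rightarrow> ('m, 'n) jet_index \<Rightarrow>
   'm jet \<Rightarrow> 'm jet tangent" where
  "delta_t A \<Gamma> k p = (\<lambda>f. del_t A k p f - (\<Sum>j\<in>UNIV. M_comp \<Gamma> k j p * del_y A k j p f))"

definition delta_x ::
  "('m, 'n::finite) mchart set \<Rightarrow> ('m, 'n) nonlinear_comps \<Rightarrow> ('m, 'n) jet_index \<Rightarrow> 'n \<Rightarrow>
   'm jet \<Rightarrow> 'm jet tangent" where
  "delta_x A \<Gamma> k i p = (\<lambda>f. del_x A k i p f - (\<Sum>j\<in>UNIV. N_comp \<Gamma> k j i p * del_y A k j p f))"

definition span_t where
  "span_t A \<Gamma> p =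
     {(\<lambda>f. a * delta_t A \<Gamma> k p f) | a k. k \<in> jet_indices A \<and> p \<in> jet_dom A k}"

definition span_x where
  "span_x A \<Gamma> p =
     {(\<lambda>f. \<Sum>i\<in>UNIV. a i * delta_x A \<Gamma> k i p f) | a k. k \<in> jet_indices A \<and> p \<in> jet_dom A k}"

definition span_y where
  "span_y A p =
     {(\<lambda>f. \<Sum>i\<in>UNIV. a i * del_y A k i p f) | a k. k \<in> jet_indices A \<and> p \<in> jet_dom A k}"

text \<open>Projection of \<open>X\<close> onto the first of three pointwise complementary summands on the set \<open>P\<close>.\<close>

definition proj_summand ::
  "'p set \<Rightarrow> ('p \<Rightarrow> 'p tangent set) \<Rightarrow> ('p \<Rightarrow> 'p tangent set) \<Rightarrow> ('p \<Rightarrow> 'p tangent set) \<Rightarrow>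
   ('p \<Rightarrow> 'p tangent) \<Rightarrow> ('p \<Rightarrow> 'p tangent)" where
  "proj_summand P H1 H2 H3 X =
     (\<lambda>p. if p \<in> P
          then THE U. U \<in> H1 p \<and> (\<exists>V\<in>H2 p. \<exists>W\<in>H3 p. X p = (\<lambda>f. U f + V f + W f))
          else (\<lambda>f. 0))"

definition h_R where
  "h_R A \<Gamma> = proj_summand (jet_space A) (span_t A \<Gamma>) (span_x A \<Gamma>) (span_y A)"

definition h_M where
  "h_M A \<Gamma> = proj_summand (jet_space A) (span_x A \<Gamma>) (span_t A \<Gamma>) (span_y A)"

definition v_proj where
  "v_proj A \<Gamma> = proj_summand (jet_space A) (span_y A) (span_t A \<Gamma>) (span_x A \<Gamma>)"


section \<open>\<open>\<Gamma>\<close>-linear connections and their adapted coefficients\<close>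

definition gamma_linear_connection ::
  "('m, 'n::finite) mchart set \<Rightarrow> ('m, 'n) nonlinear_comps \<Rightarrow>
   (('m jet \<Rightarrow> 'm jet tangent) \<Rightarrow> ('m jet \<Rightarrow> 'm jet tangent) \<Rightarrow> ('m jet \<Rightarrow> 'm jet tangent)) \<Rightarrow> bool"
  where
  "gamma_linear_connection A \<Gamma> nabla \<longleftrightarrow>
     linear_connection (jet_atlas A) nabla \<and>
     (\<forall>h\<in>{h_R A \<Gamma>, h_M A \<Gamma>, v_proj A \<Gamma>}.
        \<forall>X\<in>vector_fields (jet_atlas A). \<forall>Y\<in>vector_fields (jet_atlas A).
          nabla X (h Y) = h (nabla X Y))"

text \<open>The letters \<open>G\<close>, \<open>L\<close>, \<open>C\<close> refer to the direction of differentiation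
  (\<open>\<delta>/\<delta>t\<close>, \<open>\<delta>/\<delta>x\<close>, \<open>\<partial>/\<partial>y\<close>), the suffixes \<open>bar\<close>, \<open>x\<close>, \<open>y\<close> to the differentiated basis fields
  (\<open>\<delta>/\<delta>t\<close>, \<open>\<delta>/\<delta>x\<close>, \<open>\<partial>/\<partial>y\<close>).  The arguments are the chart, the upper index, the index of the
  differentiated field and the index of the direction (those among these indices which are not the
  time index \<open>1\<close>), and the point.\<close>

record ('m, 'n) adapted_comps =
  G_bar :: "('m, 'n) jet_index \<Rightarrow> 'm jet \<Rightarrow> real"
  G_x   :: "('m, 'n) jet_index \<Rightarrow> 'n \<Rightarrow> 'n \<Rightarrow> 'm jet \<Rightarrow> real"
  G_y   :: "('m, 'n) jet_index \<Rightarrow> 'n \<Rightarrow> 'n \<Rightarrow> 'm jet \<Rightarrow> real"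
  L_bar :: "('m, 'n) jet_index \<Rightarrow> 'n \<Rightarrow> 'm jet \<Rightarrow> real"
  L_x   :: "('m, 'n) jet_index \<Rightarrow> 'n \<Rightarrow> 'n \<Rightarrow> 'n \<Rightarrow> 'm jet \<Rightarrow> real"
  L_y   :: "('m, 'n) jet_index \<Rightarrow> 'n \<Rightarrow> 'n \<Rightarrow> 'n \<Rightarrow> 'm jet \<Rightarrow> real"
  C_bar :: "('m, 'n) jet_index \<Rightarrow> 'n \<Rightarrow> 'm jet \<Rightarrow> real"
  C_x   :: "('m, 'n) jet_index \<Rightarrow> 'n \<Rightarrow> 'n \<Rightarrow> 'n \<Rightarrow> 'm jet \<Rightarrow> real"
  C_y   :: "('m, 'n) jet_index \<Rightarrow> 'n \<Rightarrow> 'n \<Rightarrow> 'n \<Rightarrow> 'm jet \<Rightarrow> real"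

definition has_adapted_coefficients ::
  "('m, 'n::finite) mchart set \<Rightarrow> ('m, 'n) nonlinear_comps \<Rightarrow>
   (('m jet \<Rightarrow> 'm jet tangent) \<Rightarrow> ('m jet \<Rightarrow> 'm jet tangent) \<Rightarrow> ('m jet \<Rightarrow> 'm jet tangent)) \<Rightarrow>
   ('m, 'n) adapted_comps \<Rightarrow> bool" where
  "has_adapted_coefficients A \<Gamma> nabla K \<longleftrightarrow>
     (\<forall>k\<in>jet_indices A.
       (let eq = connection_eq_on (jet_atlas A) nabla (jet_dom A k);
            dt = delta_t A \<Gamma> k; dx = delta_x A \<Gamma> k; dy = del_y A k
        in
          eq dt dt (\<lambda>p f. G_bar K k p * dt p f) \<and>
          (\<forall>i. eq dt (dx i) (\<lambda>p f. \<Sum>r\<in>UNIV. G_x K k r i p * dx r p f)) \<and>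
          (\<forall>i. eq dt (dy i) (\<lambda>p f. \<Sum>r\<in>UNIV. G_y K k r i p * dy r p f)) \<and>
          (\<forall>j. eq (dx j) dt (\<lambda>p f. L_bar K k j p * dt p f)) \<and>
          (\<forall>i j. eq (dx j) (dx i) (\<lambda>p f. \<Sum>r\<in>UNIV. L_x K k r i j p * dx r p f)) \<and>
          (\<forall>i j. eq (dx j) (dy i) (\<lambda>p f. \<Sum>r\<in>UNIV. L_y K k r i j p * dy r p f)) \<and>
          (\<forall>j. eq (dy j) dt (\<lambda>p f. C_bar K k j p * dt p f)) \<and>
          (\<forall>i j. eq (dy j) (dx i) (\<lambda>p f. \<Sum>r\<in>UNIV. C_x K k r i j p * dx r p f)) \<and>
          (\<forall>i j. eq (dy j) (dy i) (\<lambda>p f. \<Sum>r\<in>UNIV. C_y K k r i j p * dy r p f))))"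

text \<open>Families of (smooth) local functions on the charts of the jet bundle, normalized to be \<open>0\<close>
  outside the domains of the charts so that equality of families is equality in HOL.\<close>

definition local_function ::
  "('m, 'n::finite) mchart set \<Rightarrow> (('m, 'n) jet_index \<Rightarrow> 'm jet \<Rightarrow> real) \<Rightarrow> bool" where
  "local_function A F \<longleftrightarrow>
     (\<forall>k\<in>jet_indices A. smooth_in_chart (jet_chart A k) (F k)) \<and>
     (\<forall>k p. \<not> (k \<in> jet_indices A \<and> p \<in> jet_dom A k) \<longrightarrow> F k p = 0)"

definition local_components ::
  "('m, 'n::finite) mchart set \<Rightarrow> ('m, 'n) adapted_comps \<Rightarrow> bool" where
  "local_components A K \<longleftrightarrow>
     local_function A (G_bar K) \<and>
     (\<forall>r i. local_function A (\<lambda>k. G_x K k r i)) \<and>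
     (\<forall>r i. local_function A (\<lambda>k. G_y K k r i)) \<and>
     (\<forall>j. local_function A (\<lambda>k. L_bar K k j)) \<and>
     (\<forall>r i j. local_function A (\<lambda>k. L_x K k r i j)) \<and>
     (\<forall>r i j. local_function A (\<lambda>k. L_y K k r i j)) \<and>
     (\<forall>j. local_function A (\<lambda>k. C_bar K k j)) \<and>
     (\<forall>r i j. local_function A (\<lambda>k. C_x K k r i j)) \<and>
     (\<forall>r i j. local_function A (\<lambda>k. C_y K k r i j))"

text \<open>The chart \<open>k'\<close> is the one with coordinates \<open>(t', x', y')\<close> (with a tilde).\<close>

definition transformation_rules ::
  "('m, 'n::finite) mchart set \<Rightarrow> ('m, 'n) adapted_comps \<Rightarrow> bool" where
  "transformation_rules A K \<longleftrightarrow>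
     (\<forall>k\<in>jet_indices A. \<forall>k'\<in>jet_indices A. \<forall>p\<in>jet_dom A k \<inter> jet_dom A k'.
        G_bar K k p = G_bar K k' p * d_tt A k k' p + d_tt A k' k p * d2_tt A k k' p \<and>
        (\<forall>l i. G_x K k l i p =
           (\<Sum>r\<in>UNIV. \<Sum>j\<in>UNIV.
              G_x K k' r j p * d_xx A k' k l r p * d_xx A k k' j i p * d_tt A k k' p)) \<and>
        (\<forall>l i. G_y K k l i p =
           (\<Sum>r\<in>UNIV. \<Sum>j\<in>UNIV.
              G_y K k' r j p * d_xx A k' k l r p * d_xx A k k' j i p * d_tt A k k' p)
           + (if i = l then 1 else 0) * (d_tt A k k' p)\<^sup>2 * d2_tt A k' k p) \<and>
        (\<forall>j. L_bar K k j p = (\<Sum>l\<in>UNIV. L_bar K k' l p * d_xx A k k' l j p)) \<and>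
        (\<forall>r i j. L_x K k r i j p =
           (\<Sum>s\<in>UNIV. \<Sum>a\<in>UNIV. \<Sum>b\<in>UNIV.
              L_x K k' s a b p * d_xx A k' k r s p * d_xx A k k' a i p * d_xx A k k' b j p)
           + (\<Sum>s\<in>UNIV. d_xx A k' k r s p * d2_xx A k k' s i j p)) \<and>
        (\<forall>r i j. L_y K k r i j p =
           (\<Sum>s\<in>UNIV. \<Sum>a\<in>UNIV. \<Sum>b\<in>UNIV.
              L_y K k' s a b p * d_xx A k' k r s p * d_xx A k k' a i p * d_xx A k k' b j p)
           + (\<Sum>s\<in>UNIV. d_xx A k' k r s p * d2_xx A k k' s i j p)) \<and>
        (\<forall>i. C_bar K k i p =
           (\<Sum>j\<in>UNIV. C_bar K k' j p * d_xx A k k' j i p * d_tt A k' k p)) \<and>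
        (\<forall>r i j. C_x K k r i j p =
           (\<Sum>s\<in>UNIV. \<Sum>a\<in>UNIV. \<Sum>b\<in>UNIV.
              C_x K k' s a b p * d_xx A k' k r s p * d_xx A k k' a i p * d_xx A k k' b j p
                * d_tt A k' k p)) \<and>
        (\<forall>r i j. C_y K k r i j p =
           (\<Sum>s\<in>UNIV. \<Sum>a\<in>UNIV. \<Sum>b\<in>UNIV.
              C_y K k' s a b p * d_xx A k' k r s p * d_xx A k k' a i p * d_xx A k k' b j p
                * d_tt A k' k p)))"

end

theory Submission
  imports Defs
begin

text \<open>
  At a point of the jet bundle, the adapted basis of a chart identifies the tangent vectors with
  \<open>\<real> \<times> \<real>\<^sup>n \<times> \<real>\<^sup>n\<close>.  In these frames a vector field is a function with values in this space, and the
  nine families of adapted coefficients are the blocks of one bilinear map \<open>\<omega>\<close> (\<open>jet_coeffs\<close>): the frame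
  fields \<open>U\<close>, \<open>V\<close> with constant components \<open>u\<close>, \<open>v\<close> satisfy \<open>nabla\<^sub>V U = \<omega>(u, v)\<close>.

  The first half of the proof concerns arbitrary frames on an arbitrary Hausdorff manifold.  A linear
  connection is local (\<open>conn_local\<close>), so by the Leibniz rule
  \<open>nabla\<^sub>X Y = d\<eta>(\<xi>) + \<omega>(\<eta>, \<xi>)\<close> for fields \<open>X\<close>, \<open>Y\<close> with components \<open>\<xi>\<close>, \<open>\<eta>\<close> (\<open>conn_formula\<close>).  Let \<open>B\<close> be the
  change of frames between two charts.  If \<open>\<xi>\<close> and \<open>\<eta>\<close> are constant in the first chart, then the formula
  in the second chart gives the law \<open>B \<omega>(u, v) = \<omega>'(B u, B v) + d(B u)(v)\<close>
  (\<open>coeffs_transform_necessary\<close>).  Conversely, this law is exactly what makes the right-hand side of the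
  formula independent of the chart (\<open>conn_value_chg\<close>), so that the formula defines a connection
  (\<open>conn_of\<close>).  Hence linear connections are the same as smooth families \<open>\<omega>\<close> which obey the law
  (\<open>coeffs_exist\<close>, \<open>coeffs_unique\<close>, \<open>conn_of_conn\<close>, \<open>conn_unique\<close>).

  The second half specializes to the adapted frames.  The transformation law of \<open>\<Gamma>\<close> says that \<open>B\<close> is
  block diagonal with the blocks \<open>dt'/dt\<close>, \<open>\<partial>x'/\<partial>x\<close> and \<open>(\<partial>x'/\<partial>x) (dt/dt')\<close> (\<open>chg_block\<close>).  The projections
  \<open>h_R\<close>, \<open>h_M\<close>, \<open>v_proj\<close> are constant in the frames, so that they are parallel if and only if \<open>\<omega>\<close> preserves
  the blocks of its first argument (\<open>gamma_linear_iff\<close>); this leaves precisely the nine families.  The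
  derivative of \<open>B\<close> consists of second derivatives of the coordinates, and written out in blocks the law
  for \<open>\<omega>\<close> becomes the nine transformation rules (\<open>pulled_back_basis\<close>, \<open>transformation_rules_iff\<close>).

  Connections act on global fields.  The passage from local to global objects needs bump functions, and
  therefore that the jets form a Hausdorff manifold (\<open>jet_chart_compatible\<close>, \<open>jet_hausdorff\<close>).
\<close>


section \<open>Calculus of smooth functions\<close>

lemma has_derivative_cong_open:
  assumes "open S" "x \<in> S" "\<And>y. y \<in> S \<Longrightarrow> f y = g y"
  shows "(f has_derivative D) (at x) \<longleftrightarrow> (g has_derivative D) (at x)"
  using assms by (metis has_derivative_transform_within_open)

lemma frechet_derivative_cong_open:
  assumes "open S" "x \<in> S" "\<And>y. y \<in> S \<Longrightarrow> f y = g y"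
  shows "frechet_derivative f (at x) = frechet_derivative g (at x)"
  unfolding frechet_derivative_def using has_derivative_cong_open[OF assms] by simp

lemma differentiable_cong_open:
  assumes "open S" "x \<in> S" "\<And>y. y \<in> S \<Longrightarrow> f y = g y"
  shows "f differentiable (at x) \<longleftrightarrow> g differentiable (at x)"
  unfolding differentiable_def using has_derivative_cong_open[OF assms] by simp

lemma k_smooth_on_Suc_imp: "k_smooth_on (Suc k) S f \<Longrightarrow> k_smooth_on k S f"
proof (induction k arbitrary: f)
  case 0
  then show ?case
    by (simp add: continuous_at_imp_continuous_on differentiable_imp_continuous_within)
next
  case (Suc k)
  then show ?case by (metis k_smooth_on.simps(2))
qed

lemma k_smooth_on_cong_imp:
  assumes "open S" "k_smooth_on k S f" "\<And>y. y \<in> S \<Longrightarrow> f y = g y"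
  shows "k_smooth_on k S g"
  using assms(2,3)
proof (induction k arbitrary: f g)
  case 0
  then show ?case by (metis continuous_on_cong k_smooth_on.simps(1))
next
  case (Suc k)
  have "g differentiable (at x)" if "x \<in> S" for x
    using differentiable_cong_open[OF assms(1) that, of f g] Suc.prems that by simp
  moreover have "k_smooth_on k S (\<lambda>x. frechet_derivative g (at x) v)" for v
  proof (rule Suc.IH)
    show "k_smooth_on k S (\<lambda>x. frechet_derivative f (at x) v)"
      using Suc.prems by simp
    show "frechet_derivative f (at y) v = frechet_derivative g (at y) v" if "y \<in> S" for y
      using frechet_derivative_cong_open[OF assms(1) that, of f g] Suc.prems by simp
  qed
  ultimately show ?case by simp
qed

lemma k_smooth_on_subset:
  "k_smooth_on k S f \<Longrightarrow> T \<subseteq> S \<Longrightarrow> k_smooth_on k T f"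
  by (induction k arbitrary: f) (auto intro: continuous_on_subset)

lemma k_smooth_on_local:
  assumes "\<And>x. x \<in> S \<Longrightarrow> \<exists>T. open T \<and> x \<in> T \<and> k_smooth_on k T f"
  shows "k_smooth_on k S f"
  using assms
proof (induction k arbitrary: f)
  case 0
  have "continuous (at x) f" if "x \<in> S" for x
    using 0[OF that] by (auto simp: continuous_on_eq_continuous_at)
  then show ?case by (simp add: continuous_at_imp_continuous_on)
next
  case (Suc k)
  have "f differentiable (at x)" if "x \<in> S" for x
    using Suc.prems[OF that] unfolding k_smooth_on.simps by blast
  moreover have "k_smooth_on k S (\<lambda>x. frechet_derivative f (at x) v)" for v
  proof (rule Suc.IH)
    show "\<exists>T. open T \<and> x \<in> T \<and> k_smooth_on k T (\<lambda>x. frechet_derivative f (at x) v)"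
      if "x \<in> S" for x
      using Suc.prems[OF that] unfolding k_smooth_on.simps by blast
  qed
  ultimately show ?case by simp
qed

lemma k_smooth_on_const: "k_smooth_on k S (\<lambda>x. c)"
  by (induction k arbitrary: c) auto

lemma frechet_derivative_eqI: "(f has_derivative D) (at x) \<Longrightarrow> frechet_derivative f (at x) = D"
  using frechet_derivative_at by metis

lemma k_smooth_on_has_derivative:
  assumes "k_smooth_on (Suc k) S f" "x \<in> S"
  shows "(f has_derivative frechet_derivative f (at x)) (at x)"
  using assms frechet_derivative_works by auto

lemma k_smooth_on_SucI:
  assumes "open S" "\<And>x. x \<in> S \<Longrightarrow> (f has_derivative D x) (at x)"
    and "\<And>v. k_smooth_on k S (\<lambda>x. D x v)"
  shows "k_smooth_on (Suc k) S f"
proof -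
  have "k_smooth_on k S (\<lambda>x. frechet_derivative f (at x) v)" for v
    by (rule k_smooth_on_cong_imp[OF assms(1) assms(3)[of v]])
      (use assms(2) frechet_derivative_eqI in metis)
  then show ?thesis using assms(2) by (auto simp: differentiable_def)
qed

lemma k_smooth_on_add:
  assumes "open S" "k_smooth_on k S f" "k_smooth_on k S g"
  shows "k_smooth_on k S (\<lambda>x. f x + g x)"
  using assms(2,3)
proof (induction k arbitrary: f g)
  case 0
  then show ?case by (auto intro: continuous_on_add)
next
  case (Suc k)
  show ?case
  proof (rule k_smooth_on_SucI[OF assms(1)])
    show "((\<lambda>x. f x + g x) has_derivative
        (\<lambda>v. frechet_derivative f (at x) v + frechet_derivative g (at x) v)) (at x)"
      if "x \<in> S" for x
      using that by (intro has_derivative_add k_smooth_on_has_derivative[OF Suc.prems(1)]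
          k_smooth_on_has_derivative[OF Suc.prems(2)])
    show "k_smooth_on k S (\<lambda>x. frechet_derivative f (at x) v + frechet_derivative g (at x) v)" for v
      using Suc.prems by (intro Suc.IH) simp_all
  qed
qed

lemma k_smooth_on_bounded_linear:
  assumes "bounded_linear L" "open S" "k_smooth_on k S f"
  shows "k_smooth_on k S (\<lambda>x. L (f x))"
  using assms(3)
proof (induction k arbitrary: f)
  case 0
  then show ?case
    using assms(1) by (auto intro: bounded_linear.continuous_on)
next
  case (Suc k)
  show ?case
  proof (rule k_smooth_on_SucI[OF assms(2)])
    show "((\<lambda>x. L (f x)) has_derivative (\<lambda>v. L (frechet_derivative f (at x) v))) (at x)"
      if "x \<in> S" for x
      using that
      by (intro bounded_linear.has_derivative[OF assms(1)] k_smooth_on_has_derivative[OF Suc.prems])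
    show "k_smooth_on k S (\<lambda>x. L (frechet_derivative f (at x) v))" for v
      using Suc.prems by (intro Suc.IH) simp_all
  qed
qed

lemma k_smooth_on_bounded_bilinear:
  assumes "bounded_bilinear B" "open S" "k_smooth_on k S f" "k_smooth_on k S g"
  shows "k_smooth_on k S (\<lambda>x. B (f x) (g x))"
  using assms(3,4)
proof (induction k arbitrary: f g)
  case 0
  then show ?case
    using assms(1) by (auto intro: bounded_bilinear.continuous_on)
next
  case (Suc k)
  show ?case
  proof (rule k_smooth_on_SucI[OF assms(2)])
    show "((\<lambda>x. B (f x) (g x)) has_derivative (\<lambda>v. B (f x) (frechet_derivative g (at x) v)
        + B (frechet_derivative f (at x) v) (g x))) (at x)" if "x \<in> S" for x
      using that by (intro bounded_bilinear.FDERIV[OF assms(1)]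
          k_smooth_on_has_derivative[OF Suc.prems(1)] k_smooth_on_has_derivative[OF Suc.prems(2)])
    have "k_smooth_on k S f" "k_smooth_on k S g"
      using Suc.prems by (blast intro: k_smooth_on_Suc_imp)+
    then show "k_smooth_on k S (\<lambda>x. B (f x) (frechet_derivative g (at x) v)
        + B (frechet_derivative f (at x) v) (g x))" for v
      using Suc.prems by (intro k_smooth_on_add assms(2) Suc.IH) simp_all
  qed
qed

lemma k_smooth_on_sum:
  assumes "open S" "\<And>i. i \<in> I \<Longrightarrow> k_smooth_on k S (f i)"
  shows "k_smooth_on k S (\<lambda>x. \<Sum>i\<in>I. f i x)"
  using assms(2)
  by (induction I rule: infinite_finite_induct)
    (auto intro!: k_smooth_on_const k_smooth_on_add assms(1))

lemma linear_Basis_expansion: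
  fixes w :: "'a::euclidean_space"
  assumes "linear L"
  shows "L w = (\<Sum>b\<in>Basis. (w \<bullet> b) *\<^sub>R L b)"
proof -
  have "L (\<Sum>b\<in>Basis. (w \<bullet> b) *\<^sub>R b) = (\<Sum>b\<in>Basis. (w \<bullet> b) *\<^sub>R L b)"
    by (simp only: linear_sum[OF assms] linear_scale[OF assms])
  then show ?thesis by (simp add: euclidean_representation)
qed

text \<open>The directional derivative of a composition is a sum, over an orthonormal basis, of products
  of directional derivatives of the two factors; this is what the induction on the order of
  differentiability runs on.\<close>

lemma k_smooth_on_compose:
  fixes f :: "'a::euclidean_space \<Rightarrow> 'b::euclidean_space" and g :: "'b \<Rightarrow> 'c::real_normed_vector"
  assumes "open S" "open T" "k_smooth_on k S f" "k_smooth_on k T g" "f ` S \<subseteq> T"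
  shows "k_smooth_on k S (\<lambda>x. g (f x))"
  using assms(3,4)
proof (induction k arbitrary: g)
  case 0
  then show ?case
    using assms(5) by (auto intro: continuous_on_compose2)
next
  case (Suc k)
  let ?D = "\<lambda>x v. \<Sum>b\<in>Basis. (frechet_derivative f (at x) v \<bullet> b) *\<^sub>R frechet_derivative g (at (f x)) b"
  have f: "k_smooth_on k S f" using Suc.prems(1) by (rule k_smooth_on_Suc_imp)
  show ?case
  proof (rule k_smooth_on_SucI[OF assms(1), of _ ?D])
    fix x assume x: "x \<in> S"
    have g: "(g has_derivative frechet_derivative g (at (f x))) (at (f x))"
      using k_smooth_on_has_derivative[OF Suc.prems(2)] x assms(5) by auto
    then have lin: "linear (frechet_derivative g (at (f x)))"
      by (rule has_derivative_linear)
    have eq: "(\<lambda>v. frechet_derivative g (at (f x)) (frechet_derivative f (at x) v)) = ?D x"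
      by (rule ext) (rule linear_Basis_expansion[OF lin])
    show "((\<lambda>x. g (f x)) has_derivative ?D x) (at x)"
      using has_derivative_compose[OF k_smooth_on_has_derivative[OF Suc.prems(1) x] g]
      unfolding eq .
  next
    fix v
    have "k_smooth_on k S (\<lambda>x. frechet_derivative f (at x) v)" using Suc.prems(1) by simp
    moreover have "k_smooth_on k S (\<lambda>x. frechet_derivative g (at (f x)) b)" for b
      by (rule Suc.IH[OF f]) (use Suc.prems in simp)
    ultimately show "k_smooth_on k S (\<lambda>x. ?D x v)"
      by (intro k_smooth_on_sum assms(1) k_smooth_on_bounded_bilinear[OF bounded_bilinear_scaleR]
          k_smooth_on_bounded_linear[OF bounded_linear_inner_left])
  qed
qed

lemma smooth_on_cong_imp:
  assumes "open S" "smooth_on S f" "\<And>y. y \<in> S \<Longrightarrow> f y = g y"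
  shows "smooth_on S g"
  using assms(2) k_smooth_on_cong_imp[OF assms(1) _ assms(3)] by (auto simp: smooth_on_def)

lemma smooth_on_subset: "smooth_on S f \<Longrightarrow> T \<subseteq> S \<Longrightarrow> smooth_on T f"
  by (auto simp: smooth_on_def intro: k_smooth_on_subset)

lemma smooth_on_local:
  assumes "\<And>x. x \<in> S \<Longrightarrow> \<exists>T. open T \<and> x \<in> T \<and> smooth_on T f"
  shows "smooth_on S f"
  unfolding smooth_on_def
proof
  show "k_smooth_on k S f" for k
    by (rule k_smooth_on_local) (use assms in \<open>unfold smooth_on_def, blast\<close>)
qed

lemma smooth_on_const: "smooth_on S (\<lambda>x. c)"
  by (simp add: smooth_on_def k_smooth_on_const)

lemma smooth_on_add:
  "open S \<Longrightarrow> smooth_on S f \<Longrightarrow> smooth_on S g \<Longrightarrow> smooth_on S (\<lambda>x. f x + g x)"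
  by (simp add: smooth_on_def k_smooth_on_add)

lemma smooth_on_sum:
  "open S \<Longrightarrow> (\<And>i. i \<in> I \<Longrightarrow> smooth_on S (f i)) \<Longrightarrow> smooth_on S (\<lambda>x. \<Sum>i\<in>I. f i x)"
  by (simp add: smooth_on_def k_smooth_on_sum)

lemma smooth_on_bounded_linear:
  "bounded_linear L \<Longrightarrow> open S \<Longrightarrow> smooth_on S f \<Longrightarrow> smooth_on S (\<lambda>x. L (f x))"
  by (simp add: smooth_on_def k_smooth_on_bounded_linear)

lemma smooth_on_bounded_bilinear:
  "bounded_bilinear B \<Longrightarrow> open S \<Longrightarrow> smooth_on S f \<Longrightarrow> smooth_on S g
    \<Longrightarrow> smooth_on S (\<lambda>x. B (f x) (g x))"
  by (simp add: smooth_on_def k_smooth_on_bounded_bilinear)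

lemma smooth_on_ident: "open S \<Longrightarrow> smooth_on S (\<lambda>x. x)"
proof -
  assume S: "open S"
  have "k_smooth_on k S (\<lambda>x. x)" for k
  proof (cases k)
    case (Suc j)
    then show ?thesis
      using k_smooth_on_SucI[OF S has_derivative_ident] k_smooth_on_const by blast
  qed (simp add: continuous_on_id)
  then show ?thesis by (simp add: smooth_on_def)
qed

lemma smooth_on_linear: "bounded_linear L \<Longrightarrow> open S \<Longrightarrow> smooth_on S L"
  using smooth_on_bounded_linear[OF _ _ smooth_on_ident] by blast

lemma smooth_on_compose:
  fixes f :: "'a::euclidean_space \<Rightarrow> 'b::euclidean_space" and g :: "'b \<Rightarrow> 'c::real_normed_vector"
  assumes "open S" "open T" "smooth_on S f" "smooth_on T g" "f ` S \<subseteq> T"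
  shows "smooth_on S (\<lambda>x. g (f x))"
  unfolding smooth_on_def
proof
  show "k_smooth_on k S (\<lambda>x. g (f x))" for k
    by (rule k_smooth_on_compose[OF assms(1,2) _ _ assms(5)])
      (use assms(3,4) in \<open>simp_all add: smooth_on_def\<close>)
qed

lemma smooth_on_Pair:
  assumes "open S" "smooth_on S f" "smooth_on S g"
  shows "smooth_on S (\<lambda>x. (f x, g x))"
proof -
  have 1: "bounded_linear (\<lambda>y. (y, 0))" and 2: "bounded_linear (\<lambda>y. (0, y))"
    by (simp_all add: bounded_linear_Pair bounded_linear_ident bounded_linear_zero)
  have "smooth_on S (\<lambda>x. (f x, 0) + (0, g x))"
    by (rule smooth_on_add[OF assms(1) smooth_on_bounded_linear[OF 1 assms(1,2)]
          smooth_on_bounded_linear[OF 2 assms(1,3)]])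
  then show ?thesis by simp
qed

lemma smooth_on_has_derivative:
  "smooth_on S f \<Longrightarrow> x \<in> S \<Longrightarrow> (f has_derivative frechet_derivative f (at x)) (at x)"
  unfolding smooth_on_def using k_smooth_on_has_derivative by blast

lemma smooth_on_continuous_on: "smooth_on S f \<Longrightarrow> continuous_on S f"
  unfolding smooth_on_def by (metis k_smooth_on.simps(1))

lemma smooth_on_frechet_derivative:
  "smooth_on S f \<Longrightarrow> smooth_on S (\<lambda>x. frechet_derivative f (at x) v)"
  unfolding smooth_on_def by (metis k_smooth_on.simps(2))

text \<open>A field of linear maps is smooth as soon as it is smooth on basis vectors; expanding the argument in
  the basis turns its application into a sum of products.\<close>

lemma smooth_on_linear_field:
  fixes w :: "'a::euclidean_space \<Rightarrow> 'b::euclidean_space"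
  assumes "open S" "\<And>x. x \<in> S \<Longrightarrow> linear (L x)"
    and "\<And>b. b \<in> Basis \<Longrightarrow> smooth_on S (\<lambda>x. L x b)" and "smooth_on S w"
  shows "smooth_on S (\<lambda>x. L x (w x))"
proof (rule smooth_on_cong_imp[OF assms(1)])
  show "smooth_on S (\<lambda>x. \<Sum>b\<in>Basis. (w x \<bullet> b) *\<^sub>R L x b)"
    by (intro smooth_on_sum assms smooth_on_bounded_bilinear[OF bounded_bilinear_scaleR]
          smooth_on_bounded_linear[OF bounded_linear_inner_left])
qed (use assms linear_Basis_expansion in metis)

lemma smooth_on_inverse: "smooth_on {0<..} (inverse :: real \<Rightarrow> real)"
proof -
  have "k_smooth_on k {0<..} (inverse :: real \<Rightarrow> real)" for k
  proof (induction k)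
    case (Suc k)
    show ?case
    proof (rule k_smooth_on_SucI)
      show "(inverse has_derivative (\<lambda>v. - (inverse x * v * inverse x))) (at x)"
        if "x \<in> {0<..}" for x :: real
        using that by (auto intro!: derivative_eq_intros)
      have "k_smooth_on k {0<..} (\<lambda>x::real. (- v) * (inverse x * inverse x))" for v
        by (rule k_smooth_on_bounded_linear[OF bounded_linear_mult_right open_greaterThan
           k_smooth_on_bounded_bilinear[OF bounded_bilinear_mult open_greaterThan Suc Suc]])
      then show "k_smooth_on k {0<..} (\<lambda>x. - (inverse x * v * inverse x))" for v :: real
        by (simp add: mult_ac)
    qed auto
  qed (auto intro!: continuous_intros)
  then show ?thesis by (simp add: smooth_on_def)
qed


section \<open>Symmetry of second derivatives\<close>

text \<open>The second difference of \<open>f\<close> along \<open>v\<close> and \<open>w\<close> is, by two applications of the mean value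
  theorem, a value near \<open>x\<close> of the second derivative taken first along \<open>v\<close>, then along \<open>w\<close>.
  The second difference is symmetric in \<open>v\<close> and \<open>w\<close>, hence so is its limit.\<close>

lemma second_difference_mean_value:
  fixes f :: "'a::euclidean_space \<Rightarrow> real"
  assumes f: "smooth_on S f" and s: "0 < s"
    and S: "\<And>a b. 0 \<le> a \<Longrightarrow> a \<le> s \<Longrightarrow> 0 \<le> b \<Longrightarrow> b \<le> s \<Longrightarrow> x + a *\<^sub>R v + b *\<^sub>R w \<in> S"
  obtains a b where "0 < a" "a < s" "0 < b" "b < s"
    "f (x + s *\<^sub>R v + s *\<^sub>R w) - f (x + s *\<^sub>R v) - (f (x + s *\<^sub>R w) - f x) =
     s\<^sup>2 * frechet_derivative (\<lambda>z. frechet_derivative f (at z) v) (at (x + a *\<^sub>R v + b *\<^sub>R w)) w"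
proof -
  let ?g = "\<lambda>z. frechet_derivative f (at z) v"
  have g: "smooth_on S ?g" using f by (rule smooth_on_frechet_derivative)
  have df: "((\<lambda>a. f (x + a *\<^sub>R v + b *\<^sub>R w)) has_real_derivative ?g (x + a *\<^sub>R v + b *\<^sub>R w)) (at a)"
    if "0 \<le> a" "a \<le> s" "0 \<le> b" "b \<le> s" for a b
  proof -
    have 1: "((\<lambda>a. x + a *\<^sub>R v + b *\<^sub>R w) has_derivative (\<lambda>h. h *\<^sub>R v)) (at a)"
      by (auto intro!: derivative_eq_intros)
    note D = smooth_on_has_derivative[OF f S[OF that]]
    show ?thesis
      using has_derivative_compose[OF 1 D] linear_scale[OF has_derivative_linear[OF D]]
      by (simp add: has_field_derivative_def mult.commute[of _ "?g _"])
  qed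
  have dg: "((\<lambda>b. ?g (x + a *\<^sub>R v + b *\<^sub>R w)) has_real_derivative
      frechet_derivative ?g (at (x + a *\<^sub>R v + b *\<^sub>R w)) w) (at b)"
    if "0 \<le> a" "a \<le> s" "0 \<le> b" "b \<le> s" for a b
  proof -
    have 1: "((\<lambda>b. x + a *\<^sub>R v + b *\<^sub>R w) has_derivative (\<lambda>h. h *\<^sub>R w)) (at b)"
      by (auto intro!: derivative_eq_intros)
    note D = smooth_on_has_derivative[OF g S[OF that]]
    show ?thesis
      using has_derivative_compose[OF 1 D] linear_scale[OF has_derivative_linear[OF D]]
      by (simp add: has_field_derivative_def mult.commute[of _ "frechet_derivative ?g _ _"])
  qed
  have "\<exists>a. 0 < a \<and> a < s \<and>
     (f (x + s *\<^sub>R v + s *\<^sub>R w) - f (x + s *\<^sub>R v + 0 *\<^sub>R w)) - (f (x + 0 *\<^sub>R v + s *\<^sub>R w) - f (x + 0 *\<^sub>R v + 0 *\<^sub>R w)) =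
     (s - 0) * (?g (x + a *\<^sub>R v + s *\<^sub>R w) - ?g (x + a *\<^sub>R v + 0 *\<^sub>R w))"
    by (rule MVT2[OF s]) (intro DERIV_diff df; use s in simp)
  then obtain a where a: "0 < a" "a < s" and
    1: "(f (x + s *\<^sub>R v + s *\<^sub>R w) - f (x + s *\<^sub>R v)) - (f (x + s *\<^sub>R w) - f x) =
     s * (?g (x + a *\<^sub>R v + s *\<^sub>R w) - ?g (x + a *\<^sub>R v))" by auto
  have "\<exists>b. 0 < b \<and> b < s \<and> ?g (x + a *\<^sub>R v + s *\<^sub>R w) - ?g (x + a *\<^sub>R v + 0 *\<^sub>R w) =
     (s - 0) * frechet_derivative ?g (at (x + a *\<^sub>R v + b *\<^sub>R w)) w"
    by (rule MVT2[OF s]) (intro dg; use a in simp)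
  then obtain b where b: "0 < b" "b < s" and
    2: "?g (x + a *\<^sub>R v + s *\<^sub>R w) - ?g (x + a *\<^sub>R v) =
     s * frechet_derivative ?g (at (x + a *\<^sub>R v + b *\<^sub>R w)) w" by auto
  show thesis
    by (rule that[OF a b]) (use 1 2 in \<open>simp add: power2_eq_square\<close>)
qed

lemma symmetric_second_derivative:
  fixes f :: "'a::euclidean_space \<Rightarrow> real"
  assumes "open S" "smooth_on S f" "x \<in> S"
  shows "frechet_derivative (\<lambda>z. frechet_derivative f (at z) v) (at x) w
       = frechet_derivative (\<lambda>z. frechet_derivative f (at z) w) (at x) v"
proof (rule ccontr)
  define P where "P v w z = frechet_derivative (\<lambda>z. frechet_derivative f (at z) v) (at z) w" for v w z
  assume "\<not> ?thesis"
  then have ne: "P v w x \<noteq> P w v x" by (simp add: P_def)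
  define e where "e = \<bar>P v w x - P w v x\<bar> / 2"
  have e: "e > 0" using ne by (simp add: e_def)
  have cont: "continuous_on S (P v w)" for v w
    unfolding P_def
    by (intro smooth_on_continuous_on smooth_on_frechet_derivative assms)
  have near: "\<exists>d>0. \<forall>z. dist z x < d \<longrightarrow> z \<in> S \<and> \<bar>P v w z - P v w x\<bar> < e" for v w
  proof -
    obtain d1 where d1: "d1 > 0" "\<forall>z\<in>S. dist z x < d1 \<longrightarrow> dist (P v w z) (P v w x) < e"
      using cont[of v w] assms(3) e unfolding continuous_on_iff by metis
    obtain d2 where d2: "d2 > 0" "ball x d2 \<subseteq> S"
      using assms(1,3) open_contains_ball by metis
    show ?thesis
      by (rule exI[of _ "min d1 d2"])
        (use d1 d2 in \<open>auto simp: dist_real_def dist_commute subset_iff\<close>)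
  qed
  obtain d1 where d1: "d1 > 0" "\<And>z. dist z x < d1 \<Longrightarrow> z \<in> S \<and> \<bar>P v w z - P v w x\<bar> < e"
    using near by metis
  obtain d2 where d2: "d2 > 0" "\<And>z. dist z x < d2 \<Longrightarrow> z \<in> S \<and> \<bar>P w v z - P w v x\<bar> < e"
    using near by metis
  \<comment> \<open>the parallelogram with the sides \<open>s v\<close> and \<open>s w\<close> at \<open>x\<close> stays within the distance \<open>min d1 d2\<close>\<close>
  define s where "s = min d1 d2 / (norm v + norm w + 1)"
  have pos: "norm v + norm w + 1 > 0" using norm_ge_zero[of v] norm_ge_zero[of w] by linarith
  have s: "s > 0" using d1 d2 pos by (simp add: s_def)
  have dist: "dist (x + a *\<^sub>R v + b *\<^sub>R w) x < min d1 d2"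
    if "0 \<le> a" "a \<le> s" "0 \<le> b" "b \<le> s" for a b
  proof -
    have "dist (x + a *\<^sub>R v + b *\<^sub>R w) x \<le> a * norm v + b * norm w"
      using norm_triangle_ineq[of "a *\<^sub>R v" "b *\<^sub>R w"] that
      by (simp add: dist_norm algebra_simps)
    also have "\<dots> \<le> s * norm v + s * norm w"
      using that by (intro add_mono mult_right_mono) auto
    also have "\<dots> < s * (norm v + norm w + 1)" using s by (simp add: algebra_simps)
    also have "\<dots> = min d1 d2" using pos by (simp add: s_def)
    finally show ?thesis .
  qed
  obtain a b where ab: "0 < a" "a < s" "0 < b" "b < s"
    "f (x + s *\<^sub>R v + s *\<^sub>R w) - f (x + s *\<^sub>R v) - (f (x + s *\<^sub>R w) - f x)
      = s\<^sup>2 * P v w (x + a *\<^sub>R v + b *\<^sub>R w)"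
  proof (rule second_difference_mean_value[OF assms(2) s, of x v w])
    show "x + a *\<^sub>R v + b *\<^sub>R w \<in> S" if "0 \<le> a" "a \<le> s" "0 \<le> b" "b \<le> s" for a b
      using dist[OF that] d1(2)[of "x + a *\<^sub>R v + b *\<^sub>R w"] by simp
  qed (use that in \<open>simp add: P_def\<close>)
  obtain a' b' where ab': "0 < a'" "a' < s" "0 < b'" "b' < s"
    "f (x + s *\<^sub>R w + s *\<^sub>R v) - f (x + s *\<^sub>R w) - (f (x + s *\<^sub>R v) - f x)
      = s\<^sup>2 * P w v (x + a' *\<^sub>R w + b' *\<^sub>R v)"
  proof (rule second_difference_mean_value[OF assms(2) s, of x w v])
    show "x + a *\<^sub>R w + b *\<^sub>R v \<in> S" if "0 \<le> a" "a \<le> s" "0 \<le> b" "b \<le> s" for a b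
      using dist[OF that(3,4,1,2)] d1(2)[of "x + a *\<^sub>R w + b *\<^sub>R v"] by (simp add: add_ac)
  qed (use that in \<open>simp add: P_def\<close>)
  have "P v w (x + a *\<^sub>R v + b *\<^sub>R w) = P w v (x + a' *\<^sub>R w + b' *\<^sub>R v)"
    using ab(5) ab'(5) s by (simp add: algebra_simps)
  moreover have "\<bar>P v w (x + a *\<^sub>R v + b *\<^sub>R w) - P v w x\<bar> < e"
    using d1(2) dist[of a b] ab by simp
  moreover have "\<bar>P w v (x + a' *\<^sub>R w + b' *\<^sub>R v) - P w v x\<bar> < e"
    using d2(2) dist[of b' a'] ab' by (simp add: add_ac)
  ultimately have "\<bar>P v w x - P w v x\<bar> < e + e" by linarith
  then show False by (simp add: e_def)
qed


section \<open>Bump functions on Euclidean spaces\<close>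

text \<open>The functions \<open>exp (-1/x) / x ^ n\<close>, extended by \<open>0\<close>: the derivative of such a function is a
  linear combination of two others, so that all of them are smooth at once.\<close>

definition flat :: "nat \<Rightarrow> real \<Rightarrow> real" where
  "flat n x = (if x > 0 then inverse x ^ n * exp (- inverse x) else 0)"

text \<open>The exponential function dominates each term of its power series.  As \<open>flat n x / x\<close> is
  \<open>flat (n + 1) x\<close>, the bound for all \<open>n\<close> shows both that \<open>flat n\<close> tends to \<open>0\<close> at \<open>0\<close> and that its
  derivative there is \<open>0\<close>.\<close>

lemma flat_le:
  assumes "x \<ge> 0"
  shows "flat n x \<le> fact (Suc n) * x"
proof (cases "x = 0")
  case False
  define y where "y = inverse x"
  have y: "y > 0" and x: "x = inverse y" using assms False by (simp_all add: y_def)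
  have "(\<Sum>k\<in>{Suc n}. inverse (fact k) * y ^ k) \<le> (\<Sum>k. inverse (fact k) * y ^ k)"
    by (rule sum_le_suminf[OF summable_exp]) (use y in auto)
  then have "inverse (fact (Suc n)) * y ^ Suc n \<le> exp y"
    by (simp add: exp_def scaleR_conv_of_real divide_inverse)
  then have "y ^ Suc n \<le> fact (Suc n) * exp y"
    by (simp add: field_simps del: fact_Suc)
  then have "y ^ n * exp (- y) \<le> fact (Suc n) * inverse y"
    using y by (simp add: exp_minus field_simps del: fact_Suc)
  then show ?thesis using y by (simp add: flat_def x)
qed (simp add: flat_def)

lemma flat_nonneg: "flat n x \<ge> 0" by (simp add: flat_def)

lemma flat_has_derivative:
  "(flat n has_real_derivative flat (n + 2) x - real n * flat (n + 1) x) (at x)"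
proof -
  consider "x > 0" | "x < 0" | "x = 0" by linarith
  then show ?thesis
  proof cases
    case 1
    have "((\<lambda>x. inverse x ^ n * exp (- inverse x)) has_real_derivative
       flat (n + 2) x - real n * flat (n + 1) x) (at x)"
    proof (cases n)
      case 0
      then show ?thesis using 1
        by (auto intro!: derivative_eq_intros simp: flat_def power2_eq_square)
    next
      case (Suc m)
      have pred: "m \<noteq> 0 \<Longrightarrow> inverse x * inverse x ^ (m - Suc 0) = inverse x ^ m"
        by (cases m) auto
      show ?thesis using 1 Suc
        by (auto intro!: derivative_eq_intros simp: flat_def algebra_simps) (metis pred)
    qed
    then show ?thesis
      by (rule has_field_derivative_transform_within_open[of _ _ _ "{0<..}"])
        (use 1 in \<open>auto simp: flat_def\<close>)
  next
    case 2
    have "((\<lambda>x. 0) has_real_derivative flat (n + 2) x - real n * flat (n + 1) x) (at x)"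
      using 2 by (simp add: flat_def)
    then show ?thesis
      by (rule has_field_derivative_transform_within_open[of _ _ _ "{..<0}"])
        (use 2 in \<open>auto simp: flat_def\<close>)
  next
    case 3
    have le: "\<bar>flat n h / h\<bar> \<le> fact (n + 2) * \<bar>h\<bar>" for h
    proof (cases "h > 0")
      case True
      then have "flat n h / h = flat (Suc n) h" by (simp add: flat_def divide_inverse)
      then show ?thesis using flat_le[of h "Suc n"] flat_nonneg[of "Suc n" h] True by simp
    next
      case False
      have "0 \<le> fact (n + 2) * \<bar>h\<bar>" by (intro mult_nonneg_nonneg fact_ge_zero abs_ge_zero)
      then show ?thesis using False by (simp add: flat_def)
    qed
    have "((\<lambda>h. flat n h / h) \<longlongrightarrow> 0) (at 0)"
    proof (rule Lim_null_comparison)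
      show "((\<lambda>h. fact (n + 2) * \<bar>h\<bar>) \<longlongrightarrow> (0::real)) (at 0)"
        by (auto intro!: tendsto_eq_intros)
    qed (use le in auto)
    then show ?thesis using 3 by (simp add: has_field_derivative_iff flat_def)
  qed
qed

lemma smooth_on_flat: "smooth_on UNIV (flat n)"
proof -
  have "k_smooth_on k UNIV (flat n)" for k
  proof (induction k arbitrary: n)
    case 0
    then show ?case
      using flat_has_derivative DERIV_isCont
      by (auto simp: continuous_on_eq_continuous_at intro: DERIV_isCont)
  next
    case (Suc k)
    show ?case
    proof (rule k_smooth_on_SucI)
      show "(flat n has_derivative (*) (flat (n + 2) x - real n * flat (n + 1) x)) (at x)" for x
        using flat_has_derivative by (simp add: has_field_derivative_def)
      have "k_smooth_on k UNIV (\<lambda>x. v * flat (n + 2) x + (- (v * real n)) * flat (n + 1) x)" for v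
        by (intro k_smooth_on_add k_smooth_on_bounded_linear[OF bounded_linear_mult_right]
            open_UNIV Suc)
      then show "k_smooth_on k UNIV (\<lambda>x. (flat (n + 2) x - real n * flat (n + 1) x) * v)" for v
        by (simp add: algebra_simps)
    qed simp
  qed
  then show ?thesis by (simp add: smooth_on_def)
qed

text \<open>A smooth transition from the value \<open>0\<close> on \<open>x \<le> 0\<close> to the value \<open>1\<close> on \<open>x \<ge> 1\<close>; the denominator is
  positive because \<open>x\<close> or \<open>1 - x\<close> is.\<close>

definition smooth_step :: "real \<Rightarrow> real" where
  "smooth_step x = flat 0 x * inverse (flat 0 x + flat 0 (1 - x))"

lemma smooth_on_smooth_step: "smooth_on UNIV smooth_step"
proof -
  have 1: "smooth_on UNIV (\<lambda>x::real. 1 + - x)"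
    by (intro smooth_on_add smooth_on_const smooth_on_linear bounded_linear_minus
        bounded_linear_ident open_UNIV)
  have 2: "smooth_on UNIV (\<lambda>x. flat 0 (1 + - x))"
    by (rule smooth_on_compose[OF open_UNIV open_UNIV 1 smooth_on_flat]) simp
  have 3: "smooth_on UNIV (\<lambda>x. inverse (flat 0 x + flat 0 (1 + - x)))"
  proof (rule smooth_on_compose[OF open_UNIV open_greaterThan _ smooth_on_inverse])
    show "smooth_on UNIV (\<lambda>x. flat 0 x + flat 0 (1 + - x))"
      by (intro smooth_on_add smooth_on_flat 2 open_UNIV)
    have "flat 0 x + flat 0 (1 + - x) > 0" for x
      by (auto simp: flat_def intro: add_pos_pos)
    then show "range (\<lambda>x. flat 0 x + flat 0 (1 + - x)) \<subseteq> {0<..}" by auto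
  qed
  have "smooth_on UNIV (\<lambda>x. flat 0 x * inverse (flat 0 x + flat 0 (1 + - x)))"
    by (rule smooth_on_bounded_bilinear[OF bounded_bilinear_mult open_UNIV smooth_on_flat 3])
  then show ?thesis by (simp add: smooth_step_def[abs_def])
qed

lemma smooth_bump_exists:
  fixes u0 :: "'a::euclidean_space"
  assumes "r > 0"
  obtains b :: "'a \<Rightarrow> real" where "smooth_on UNIV b"
    "\<And>u. dist u u0 \<le> r \<Longrightarrow> b u = 1" "\<And>u. dist u u0 \<ge> 2 * r \<Longrightarrow> b u = 0"
proof
  \<comment> \<open>a polynomial that is at least \<open>1\<close> on the ball of radius \<open>r\<close> and negative off the one of radius \<open>2 r\<close>\<close>
  define q :: "'a \<Rightarrow> real" where "q u = 2 + - inverse (r\<^sup>2) * ((u + - u0) \<bullet> (u + - u0))" for u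
  have 1: "smooth_on UNIV (\<lambda>u. u + - u0)"
    by (intro smooth_on_add smooth_on_const smooth_on_ident open_UNIV)
  have "smooth_on UNIV q"
    unfolding q_def
    by (intro smooth_on_add smooth_on_const open_UNIV
        smooth_on_bounded_linear[OF bounded_linear_mult_right]
        smooth_on_bounded_bilinear[OF bounded_bilinear_inner] 1)
  then show "smooth_on UNIV (\<lambda>u. smooth_step (q u))"
    by (rule smooth_on_compose[OF open_UNIV open_UNIV _ smooth_on_smooth_step]) simp
  have q: "q u = 2 - (dist u u0)\<^sup>2 / r\<^sup>2" for u
    by (simp add: q_def dist_norm power2_norm_eq_inner divide_inverse mult.commute)
  show "smooth_step (q u) = 1" if "dist u u0 \<le> r" for u
  proof -
    have "(dist u u0)\<^sup>2 \<le> r\<^sup>2" using that by (simp add: power_mono)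
    then have "q u \<ge> 1" using assms by (simp add: q field_simps)
    then show ?thesis by (simp add: smooth_step_def flat_def)
  qed
  show "smooth_step (q u) = 0" if "dist u u0 \<ge> 2 * r" for u
  proof -
    have "(2 * r)\<^sup>2 \<le> (dist u u0)\<^sup>2" by (rule power_mono) (use that assms in auto)
    then have "4 * r\<^sup>2 \<le> (dist u u0)\<^sup>2" by (simp add: power_mult_distrib)
    then have "2 * r\<^sup>2 \<le> (dist u u0)\<^sup>2" using zero_le_power2[of r] by linarith
    then have "q u \<le> 0" using assms by (simp add: q field_simps)
    then show ?thesis by (simp add: smooth_step_def flat_def)
  qed
qed


section \<open>Local calculus on a manifold given by a family of charts\<close>

text \<open>The charts are indexed, instead of being collected in a set, because the components of geometric
  objects on the jet bundle are families over the pairs of a chart of \<open>\<real>\<close> and a chart of \<open>M\<close>.\<close>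

locale charted =
  fixes J :: "'k set" and ch :: "'k \<Rightarrow> ('p, 'e::euclidean_space) chart"
  assumes chart: "k \<in> J \<Longrightarrow> is_chart (ch k)"
    and compat: "k \<in> J \<Longrightarrow> l \<in> J \<Longrightarrow> compatible (ch k) (ch l)"
begin

abbreviation pts :: "'p set" where "pts \<equiv> points (ch ` J)"
abbreviation cdom :: "'k \<Rightarrow> 'p set" where "cdom k \<equiv> fst (ch k)"
abbreviation co :: "'k \<Rightarrow> 'p \<Rightarrow> 'e" where "co k \<equiv> snd (ch k)"
abbreviation ci :: "'k \<Rightarrow> 'e \<Rightarrow> 'p" where "ci k \<equiv> chart_inv (ch k)"

definition opn :: "'p set \<Rightarrow> bool" where
  "opn V \<longleftrightarrow> openin (atlas_topology (ch ` J)) V"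

lemma ci_co [simp]: "k \<in> J \<Longrightarrow> p \<in> cdom k \<Longrightarrow> ci k (co k p) = p"
  using chart by (simp add: chart_inv_def is_chart_def)

lemma co_ci: "k \<in> J \<Longrightarrow> u \<in> co k ` cdom k \<Longrightarrow> co k (ci k u) = u \<and> ci k u \<in> cdom k"
  by auto

lemma opn_iff: "opn V \<longleftrightarrow> V \<subseteq> pts \<and> (\<forall>k\<in>J. open (co k ` (V \<inter> cdom k)))"
  unfolding opn_def by (subst openin_atlas_topology) (use chart in auto)

lemma opn_subset_pts: "opn V \<Longrightarrow> V \<subseteq> pts"
  by (simp add: opn_iff)

lemma opn_cdom: "k \<in> J \<Longrightarrow> opn (cdom k)"
  using compat by (auto simp: opn_iff points_def compatible_def)

lemma opn_Int: "opn V \<Longrightarrow> opn W \<Longrightarrow> opn (V \<inter> W)"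
  by (simp add: opn_def openin_Int)

lemma open_co_image: "opn V \<Longrightarrow> k \<in> J \<Longrightarrow> V \<subseteq> cdom k \<Longrightarrow> open (co k ` V)"
  using opn_iff by (metis inf.orderE)

lemma cdom_subset_pts: "k \<in> J \<Longrightarrow> cdom k \<subseteq> pts"
  by (auto simp: points_def)

lemma ptsE:
  assumes "p \<in> pts"
  obtains k where "k \<in> J" "p \<in> cdom k"
  using assms by (auto simp: points_def)

text \<open>Smoothness on an open subset of a chart domain, for arguments in which the domain shrinks while
  the chart is kept.\<close>

definition loc_smooth :: "'k \<Rightarrow> 'p set \<Rightarrow> ('p \<Rightarrow> 'b::real_normed_vector) \<Rightarrow> bool" where
  "loc_smooth k V f \<longleftrightarrow> smooth_on (co k ` V) (\<lambda>u. f (ci k u))"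

lemma loc_smooth_subset: "loc_smooth k V f \<Longrightarrow> W \<subseteq> V \<Longrightarrow> loc_smooth k W f"
  unfolding loc_smooth_def by (erule smooth_on_subset) auto

lemma smooth_on_transition:
  assumes "k \<in> J" "l \<in> J" "V \<subseteq> cdom k \<inter> cdom l"
  shows "smooth_on (co k ` V) (\<lambda>u. co l (ci k u))"
proof (rule smooth_on_subset)
  show "smooth_on (co k ` (cdom k \<inter> cdom l)) (\<lambda>u. co l (ci k u))"
    using compat[OF assms(1,2)] by (simp add: compatible_def)
qed (use assms in auto)

lemma opn_preimage:
  assumes k: "k \<in> J" and B: "open B"
  shows "opn {q \<in> cdom k. co k q \<in> B}"
  unfolding opn_iff
proof safe
  show "q \<in> pts" if "q \<in> cdom k" for q using that k cdom_subset_pts by auto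
  fix l assume l: "l \<in> J"
  have o: "open (co l ` (cdom l \<inter> cdom k))"
    using compat[OF l k] by (simp add: compatible_def)
  have "co l ` ({q \<in> cdom k. co k q \<in> B} \<inter> cdom l)
      = co l ` (cdom l \<inter> cdom k) \<inter> (\<lambda>u. co k (ci l u)) -` B"
    using l by auto
  moreover have "open \<dots>"
    by (rule continuous_open_preimage[OF _ o B])
      (use k l in \<open>auto intro!: smooth_on_continuous_on smooth_on_transition\<close>)
  ultimately show "open (co l ` ({q \<in> cdom k. co k q \<in> B} \<inter> cdom l))" by simp
qed

lemma loc_smooth_change:
  assumes "k \<in> J" "l \<in> J" "opn V" "V \<subseteq> cdom k \<inter> cdom l" "loc_smooth k V f"
  shows "loc_smooth l V f"
proof -
  have "smooth_on (co l ` V) (\<lambda>u. f (ci k (co k (ci l u))))"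
  proof (rule smooth_on_compose[where T = "co k ` V"])
    show "smooth_on (co l ` V) (\<lambda>u. co k (ci l u))"
      by (rule smooth_on_transition) (use assms in auto)
    show "smooth_on (co k ` V) (\<lambda>u. f (ci k u))"
      using assms(5) by (simp add: loc_smooth_def)
    show "(\<lambda>u. co k (ci l u)) ` co l ` V \<subseteq> co k ` V"
      using assms(2,4) by force
  qed (use assms in \<open>auto intro: open_co_image\<close>)
  then show ?thesis
    unfolding loc_smooth_def
  proof (rule smooth_on_cong_imp[rotated])
    show "f (ci k (co k (ci l u))) = f (ci l u)" if "u \<in> co l ` V" for u
    proof -
      have "ci l u \<in> cdom k" using that assms(2,4) by (auto simp: subset_iff)
      then show ?thesis using assms(1) by simp
    qed
  qed (use assms in \<open>auto intro: open_co_image\<close>)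
qed


subsection \<open>Germs of smooth functions\<close>

text \<open>Smoothness at a point is a property of the germ that refers to no particular chart
  (\<open>smooth_at_in_chart\<close>).  It is closed under all the operations below without any bookkeeping of
  domains.\<close>

definition smooth_at :: "'p \<Rightarrow> ('p \<Rightarrow> 'b::real_normed_vector) \<Rightarrow> bool" where
  "smooth_at p f \<longleftrightarrow> (\<exists>k\<in>J. \<exists>V. opn V \<and> p \<in> V \<and> V \<subseteq> cdom k \<and> loc_smooth k V f)"

lemma smooth_atI:
  "k \<in> J \<Longrightarrow> opn V \<Longrightarrow> p \<in> V \<Longrightarrow> V \<subseteq> cdom k \<Longrightarrow> loc_smooth k V f \<Longrightarrow> smooth_at p f"
  by (auto simp: smooth_at_def)

lemma smooth_at_in_chart:
  assumes "smooth_at p f" "k \<in> J" "p \<in> cdom k"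
  obtains V where "opn V" "p \<in> V" "V \<subseteq> cdom k" "loc_smooth k V f"
proof -
  obtain l V where V: "l \<in> J" "opn V" "p \<in> V" "V \<subseteq> cdom l" "loc_smooth l V f"
    using assms(1) by (auto simp: smooth_at_def)
  show thesis
  proof
    show "opn (V \<inter> cdom k)" using V(2) opn_cdom[OF assms(2)] by (rule opn_Int)
    then show "loc_smooth k (V \<inter> cdom k) f"
      by (rule loc_smooth_change[OF V(1) assms(2)])
        (use V in \<open>auto intro: loc_smooth_subset\<close>)
  qed (use V assms in auto)
qed

lemma smooth_at_pts: "smooth_at p f \<Longrightarrow> p \<in> pts"
  by (auto simp: smooth_at_def points_def)

lemma smooth_at_cong:
  assumes "smooth_at p f" "opn U" "p \<in> U" "\<And>q. q \<in> U \<Longrightarrow> f q = g q"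
  shows "smooth_at p g"
proof -
  obtain k V where V: "k \<in> J" "opn V" "p \<in> V" "V \<subseteq> cdom k" "loc_smooth k V f"
    using assms(1) by (auto simp: smooth_at_def)
  have o: "opn (V \<inter> U)" using V assms by (simp add: opn_Int)
  show ?thesis
  proof (rule smooth_atI[OF V(1) o])
    have "loc_smooth k (V \<inter> U) f" using V by (auto intro: loc_smooth_subset)
    then show "loc_smooth k (V \<inter> U) g"
      unfolding loc_smooth_def
    proof (rule smooth_on_cong_imp[rotated])
      show "f (ci k u) = g (ci k u)" if "u \<in> co k ` (V \<inter> U)" for u
      proof -
        have "ci k u \<in> U" using that V(1,4) by (auto simp: subset_iff)
        then show ?thesis by (rule assms(4))
      qed
    qed (use V o open_co_image in blast)
  qed (use V assms in auto)
qed

lemma smooth_at_lift1: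
  assumes "smooth_at p f" and "\<And>(S :: 'e set) f. open S \<Longrightarrow> smooth_on S f \<Longrightarrow> smooth_on S (\<lambda>u. H (f u))"
  shows "smooth_at p (\<lambda>q. H (f q))"
proof -
  obtain k V where V: "k \<in> J" "opn V" "p \<in> V" "V \<subseteq> cdom k" "loc_smooth k V f"
    using assms(1) by (auto simp: smooth_at_def)
  show ?thesis
    by (rule smooth_atI[OF V(1-4)])
      (use V assms(2) open_co_image[OF V(2,1,4)] in \<open>auto simp: loc_smooth_def\<close>)
qed

lemma smooth_at_common:
  assumes "smooth_at p f" "smooth_at p g" "k \<in> J" "p \<in> cdom k"
  obtains V where "opn V" "p \<in> V" "V \<subseteq> cdom k" "loc_smooth k V f" "loc_smooth k V g"
proof -
  obtain V where V: "opn V" "p \<in> V" "V \<subseteq> cdom k" "loc_smooth k V f"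
    by (rule smooth_at_in_chart[OF assms(1,3,4)])
  obtain W where W: "opn W" "p \<in> W" "W \<subseteq> cdom k" "loc_smooth k W g"
    by (rule smooth_at_in_chart[OF assms(2,3,4)])
  show thesis
    by (rule that[of "V \<inter> W"]) (use V W in \<open>auto intro: opn_Int loc_smooth_subset\<close>)
qed

lemma smooth_at_lift2:
  assumes "smooth_at p f" "smooth_at p g"
    and "\<And>(S :: 'e set) f g. open S \<Longrightarrow> smooth_on S f \<Longrightarrow> smooth_on S g \<Longrightarrow> smooth_on S (\<lambda>u. H (f u) (g u))"
  shows "smooth_at p (\<lambda>q. H (f q) (g q))"
proof -
  obtain k where k: "k \<in> J" "p \<in> cdom k" using smooth_at_pts[OF assms(1)] by (rule ptsE)
  obtain V where V: "opn V" "p \<in> V" "V \<subseteq> cdom k" "loc_smooth k V f" "loc_smooth k V g"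
    by (rule smooth_at_common[OF assms(1,2) k])
  show ?thesis
    by (rule smooth_atI[OF k(1) V(1-3)])
      (use V assms(3) open_co_image[OF V(1) k(1) V(3)] in \<open>auto simp: loc_smooth_def\<close>)
qed

lemma smooth_at_const: "p \<in> pts \<Longrightarrow> smooth_at p (\<lambda>q. c)"
  by (erule ptsE) (auto intro!: smooth_atI[OF _ opn_cdom] simp: loc_smooth_def smooth_on_const)

lemma smooth_at_add: "smooth_at p f \<Longrightarrow> smooth_at p g \<Longrightarrow> smooth_at p (\<lambda>q. f q + g q)"
  by (erule (1) smooth_at_lift2) (rule smooth_on_add)

lemma smooth_at_bounded_linear:
  "bounded_linear L \<Longrightarrow> smooth_at p f \<Longrightarrow> smooth_at p (\<lambda>q. L (f q))"
  by (erule smooth_at_lift1) (rule smooth_on_bounded_linear)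

lemma smooth_at_bounded_bilinear:
  "bounded_bilinear B \<Longrightarrow> smooth_at p f \<Longrightarrow> smooth_at p g \<Longrightarrow> smooth_at p (\<lambda>q. B (f q) (g q))"
  by (erule (1) smooth_at_lift2) (rule smooth_on_bounded_bilinear)

lemmas smooth_at_scaleR = smooth_at_bounded_bilinear[OF bounded_bilinear_scaleR]
lemmas smooth_at_mult = smooth_at_bounded_bilinear[OF bounded_bilinear_mult]
lemmas smooth_at_inner = smooth_at_bounded_linear[OF bounded_linear_inner_left]
lemmas smooth_at_minus = smooth_at_bounded_linear[OF bounded_linear_minus[OF bounded_linear_ident]]

lemma smooth_at_diff: "smooth_at p f \<Longrightarrow> smooth_at p g \<Longrightarrow> smooth_at p (\<lambda>q. f q - g q)"
  using smooth_at_add[OF _ smooth_at_minus, of p f g] by simp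

lemma smooth_at_Pair: "smooth_at p f \<Longrightarrow> smooth_at p g \<Longrightarrow> smooth_at p (\<lambda>q. (f q, g q))"
  by (erule (1) smooth_at_lift2) (rule smooth_on_Pair)

lemma smooth_at_sum:
  assumes "p \<in> pts" "\<And>i. i \<in> I \<Longrightarrow> smooth_at p (f i)"
  shows "smooth_at p (\<lambda>q. \<Sum>i\<in>I. f i q)"
  using assms(2)
  by (induction I rule: infinite_finite_induct)
    (auto intro: smooth_at_const[OF assms(1)] smooth_at_add)

lemma smooth_at_vec:
  fixes f :: "'n::finite \<Rightarrow> 'p \<Rightarrow> real"
  assumes "p \<in> pts" "\<And>i. smooth_at p (f i)"
  shows "smooth_at p (\<lambda>q. \<chi> i. f i q)"
proof -
  have "(\<chi> i. f i q) = (\<Sum>i\<in>UNIV. f i q *\<^sub>R axis i 1)" for q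
    using basis_expansion[of "\<chi> i. f i q"] by (simp add: scalar_mult_eq_scaleR)
  then show ?thesis
    by (simp, intro smooth_at_sum smooth_at_scaleR smooth_at_const assms)
qed

lemma smooth_at_linear_field:
  fixes w :: "'p \<Rightarrow> 'b::euclidean_space"
  assumes "opn U" "p \<in> U" "\<And>q. q \<in> U \<Longrightarrow> linear (L q)"
    and "\<And>b. b \<in> Basis \<Longrightarrow> smooth_at p (\<lambda>q. L q b)" and "smooth_at p w"
  shows "smooth_at p (\<lambda>q. L q (w q))"
proof (rule smooth_at_cong[OF _ assms(1,2)])
  show "smooth_at p (\<lambda>q. \<Sum>b\<in>Basis. (w q \<bullet> b) *\<^sub>R L q b)"
    using smooth_at_pts[OF assms(5)]
    by (intro smooth_at_sum smooth_at_scaleR smooth_at_inner assms)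
  show "(\<Sum>b\<in>Basis. (w q \<bullet> b) *\<^sub>R L q b) = L q (w q)" if "q \<in> U" for q
    by (rule linear_Basis_expansion[OF assms(3)[OF that], symmetric])
qed

lemma smooth_at_compose:
  fixes f :: "'p \<Rightarrow> 'b::euclidean_space"
  assumes "smooth_at p f" "open T" "f p \<in> T" "smooth_on T g"
  shows "smooth_at p (\<lambda>q. g (f q))"
proof -
  obtain k where k: "k \<in> J" "p \<in> cdom k" using smooth_at_pts[OF assms(1)] by (rule ptsE)
  obtain V where V: "opn V" "p \<in> V" "V \<subseteq> cdom k" "loc_smooth k V f"
    by (rule smooth_at_in_chart[OF assms(1) k])
  let ?S = "co k ` V \<inter> (\<lambda>u. f (ci k u)) -` T"
  have "open ?S"
    using V open_co_image[OF V(1) k(1) V(3)] assms(2)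
    by (intro continuous_open_preimage smooth_on_continuous_on) (auto simp: loc_smooth_def)
  \<comment> \<open>the neighbourhood on which the composition makes sense; it is open because \<open>f\<close> is continuous\<close>
  define W where "W = {q \<in> V. f q \<in> T}"
  have S: "?S = co k ` W" using V(3) k by (auto simp: W_def subset_iff)
  have "W = {q \<in> cdom k. co k q \<in> ?S}"
    unfolding S using V(3) chart[OF k(1)] by (auto simp: W_def is_chart_def inj_on_def)
  then have "opn W" using opn_preimage[OF k(1) \<open>open ?S\<close>] by simp
  moreover have "loc_smooth k W (\<lambda>q. g (f q))"
    unfolding loc_smooth_def
  proof (rule smooth_on_compose[OF _ assms(2) _ assms(4)])
    show "open (co k ` W)" using \<open>open ?S\<close> S by simp
    show "smooth_on (co k ` W) (\<lambda>u. f (ci k u))"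
      using V(4) by (auto simp: loc_smooth_def W_def intro: smooth_on_subset)
    show "(\<lambda>u. f (ci k u)) ` co k ` W \<subseteq> T" using S by blast
  qed
  ultimately show ?thesis
    using V assms(3) by (intro smooth_atI[OF k(1), of W]) (auto simp: W_def)
qed

lemma smooth_in_chart_iff:
  assumes "k \<in> J"
  shows "smooth_in_chart (ch k) f \<longleftrightarrow> (\<forall>p\<in>cdom k. smooth_at p f)"
proof
  assume "smooth_in_chart (ch k) f"
  then show "\<forall>p\<in>cdom k. smooth_at p f"
    using smooth_atI[OF assms opn_cdom[OF assms]] by (auto simp: smooth_in_chart_def loc_smooth_def)
next
  assume R: "\<forall>p\<in>cdom k. smooth_at p f"
  show "smooth_in_chart (ch k) f"
    unfolding smooth_in_chart_def
  proof (rule smooth_on_local)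
    fix u assume "u \<in> co k ` cdom k"
    then obtain p where p: "p \<in> cdom k" "u = co k p" by auto
    obtain V where V: "opn V" "p \<in> V" "V \<subseteq> cdom k" "loc_smooth k V f"
      using smooth_at_in_chart[of p f k] R p assms by metis
    show "\<exists>T. open T \<and> u \<in> T \<and> smooth_on T (\<lambda>u. f (ci k u))"
      using V p open_co_image[OF V(1) assms V(3)] by (auto simp: loc_smooth_def)
  qed
qed

lemma smooth_functions_iff:
  "f \<in> smooth_functions (ch ` J) \<longleftrightarrow> (\<forall>p\<in>pts. smooth_at p f)"
  using smooth_in_chart_iff by (auto simp: smooth_functions_def points_def)

lemma smooth_at_co: "k \<in> J \<Longrightarrow> p \<in> cdom k \<Longrightarrow> smooth_at p (co k)"
proof (rule smooth_atI[OF _ opn_cdom])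
  assume k: "k \<in> J"
  show "loc_smooth k (cdom k) (co k)"
    unfolding loc_smooth_def
  proof (rule smooth_on_cong_imp[OF _ smooth_on_ident])
    show "u = co k (ci k u)" if "u \<in> co k ` cdom k" for u
      using co_ci[OF k that] by simp
  qed (use open_co_image[OF opn_cdom[OF k] k] in auto)
qed auto


subsection \<open>Derivatives in a chart\<close>

text \<open>The derivative \<open>chart_deriv\<close> for functions with values in any normed space, as a linear map of the
  direction.\<close>

definition cderiv :: "'k \<Rightarrow> ('p \<Rightarrow> 'b::real_normed_vector) \<Rightarrow> 'p \<Rightarrow> 'e \<Rightarrow> 'b" where
  "cderiv k f p w = frechet_derivative (\<lambda>u. f (ci k u)) (at (co k p)) w"

lemma chart_deriv_cderiv: "chart_deriv (ch k) w f p = cderiv k f p w"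
  by (simp add: chart_deriv_def cderiv_def)

lemma has_cderiv:
  assumes "smooth_at p f" "k \<in> J" "p \<in> cdom k"
  shows "((\<lambda>u. f (ci k u)) has_derivative cderiv k f p) (at (co k p))"
proof -
  obtain V where V: "opn V" "p \<in> V" "V \<subseteq> cdom k" "loc_smooth k V f"
    by (rule smooth_at_in_chart[OF assms])
  have "((\<lambda>u. f (ci k u)) has_derivative frechet_derivative (\<lambda>u. f (ci k u)) (at (co k p))) (at (co k p))"
    using V by (intro smooth_on_has_derivative) (auto simp: loc_smooth_def)
  moreover have "frechet_derivative (\<lambda>u. f (ci k u)) (at (co k p)) = cderiv k f p"
    by (simp add: cderiv_def fun_eq_iff)
  ultimately show ?thesis by simp
qed

lemma cderiv_eqI: "((\<lambda>u. f (ci k u)) has_derivative D) (at (co k p)) \<Longrightarrow> cderiv k f p w = D w"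
  by (simp add: cderiv_def frechet_derivative_eqI)

lemma linear_cderiv: "smooth_at p f \<Longrightarrow> k \<in> J \<Longrightarrow> p \<in> cdom k \<Longrightarrow> linear (cderiv k f p)"
  using has_derivative_linear[OF has_cderiv] .

lemma cderiv_cong:
  assumes "opn U" "p \<in> U" "\<And>q. q \<in> U \<Longrightarrow> f q = g q" "k \<in> J" "p \<in> cdom k"
  shows "cderiv k f p w = cderiv k g p w"
proof -
  have "frechet_derivative (\<lambda>u. f (ci k u)) (at (co k p)) = frechet_derivative (\<lambda>u. g (ci k u)) (at (co k p))"
  proof (rule frechet_derivative_cong_open)
    show "open (co k ` (U \<inter> cdom k))" using assms by (simp add: opn_iff)
  qed (use assms in auto)
  then show ?thesis by (simp add: cderiv_def)
qed

lemma cderiv_const: "cderiv k (\<lambda>q. c) p w = 0"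
  by (simp add: cderiv_def)

lemma cderiv_add:
  assumes "smooth_at p f" "smooth_at p g" "k \<in> J" "p \<in> cdom k"
  shows "cderiv k (\<lambda>q. f q + g q) p w = cderiv k f p w + cderiv k g p w"
  by (rule cderiv_eqI) (intro has_derivative_add has_cderiv assms)

lemma cderiv_bounded_linear:
  assumes "bounded_linear L" "smooth_at p f" "k \<in> J" "p \<in> cdom k"
  shows "cderiv k (\<lambda>q. L (f q)) p w = L (cderiv k f p w)"
  by (rule cderiv_eqI) (intro bounded_linear.has_derivative[OF assms(1)] has_cderiv assms)

lemma cderiv_bounded_bilinear:
  assumes "bounded_bilinear B" "smooth_at p f" "smooth_at p g" "k \<in> J" "p \<in> cdom k"
  shows "cderiv k (\<lambda>q. B (f q) (g q)) p w = B (f p) (cderiv k g p w) + B (cderiv k f p w) (g p)"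
proof -
  have "((\<lambda>u. B (f (ci k u)) (g (ci k u))) has_derivative
     (\<lambda>w. B (f (ci k (co k p))) (cderiv k g p w) + B (cderiv k f p w) (g (ci k (co k p))))) (at (co k p))"
    by (intro bounded_bilinear.FDERIV[OF assms(1)] has_cderiv assms)
  then show ?thesis using cderiv_eqI[of "\<lambda>q. B (f q) (g q)"] assms(4,5) by simp
qed

lemma cderiv_sum:
  assumes "p \<in> pts" "\<And>i. i \<in> I \<Longrightarrow> smooth_at p (f i)" "k \<in> J" "p \<in> cdom k"
  shows "cderiv k (\<lambda>q. \<Sum>i\<in>I. f i q) p w = (\<Sum>i\<in>I. cderiv k (f i) p w)"
  using assms(2)
proof (induction I rule: infinite_finite_induct)
  case (insert i I)
  then have "smooth_at p (\<lambda>q. \<Sum>i\<in>I. f i q)" by (intro smooth_at_sum assms(1)) auto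
  then show ?case using insert by (simp add: cderiv_add[OF _ _ assms(3,4)])
qed (simp_all add: cderiv_const)

lemma cderiv_compose:
  fixes f :: "'p \<Rightarrow> 'b::euclidean_space"
  assumes "smooth_at p f" "f p \<in> T" "smooth_on T g" "k \<in> J" "p \<in> cdom k"
  shows "cderiv k (\<lambda>q. g (f q)) p w = frechet_derivative g (at (f p)) (cderiv k f p w)"
proof (rule cderiv_eqI)
  show "((\<lambda>u. g (f (ci k u))) has_derivative (\<lambda>w. frechet_derivative g (at (f p)) (cderiv k f p w)))
      (at (co k p))"
    using has_derivative_compose[OF has_cderiv[OF assms(1,4,5)], of g]
      smooth_on_has_derivative[OF assms(3,2)] assms(4,5) by simp
qed

lemma cderiv_co_self: "k \<in> J \<Longrightarrow> p \<in> cdom k \<Longrightarrow> cderiv k (co k) p w = w"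
proof (rule cderiv_eqI)
  assume k: "k \<in> J" "p \<in> cdom k"
  have "((\<lambda>u. u) has_derivative (\<lambda>w. w)) (at (co k p))" by (rule has_derivative_ident)
  then show "((\<lambda>u. co k (ci k u)) has_derivative (\<lambda>w. w)) (at (co k p))"
    by (rule has_derivative_transform_within_open[OF _ open_co_image[OF opn_cdom]])
      (use k co_ci in auto)
qed

lemma cderiv_change:
  assumes "smooth_at p f" "k \<in> J" "p \<in> cdom k" "l \<in> J" "p \<in> cdom l"
  shows "cderiv k f p w = cderiv l f p (cderiv k (co l) p w)"
proof (rule cderiv_eqI)
  have o: "opn (cdom k \<inter> cdom l)" using assms by (simp add: opn_Int opn_cdom)
  have "((\<lambda>u. f (ci l (co l (ci k u)))) has_derivative (\<lambda>w. cderiv l f p (cderiv k (co l) p w))) (at (co k p))"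
    using has_derivative_compose[OF has_cderiv[OF smooth_at_co assms(2,3)], of l "\<lambda>u. f (ci l u)"]
      has_cderiv[OF assms(1,4,5)] assms by simp
  then show "((\<lambda>u. f (ci k u)) has_derivative (\<lambda>w. cderiv l f p (cderiv k (co l) p w))) (at (co k p))"
  proof (rule has_derivative_transform_within_open[OF _ open_co_image[OF o assms(2)]])
    show "f (ci l (co l (ci k u))) = f (ci k u)" if "u \<in> co k ` (cdom k \<inter> cdom l)" for u
    proof -
      have "ci k u \<in> cdom l" using that assms(2) by auto
      then show ?thesis using assms(4) by simp
    qed
  qed (use assms in auto)
qed

lemma smooth_at_cderiv:
  fixes w :: "'p \<Rightarrow> 'e"
  assumes "smooth_at p f" "smooth_at p w" "k \<in> J" "p \<in> cdom k"
  shows "smooth_at p (\<lambda>q. cderiv k f q (w q))"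
proof -
  obtain V where V: "opn V" "p \<in> V" "V \<subseteq> cdom k" "loc_smooth k V f"
    by (rule smooth_at_in_chart[OF assms(1,3,4)])
  have sm: "smooth_at q f" if "q \<in> V" for q
    using smooth_atI[OF assms(3) V(1) that V(3,4)] .
  have "loc_smooth k V (\<lambda>q. cderiv k f q b)" for b
    unfolding loc_smooth_def
  proof (rule smooth_on_cong_imp[OF open_co_image[OF V(1) assms(3) V(3)]])
    show "smooth_on (co k ` V) (\<lambda>u. frechet_derivative (\<lambda>u. f (ci k u)) (at u) b)"
      using V(4) unfolding loc_smooth_def by (rule smooth_on_frechet_derivative)
    show "frechet_derivative (\<lambda>u. f (ci k u)) (at u) b = cderiv k f (ci k u) b"
      if "u \<in> co k ` V" for u
    proof -
      have "u \<in> co k ` cdom k" using that V(3) by auto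
      then show ?thesis using co_ci[OF assms(3)] by (simp add: cderiv_def)
    qed
  qed
  then have "smooth_at p (\<lambda>q. cderiv k f q b)" for b
    using smooth_atI[OF assms(3) V(1-3)] by blast
  moreover have "linear (cderiv k f q)" if "q \<in> V" for q
    using linear_cderiv[OF sm[OF that] assms(3)] that V(3) by blast
  ultimately show ?thesis
    by (rule smooth_at_linear_field[where L = "cderiv k f", OF V(1,2) _ _ assms(2), rotated])
qed

text \<open>The product rule for a field of linear maps applied to a vector-valued function: the coefficients of
  the argument in a basis are differentiated, and so are the values on the basis vectors.\<close>

lemma cderiv_linear_field:
  fixes w :: "'p \<Rightarrow> 'b::euclidean_space"
  assumes U: "opn U" "p \<in> U" "\<And>q. q \<in> U \<Longrightarrow> linear (L q)"
    and L: "\<And>b. b \<in> Basis \<Longrightarrow> smooth_at p (\<lambda>q. L q b)" and w: "smooth_at p w"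
    and k: "k \<in> J" "p \<in> cdom k"
  shows "cderiv k (\<lambda>q. L q (w q)) p v = cderiv k (\<lambda>q. L q (w p)) p v + L p (cderiv k w p v)"
proof -
  have p: "p \<in> pts" using k cdom_subset_pts by auto
  have exp: "cderiv k (\<lambda>q. L q (w q)) p v =
      (\<Sum>b\<in>Basis. (w p \<bullet> b) *\<^sub>R cderiv k (\<lambda>q. L q b) p v) + L p (cderiv k w p v)"
    if "smooth_at p w" for w :: "'p \<Rightarrow> 'b"
  proof -
    have "cderiv k (\<lambda>q. L q (w q)) p v = cderiv k (\<lambda>q. \<Sum>b\<in>Basis. (w q \<bullet> b) *\<^sub>R L q b) p v"
      by (rule cderiv_cong[OF U(1,2) _ k]) (rule linear_Basis_expansion[OF U(3)])
    also have "\<dots> = (\<Sum>b\<in>Basis. cderiv k (\<lambda>q. (w q \<bullet> b) *\<^sub>R L q b) p v)"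
      by (intro cderiv_sum p k smooth_at_scaleR smooth_at_inner that L)
    also have "\<dots> = (\<Sum>b\<in>Basis. (w p \<bullet> b) *\<^sub>R cderiv k (\<lambda>q. L q b) p v
        + (cderiv k w p v \<bullet> b) *\<^sub>R L p b)"
      by (intro sum.cong refl)
        (simp add: cderiv_bounded_bilinear[OF bounded_bilinear_scaleR smooth_at_inner[OF that] L k]
          cderiv_bounded_linear[OF bounded_linear_inner_left that k])
    also have "\<dots> = (\<Sum>b\<in>Basis. (w p \<bullet> b) *\<^sub>R cderiv k (\<lambda>q. L q b) p v) + L p (cderiv k w p v)"
      by (simp add: sum.distrib linear_Basis_expansion[OF U(3)[OF U(2)], of "cderiv k w p v"])
    finally show ?thesis .
  qed
  have "L p 0 = 0" using U(3)[OF U(2)] by (rule linear_0)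
  then show ?thesis
    using exp[OF w] exp[OF smooth_at_const[OF p, of "w p"]] by (simp add: cderiv_const)
qed

lemma cderiv_symmetric:
  fixes f :: "'p \<Rightarrow> real"
  assumes "smooth_at p f" "k \<in> J" "p \<in> cdom k"
  shows "cderiv k (\<lambda>q. cderiv k f q v) p w = cderiv k (\<lambda>q. cderiv k f q w) p v"
proof -
  obtain V where V: "opn V" "p \<in> V" "V \<subseteq> cdom k" "loc_smooth k V f"
    by (rule smooth_at_in_chart[OF assms])
  have o: "open (co k ` V)" "co k p \<in> co k ` V" using open_co_image[OF V(1) assms(2) V(3)] V(2) by auto
  let ?f = "\<lambda>u. f (ci k u)"
  have "cderiv k (\<lambda>q. cderiv k f q v) p w
      = frechet_derivative (\<lambda>u. frechet_derivative ?f (at u) v) (at (co k p)) w" for v w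
    unfolding cderiv_def
  proof (subst frechet_derivative_cong_open[OF o])
    show "frechet_derivative ?f (at (co k (ci k u))) v = frechet_derivative ?f (at u) v"
      if "u \<in> co k ` V" for u
    proof -
      have "u \<in> co k ` cdom k" using that V(3) by auto
      then show ?thesis using co_ci[OF assms(2)] by simp
    qed
  qed simp
  then show ?thesis
    using symmetric_second_derivative[OF o(1) _ o(2), of ?f] V(4) by (simp add: loc_smooth_def)
qed

end


subsection \<open>Bump functions\<close>

locale hausdorff_charted = charted J ch
  for J :: "'k set" and ch :: "'k \<Rightarrow> ('p, 'e::euclidean_space) chart" +
  assumes hausdorff: "Hausdorff_space (atlas_topology (ch ` J))"
begin

text \<open>The support of a bump function is compact in a chart, hence closed in the manifold because
  the manifold is Hausdorff; so the extension by zero is smooth at the points outside the chart.\<close>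

lemma bump_function:
  assumes "opn U" "p \<in> U"
  obtains b :: "'p \<Rightarrow> real" and V where "\<And>q. q \<in> pts \<Longrightarrow> smooth_at q b"
    "opn V" "p \<in> V" "V \<subseteq> U" "\<And>q. q \<in> V \<Longrightarrow> b q = 1"
    "\<And>q. q \<in> pts \<Longrightarrow> q \<notin> U \<Longrightarrow> \<exists>N. opn N \<and> q \<in> N \<and> (\<forall>r\<in>N. b r = 0)"
proof -
  obtain k where k: "k \<in> J" "p \<in> cdom k" using assms opn_subset_pts ptsE by (metis subsetD)
  define W where "W = U \<inter> cdom k"
  have W: "opn W" "W \<subseteq> cdom k" "p \<in> W" using assms k by (auto simp: W_def opn_Int opn_cdom)
  have oW: "open (co k ` W)" using open_co_image[OF W(1) k(1) W(2)] .
  then obtain e where e: "e > 0" "cball (co k p) e \<subseteq> co k ` W"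
    using W(3) open_contains_cball[of "co k ` W"] by blast
  define r where "r = e / 2"
  have r: "r > 0" "2 * r = e" using e by (auto simp: r_def)
  obtain b0 :: "'e \<Rightarrow> real" where b0: "smooth_on UNIV b0"
    "\<And>u. dist u (co k p) \<le> r \<Longrightarrow> b0 u = 1" "\<And>u. dist u (co k p) \<ge> 2 * r \<Longrightarrow> b0 u = 0"
    using smooth_bump_exists[OF r(1), of "co k p"] by metis
  define b where "b q = (if q \<in> cdom k then b0 (co k q) else 0)" for q
  \<comment> \<open>\<open>b\<close> vanishes off the set \<open>K\<close>, which is compact and hence closed in the manifold\<close>
  define K where "K = ci k ` cball (co k p) e"
  define V where "V = W \<inter> {q \<in> cdom k. co k q \<in> ball (co k p) r}"
  let ?X = "top_of_set (co k ` cdom k)"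
  have "compactin ?X (cball (co k p) e)"
    using e W(2) by (auto simp: compactin_subtopology)
  moreover have "continuous_map ?X (atlas_topology (ch ` J)) (ci k)"
    unfolding continuous_map_def
  proof (intro conjI allI impI)
    have topspace: "topspace (atlas_topology (ch ` J)) = pts"
    proof -
      have "opn pts"
        unfolding opn_iff
      proof safe
        fix l assume l: "l \<in> J"
        then have "pts \<inter> cdom l = cdom l" by (auto simp: points_def)
        then show "open (co l ` (pts \<inter> cdom l))" using open_co_image[OF opn_cdom[OF l] l] by simp
      qed
      then show ?thesis
        using opn_subset_pts unfolding opn_def by (metis openin_subset openin_topspace subset_antisym)
    qed
    show "ci k \<in> topspace ?X \<rightarrow> topspace (atlas_topology (ch ` J))"
      using k cdom_subset_pts[OF k(1)] by (auto simp: topspace)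
    fix U' assume "openin (atlas_topology (ch ` J)) U'"
    then have "open (co k ` (U' \<inter> cdom k))" using k by (simp add: opn_iff opn_def[symmetric])
    moreover have "{u \<in> topspace ?X. ci k u \<in> U'} = co k ` (U' \<inter> cdom k)"
      using k by auto
    ultimately show "openin ?X {u \<in> topspace ?X. ci k u \<in> U'}"
      by (auto intro: open_subset)
  qed
  ultimately have "compactin (atlas_topology (ch ` J)) K"
    unfolding K_def by (rule image_compactin)
  then have "closedin (atlas_topology (ch ` J)) K"
    by (rule compactin_imp_closedin[OF hausdorff])
  then have oK: "opn (topspace (atlas_topology (ch ` J)) - K)"
    by (simp add: opn_def openin_diff)
  have top: "pts \<subseteq> topspace (atlas_topology (ch ` J))"
  proof
    fix q assume "q \<in> pts"
    then obtain l where "l \<in> J" "q \<in> cdom l" by (rule ptsE)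
    then show "q \<in> topspace (atlas_topology (ch ` J))"
      using opn_cdom[of l] openin_subset unfolding opn_def by blast
  qed
  have K: "K \<subseteq> U"
  proof
    fix q assume "q \<in> K"
    then obtain q' where "q' \<in> W" "q = ci k (co k q')" using e by (auto simp: K_def)
    then show "q \<in> U" using k by (auto simp: W_def)
  qed
  have zero: "b q = 0" if "q \<notin> K" for q
  proof (cases "q \<in> cdom k")
    case True
    then have "co k q \<notin> cball (co k p) e" using that k unfolding K_def by force
    then show ?thesis using b0(3)[of "co k q"] r by (simp add: b_def dist_commute)
  qed (simp add: b_def)
  have far: "\<exists>N. opn N \<and> q \<in> N \<and> (\<forall>r\<in>N. b r = 0)" if "q \<in> pts" "q \<notin> K" for q
    using oK zero that top by (intro exI[of _ "topspace (atlas_topology (ch ` J)) - K"]) auto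
  show thesis
  proof
    show "smooth_at q b" if q: "q \<in> pts" for q
    proof (cases "q \<in> cdom k")
      case True
      have "smooth_at q (\<lambda>q. b0 (co k q))"
        by (rule smooth_at_compose[OF smooth_at_co[OF k(1) True] open_UNIV _ b0(1)]) simp
      then show ?thesis
        by (rule smooth_at_cong[OF _ opn_cdom[OF k(1)] True]) (simp add: b_def)
    next
      case False
      have "K \<subseteq> cdom k" using e k W(2) by (force simp: K_def)
      then obtain N where "opn N" "q \<in> N" "\<forall>r\<in>N. b r = 0" using far[OF q] False by blast
      then show ?thesis using smooth_at_cong[OF smooth_at_const[OF q, of "0::real"]] by auto
    qed
    show "opn V" unfolding V_def by (intro opn_Int W opn_preimage k open_ball)
    show "p \<in> V" using W k r by (auto simp: V_def)
    show "V \<subseteq> U" by (auto simp: V_def W_def)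
    show "b q = 1" if "q \<in> V" for q
      using that b0(2)[of "co k q"] by (auto simp: V_def b_def dist_commute)
    show "\<exists>N. opn N \<and> q \<in> N \<and> (\<forall>r\<in>N. b r = 0)" if "q \<in> pts" "q \<notin> U" for q
      using far that K by blast
  qed
qed

end


section \<open>Moving frames and linear connections\<close>

text \<open>A frame over a chart is a family of linear automorphisms \<open>F k p\<close> of the model space: the
  vector \<open>v\<close> stands for the tangent vector with coordinates \<open>F k p v\<close>.\<close>

locale framed = hausdorff_charted J ch
  for J :: "'k set" and ch :: "'k \<Rightarrow> ('p, 'e::euclidean_space) chart" +
  fixes F G :: "'k \<Rightarrow> 'p \<Rightarrow> 'e \<Rightarrow> 'e"
  assumes linear_F: "k \<in> J \<Longrightarrow> p \<in> cdom k \<Longrightarrow> linear (F k p)"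
    and linear_G: "k \<in> J \<Longrightarrow> p \<in> cdom k \<Longrightarrow> linear (G k p)"
    and GF: "k \<in> J \<Longrightarrow> p \<in> cdom k \<Longrightarrow> G k p (F k p v) = v"
    and FG: "k \<in> J \<Longrightarrow> p \<in> cdom k \<Longrightarrow> F k p (G k p v) = v"
    and smooth_F: "k \<in> J \<Longrightarrow> p \<in> cdom k \<Longrightarrow> smooth_at p (\<lambda>q. F k q v)"
    and smooth_G: "k \<in> J \<Longrightarrow> p \<in> cdom k \<Longrightarrow> smooth_at p (\<lambda>q. G k q v)"
begin

abbreviation SF :: "('p \<Rightarrow> real) set" where "SF \<equiv> smooth_functions (ch ` J)"
abbreviation VF :: "('p \<Rightarrow> 'p tangent) set" where "VF \<equiv> vector_fields (ch ` J)"
abbreviation conn where "conn nabla \<equiv> linear_connection (ch ` J) nabla"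

definition frame :: "'k \<Rightarrow> 'p \<Rightarrow> 'e \<Rightarrow> 'p tangent" where
  "frame k p v = coord_vector (ch ` J) (ch k) (F k p v) p"

text \<open>The derivative along the tangent vector with components \<open>v\<close> in the frame.\<close>

definition fderiv :: "'k \<Rightarrow> ('p \<Rightarrow> 'b::real_normed_vector) \<Rightarrow> 'p \<Rightarrow> 'e \<Rightarrow> 'b" where
  "fderiv k f p v = cderiv k f p (F k p v)"

definition coords :: "'k \<Rightarrow> ('p \<Rightarrow> 'p tangent) \<Rightarrow> 'p \<Rightarrow> 'e" where
  "coords k X p = (THE v. X p = frame k p v)"

text \<open>Components in the frame over \<open>l\<close> of the vector with components \<open>v\<close> in the frame over \<open>k\<close>
  (\<open>frame_chg\<close>).\<close>

definition chg :: "'k \<Rightarrow> 'k \<Rightarrow> 'p \<Rightarrow> 'e \<Rightarrow> 'e" where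
  "chg k l p v = G l p (cderiv k (co l) p (F k p v))"

lemma SF_smooth_at: "f \<in> SF \<Longrightarrow> k \<in> J \<Longrightarrow> p \<in> cdom k \<Longrightarrow> smooth_at p f"
  using smooth_functions_iff cdom_subset_pts by blast

lemma frame_apply: "frame k p v f = (if f \<in> SF then fderiv k f p v else 0)"
  by (simp add: frame_def coord_vector_def chart_deriv_cderiv fderiv_def)

lemma linear_fderiv: "smooth_at p f \<Longrightarrow> k \<in> J \<Longrightarrow> p \<in> cdom k \<Longrightarrow> linear (fderiv k f p)"
  unfolding fderiv_def
  using linear_compose[OF linear_F linear_cderiv] by (simp add: o_def)

lemma fderiv_cong:
  "opn U \<Longrightarrow> p \<in> U \<Longrightarrow> (\<And>q. q \<in> U \<Longrightarrow> f q = g q) \<Longrightarrow> k \<in> J \<Longrightarrow> p \<in> cdom k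
    \<Longrightarrow> fderiv k f p v = fderiv k g p v"
  unfolding fderiv_def by (rule cderiv_cong)

lemma frame_add:
  "k \<in> J \<Longrightarrow> p \<in> cdom k \<Longrightarrow> frame k p (v + w) f = frame k p v f + frame k p w f"
  using linear_add[OF linear_fderiv[OF SF_smooth_at]] by (simp add: frame_apply)

lemma frame_scaleR:
  "k \<in> J \<Longrightarrow> p \<in> cdom k \<Longrightarrow> frame k p (a *\<^sub>R v) f = a * frame k p v f"
  using linear_scale[OF linear_fderiv[OF SF_smooth_at]] by (simp add: frame_apply)

lemma frame_0: "k \<in> J \<Longrightarrow> p \<in> cdom k \<Longrightarrow> frame k p 0 f = 0"
  using frame_scaleR[of k p 0 0 f] by simp

lemma frame_sum:
  "k \<in> J \<Longrightarrow> p \<in> cdom k \<Longrightarrow> frame k p (\<Sum>i\<in>I. v i) f = (\<Sum>i\<in>I. frame k p (v i) f)"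
  by (induction I rule: infinite_finite_induct) (simp_all add: frame_0 frame_add)


subsection \<open>Global extensions of local objects\<close>

text \<open>The product with a bump function.  That the extension vanishes near the points outside \<open>U\<close>, and not
  merely at them, is what later makes extended vector fields smooth in the charts which do not meet
  the given one.\<close>

lemma extend_smooth:
  fixes f :: "'p \<Rightarrow> 'b::real_normed_vector"
  assumes "opn U" "p \<in> U" "\<And>q. q \<in> U \<Longrightarrow> smooth_at q f"
  obtains g V where "\<And>q. q \<in> pts \<Longrightarrow> smooth_at q g" "opn V" "p \<in> V" "V \<subseteq> U"
    "\<And>q. q \<in> V \<Longrightarrow> g q = f q"
    "\<And>q. q \<in> pts \<Longrightarrow> q \<notin> U \<Longrightarrow> \<exists>N. opn N \<and> q \<in> N \<and> (\<forall>r\<in>N. g r = 0)"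
proof -
  obtain b :: "'p \<Rightarrow> real" and V where b: "\<And>q. q \<in> pts \<Longrightarrow> smooth_at q b"
    "opn V" "p \<in> V" "V \<subseteq> U" "\<And>q. q \<in> V \<Longrightarrow> b q = 1"
    "\<And>q. q \<in> pts \<Longrightarrow> q \<notin> U \<Longrightarrow> \<exists>N. opn N \<and> q \<in> N \<and> (\<forall>r\<in>N. b r = 0)"
    by (rule bump_function[OF assms(1,2)]) blast
  define g where "g q = (if q \<in> U then b q *\<^sub>R f q else 0)" for q
  show thesis
  proof
    show far: "\<exists>N. opn N \<and> q \<in> N \<and> (\<forall>r\<in>N. g r = 0)"
      if q: "q \<in> pts" "q \<notin> U" for q
    proof -
      obtain N where "opn N" "q \<in> N" "\<forall>r\<in>N. b r = 0" using b(6)[OF q] by blast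
      then show ?thesis by (intro exI[of _ N]) (simp add: g_def)
    qed
    show "smooth_at q g" if q: "q \<in> pts" for q
    proof (cases "q \<in> U")
      case True
      show ?thesis
        by (rule smooth_at_cong[OF smooth_at_scaleR[OF b(1)[OF q] assms(3)[OF True]] assms(1) True])
          (simp add: g_def)
    next
      case False
      then obtain N where "opn N" "q \<in> N" "\<forall>r\<in>N. g r = 0" using far q by blast
      then show ?thesis using smooth_at_cong[OF smooth_at_const[OF q, of "0::'b"]] by auto
    qed
    show "g q = f q" if "q \<in> V" for q using that b(4,5) by (auto simp: g_def)
  qed (use b in auto)
qed

text \<open>Tangent vectors are determined by their values on global functions because the coordinate
  functions extend, near a given point, to global smooth functions.\<close>

lemma frame_inject:
  assumes k: "k \<in> J" "p \<in> cdom k" and eq: "frame k p v = frame k p w"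
  shows "v = w"
proof -
  have "F k p v \<bullet> i = F k p w \<bullet> i" for i
  proof -
    have sm: "smooth_at q (\<lambda>q. co k q \<bullet> i)" if "q \<in> cdom k" for q
      using smooth_at_inner[OF smooth_at_co[OF k(1) that]] .
    obtain g V where g: "\<And>q. q \<in> pts \<Longrightarrow> smooth_at q g" "opn V" "p \<in> V" "V \<subseteq> cdom k"
      "\<And>q. q \<in> V \<Longrightarrow> g q = co k q \<bullet> i"
      by (rule extend_smooth[OF opn_cdom[OF k(1)] k(2) sm]) auto
    have SF: "g \<in> SF" using g(1) by (simp add: smooth_functions_iff)
    have "fderiv k g p u = F k p u \<bullet> i" for u
    proof -
      have "fderiv k g p u = cderiv k (\<lambda>q. co k q \<bullet> i) p (F k p u)"
        unfolding fderiv_def by (rule cderiv_cong[OF g(2,3,5) k])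
      then show ?thesis
        by (simp add: cderiv_bounded_linear[OF bounded_linear_inner_left smooth_at_co[OF k] k]
            cderiv_co_self[OF k])
    qed
    then show ?thesis using fun_cong[OF eq, of g] SF by (simp add: frame_apply)
  qed
  then have "F k p v = F k p w" by (simp add: euclidean_eq_iff[of "F k p v"])
  then show ?thesis using GF[OF k] by metis
qed

lemma coords_eqI: "k \<in> J \<Longrightarrow> p \<in> cdom k \<Longrightarrow> X p = frame k p v \<Longrightarrow> coords k X p = v"
  unfolding coords_def using frame_inject by (intro the_equality) auto


subsection \<open>Changes of frames\<close>

lemma fderiv_chg:
  assumes "smooth_at p f" "k \<in> J" "l \<in> J" "p \<in> cdom k" "p \<in> cdom l"
  shows "fderiv k f p v = fderiv l f p (chg k l p v)"
  unfolding fderiv_def chg_def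
  using cderiv_change[OF assms(1,2,4,3,5)] FG[OF assms(3,5)] by simp

lemma frame_chg:
  assumes "k \<in> J" "l \<in> J" "p \<in> cdom k" "p \<in> cdom l"
  shows "frame k p v = frame l p (chg k l p v)"
  using fderiv_chg[OF SF_smooth_at[OF _ assms(1,3)] assms] by (simp add: frame_apply fun_eq_iff)

lemma linear_chg:
  assumes "k \<in> J" "l \<in> J" "p \<in> cdom k" "p \<in> cdom l"
  shows "linear (chg k l p)"
  unfolding chg_def
  using linear_compose[OF linear_compose[OF linear_F linear_cderiv] linear_G] assms
    smooth_at_co by (simp add: o_def)

lemma smooth_at_F:
  assumes "k \<in> J" "p \<in> cdom k" "smooth_at p w"
  shows "smooth_at p (\<lambda>q. F k q (w q))"
  by (rule smooth_at_linear_field[OF opn_cdom[OF assms(1)] assms(2) _ _ assms(3)])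
    (use assms linear_F smooth_F in auto)

lemma smooth_at_G:
  assumes "k \<in> J" "p \<in> cdom k" "smooth_at p w"
  shows "smooth_at p (\<lambda>q. G k q (w q))"
  by (rule smooth_at_linear_field[OF opn_cdom[OF assms(1)] assms(2) _ _ assms(3)])
    (use assms linear_G smooth_G in auto)

lemma smooth_at_fderiv:
  assumes "smooth_at p f" "smooth_at p w" "k \<in> J" "p \<in> cdom k"
  shows "smooth_at p (\<lambda>q. fderiv k f q (w q))"
  unfolding fderiv_def
  by (rule smooth_at_cderiv[OF assms(1) smooth_at_F[OF assms(3,4,2)] assms(3,4)])

lemma smooth_at_chg:
  assumes "smooth_at p w" "k \<in> J" "l \<in> J" "p \<in> cdom k" "p \<in> cdom l"
  shows "smooth_at p (\<lambda>q. chg k l q (w q))"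
  unfolding chg_def
  by (intro smooth_at_G smooth_at_cderiv smooth_at_F smooth_at_co assms)

lemma chg_chg:
  assumes "k \<in> J" "l \<in> J" "p \<in> cdom k" "p \<in> cdom l"
  shows "chg l k p (chg k l p v) = v"
proof (rule frame_inject[OF assms(1,3)])
  have "frame k p v = frame l p (chg k l p v)" by (rule frame_chg[OF assms])
  also have "\<dots> = frame k p (chg l k p (chg k l p v))" by (rule frame_chg[OF assms(2,1,4,3)])
  finally show "frame k p (chg l k p (chg k l p v)) = frame k p v" by (rule sym)
qed


subsection \<open>Vector fields\<close>

lemma VF_outside: "X \<in> VF \<Longrightarrow> p \<notin> pts \<Longrightarrow> X p = (\<lambda>f. 0)"
  by (simp add: vector_fields_def)

lemma VF_coords:
  assumes "X \<in> VF" "k \<in> J" "p \<in> cdom k"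
  shows "X p = frame k p (coords k X p)" and "smooth_at p (coords k X)"
proof -
  obtain \<xi> where \<xi>: "smooth_in_chart (ch k) \<xi>"
    "\<And>q. q \<in> cdom k \<Longrightarrow> X q = coord_vector (ch ` J) (ch k) (\<xi> q) q"
    using assms unfolding vector_fields_def by blast
  have X: "X q = frame k q (G k q (\<xi> q))" if "q \<in> cdom k" for q
    using \<xi>(2)[OF that] FG[OF assms(2) that] by (simp add: frame_def)
  then have coords: "coords k X q = G k q (\<xi> q)" if "q \<in> cdom k" for q
    using coords_eqI[OF assms(2) that] that by blast
  show "X p = frame k p (coords k X p)" using X coords assms by simp
  have "smooth_at p \<xi>" using \<xi>(1) assms by (simp add: smooth_in_chart_iff)
  then have "smooth_at p (\<lambda>q. G k q (\<xi> q))" by (rule smooth_at_G[OF assms(2,3)])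
  then show "smooth_at p (coords k X)"
    by (rule smooth_at_cong[OF _ opn_cdom[OF assms(2)] assms(3)]) (simp add: coords)
qed

text \<open>A field that near each point has smooth components in some chart has smooth components in every chart,
  since the change of frames is smooth.\<close>

lemma VF_I:
  assumes out: "\<And>p. p \<notin> pts \<Longrightarrow> X p = (\<lambda>f. 0)"
    and loc: "\<And>p. p \<in> pts \<Longrightarrow>
      \<exists>k\<in>J. \<exists>V \<xi>. opn V \<and> p \<in> V \<and> V \<subseteq> cdom k \<and> smooth_at p \<xi> \<and> (\<forall>q\<in>V. X q = frame k q (\<xi> q))"
  shows "X \<in> VF"
proof -
  have "\<exists>\<xi>. smooth_in_chart (ch l) \<xi> \<and> (\<forall>p\<in>cdom l. X p = coord_vector (ch ` J) (ch l) (\<xi> p) p)"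
    if l: "l \<in> J" for l
  proof (intro exI[of _ "\<lambda>q. F l q (coords l X q)"] conjI ballI)
    have near: "smooth_at p (coords l X) \<and> X p = frame l p (coords l X p)" if p: "p \<in> cdom l" for p
    proof -
      have "p \<in> pts" using p l cdom_subset_pts by auto
      then obtain k V \<xi> where k: "k \<in> J" "opn V" "p \<in> V" "V \<subseteq> cdom k" "smooth_at p \<xi>"
        "\<And>q. q \<in> V \<Longrightarrow> X q = frame k q (\<xi> q)" using loc by blast
      have X: "X q = frame l q (chg k l q (\<xi> q))" if "q \<in> V \<inter> cdom l" for q
        using k(6) frame_chg[OF k(1) l] that k(4) by auto
      then have coords: "coords l X q = chg k l q (\<xi> q)" if "q \<in> V \<inter> cdom l" for q
        using coords_eqI[OF l] that by blast
      have "smooth_at p (\<lambda>q. chg k l q (\<xi> q))"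
        by (rule smooth_at_chg[OF k(5,1) l]) (use k p in auto)
      then have "smooth_at p (coords l X)"
        by (rule smooth_at_cong[where U = "V \<inter> cdom l"])
          (use k l p coords in \<open>auto intro: opn_Int opn_cdom\<close>)
      then show ?thesis using X coords k(3) p by simp
    qed
    show "smooth_in_chart (ch l) (\<lambda>q. F l q (coords l X q))"
      unfolding smooth_in_chart_iff[OF l] using near smooth_at_F[OF l] by blast
    show "X p = coord_vector (ch ` J) (ch l) (F l p (coords l X p)) p" if "p \<in> cdom l" for p
      using near[OF that] by (simp add: frame_def)
  qed
  then show ?thesis using out by (auto simp: vector_fields_def)
qed

lemma VF_I_chartwise:
  assumes "\<And>p. p \<notin> pts \<Longrightarrow> X p = (\<lambda>f. 0)"
    and "\<And>k p. k \<in> J \<Longrightarrow> p \<in> cdom k \<Longrightarrow> X p = frame k p (\<xi> k p)"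
    and "\<And>k p. k \<in> J \<Longrightarrow> p \<in> cdom k \<Longrightarrow> smooth_at p (\<xi> k)"
  shows "X \<in> VF"
proof (rule VF_I)
  fix p assume "p \<in> pts"
  then obtain k where k: "k \<in> J" "p \<in> cdom k" by (rule ptsE)
  show "\<exists>k\<in>J. \<exists>V \<xi>. opn V \<and> p \<in> V \<and> V \<subseteq> cdom k \<and> smooth_at p \<xi> \<and> (\<forall>q\<in>V. X q = frame k q (\<xi> q))"
    using assms(2,3) k opn_cdom[OF k(1)]
    by (intro bexI[OF _ k(1)] exI[of _ "cdom k"] exI[of _ "\<xi> k"]) auto
qed (rule assms(1))

lemma VF_zero: "(\<lambda>p f. 0) \<in> VF"
  by (rule VF_I_chartwise[where \<xi> = "\<lambda>k p. 0"])
    (use smooth_at_const cdom_subset_pts in \<open>auto simp: frame_0 fun_eq_iff\<close>)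

lemma VF_add:
  assumes "X \<in> VF" "Y \<in> VF"
  shows "(\<lambda>p f. X p f + Y p f) \<in> VF"
proof (rule VF_I_chartwise[where \<xi> = "\<lambda>k p. coords k X p + coords k Y p"])
  show "(\<lambda>f. X p f + Y p f) = frame k p (coords k X p + coords k Y p)" if "k \<in> J" "p \<in> cdom k" for k p
    using fun_cong[OF VF_coords(1)[OF assms(1) that]] fun_cong[OF VF_coords(1)[OF assms(2) that]]
    by (auto simp: frame_add[OF that])
  show "smooth_at p (\<lambda>p. coords k X p + coords k Y p)" if "k \<in> J" "p \<in> cdom k" for k p
    by (intro smooth_at_add VF_coords(2) assms that)
qed (use assms VF_outside in auto)

lemma VF_scale:
  assumes "f \<in> SF" "X \<in> VF"
  shows "(\<lambda>p g. f p * X p g) \<in> VF"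
proof (rule VF_I_chartwise[where \<xi> = "\<lambda>k p. f p *\<^sub>R coords k X p"])
  show "(\<lambda>g. f p * X p g) = frame k p (f p *\<^sub>R coords k X p)" if "k \<in> J" "p \<in> cdom k" for k p
    using fun_cong[OF VF_coords(1)[OF assms(2) that]] by (auto simp: frame_scaleR[OF that])
  show "smooth_at p (\<lambda>p. f p *\<^sub>R coords k X p)" if "k \<in> J" "p \<in> cdom k" for k p
    by (intro smooth_at_scaleR SF_smooth_at[OF assms(1) that] VF_coords(2) assms that)
qed (use assms VF_outside in auto)

lemma VF_sum:
  assumes "\<And>i. i \<in> I \<Longrightarrow> X i \<in> VF"
  shows "(\<lambda>p f. \<Sum>i\<in>I. X i p f) \<in> VF"
  using assms
  by (induction I rule: infinite_finite_induct) (simp_all add: VF_zero VF_add)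

lemma coords_add:
  assumes "X \<in> VF" "Y \<in> VF" "k \<in> J" "p \<in> cdom k"
  shows "coords k (\<lambda>p f. X p f + Y p f) p = coords k X p + coords k Y p"
  by (rule coords_eqI[OF assms(3,4)])
    (use fun_cong[OF VF_coords(1)[OF assms(1,3,4)]] fun_cong[OF VF_coords(1)[OF assms(2,3,4)]] in
      \<open>auto simp: frame_add[OF assms(3,4)]\<close>)

lemma coords_scale:
  assumes "X \<in> VF" "k \<in> J" "p \<in> cdom k"
  shows "coords k (\<lambda>p g. f p * X p g) p = f p *\<^sub>R coords k X p"
  by (rule coords_eqI[OF assms(2,3)])
    (use fun_cong[OF VF_coords(1)[OF assms]] in \<open>auto simp: frame_scaleR[OF assms(2,3)]\<close>)

lemma extend_vector_field:
  assumes k: "k \<in> J" and U: "opn U" "p \<in> U" "U \<subseteq> cdom k"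
    and \<xi>: "\<And>q. q \<in> U \<Longrightarrow> smooth_at q \<xi>"
  obtains X V where "X \<in> VF" "opn V" "p \<in> V" "V \<subseteq> U" "\<And>q. q \<in> V \<Longrightarrow> X q = frame k q (\<xi> q)"
proof -
  obtain g V where g: "\<And>q. q \<in> pts \<Longrightarrow> smooth_at q g" "opn V" "p \<in> V" "V \<subseteq> U"
    "\<And>q. q \<in> V \<Longrightarrow> g q = \<xi> q"
    "\<And>q. q \<in> pts \<Longrightarrow> q \<notin> U \<Longrightarrow> \<exists>N. opn N \<and> q \<in> N \<and> (\<forall>r\<in>N. g r = 0)"
    by (rule extend_smooth[OF U(1,2) \<xi>]) auto
  define X where "X q = (if q \<in> cdom k then frame k q (g q) else (\<lambda>f. 0))" for q
  show thesis
  proof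
    show "X \<in> VF"
    proof (rule VF_I)
      show "X q = (\<lambda>f. 0)" if "q \<notin> pts" for q
        using that cdom_subset_pts[OF k] by (auto simp: X_def)
      fix q assume q: "q \<in> pts"
      show "\<exists>l\<in>J. \<exists>V \<xi>. opn V \<and> q \<in> V \<and> V \<subseteq> cdom l \<and> smooth_at q \<xi> \<and> (\<forall>r\<in>V. X r = frame l r (\<xi> r))"
      proof (cases "q \<in> cdom k")
        case True
        then show ?thesis using g(1)[OF q] opn_cdom[OF k]
          by (intro bexI[OF _ k] exI[of _ "cdom k"] exI[of _ g]) (simp add: X_def)
      next
        case False
        then obtain N where N: "opn N" "q \<in> N" "\<forall>r\<in>N. g r = 0" using g(6)[OF q] U(3) by blast
        obtain l where l: "l \<in> J" "q \<in> cdom l" using q by (rule ptsE)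
        show ?thesis
        proof (intro bexI[OF _ l(1)] exI[of _ "N \<inter> cdom l"] exI[of _ "\<lambda>r. 0"] conjI ballI)
          show "X r = frame l r 0" if "r \<in> N \<inter> cdom l" for r
            using that N(3) l k by (auto simp: X_def frame_0 fun_eq_iff)
        qed (use N l q in \<open>auto intro: opn_Int opn_cdom smooth_at_const\<close>)
      qed
    qed
    show "X q = frame k q (\<xi> q)" if "q \<in> V" for q
      using that g(4,5) U(3) by (auto simp: X_def)
  qed (use g in auto)
qed


subsection \<open>Linear connections are local\<close>

lemma conn_VF: "conn nabla \<Longrightarrow> X \<in> VF \<Longrightarrow> Y \<in> VF \<Longrightarrow> nabla X Y \<in> VF"
  unfolding linear_connection_def by (blast dest: PiE_mem)

lemma conn_left:
  assumes "conn nabla"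
  shows "X \<in> VF \<Longrightarrow> X' \<in> VF \<Longrightarrow> Y \<in> VF \<Longrightarrow>
      nabla (\<lambda>p g. X p g + X' p g) Y = (\<lambda>p g. nabla X Y p g + nabla X' Y p g)"
    and "f \<in> SF \<Longrightarrow> X \<in> VF \<Longrightarrow> Y \<in> VF \<Longrightarrow>
      nabla (\<lambda>p g. f p * X p g) Y = (\<lambda>p g. f p * nabla X Y p g)"
  using assms unfolding linear_connection_def by simp_all

lemma conn_right:
  assumes "conn nabla"
  shows "X \<in> VF \<Longrightarrow> Y \<in> VF \<Longrightarrow> Y' \<in> VF \<Longrightarrow>
      nabla X (\<lambda>p g. Y p g + Y' p g) = (\<lambda>p g. nabla X Y p g + nabla X Y' p g)"
    and "f \<in> SF \<Longrightarrow> X \<in> VF \<Longrightarrow> Y \<in> VF \<Longrightarrow>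
      nabla X (\<lambda>p g. f p * Y p g) = (\<lambda>p g. X p f * Y p g + f p * nabla X Y p g)"
  using assms unfolding linear_connection_def by simp_all

text \<open>Let \<open>b\<close> be a bump function at \<open>p\<close> with support in \<open>V\<close>.  Then \<open>b X = b X'\<close> and \<open>b Y = b Y'\<close> globally.
  The axioms take \<open>b\<close> out of both arguments of the connection; the Leibniz terms \<open>X'(b) Y\<close> and
  \<open>X'(b) Y'\<close> agree at \<open>p\<close>, and \<open>b p = 1\<close>.\<close>

lemma conn_local:
  assumes nabla: "conn nabla" and VF: "X \<in> VF" "X' \<in> VF" "Y \<in> VF" "Y' \<in> VF"
    and V: "opn V" "p \<in> V" "\<And>q. q \<in> V \<Longrightarrow> X q = X' q" "\<And>q. q \<in> V \<Longrightarrow> Y q = Y' q"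
  shows "nabla X Y p = nabla X' Y' p"
proof -
  obtain b :: "'p \<Rightarrow> real" and W where b: "\<And>q. q \<in> pts \<Longrightarrow> smooth_at q b"
    "opn W" "p \<in> W" "W \<subseteq> V" "\<And>q. q \<in> W \<Longrightarrow> b q = 1"
    "\<And>q. q \<in> pts \<Longrightarrow> q \<notin> V \<Longrightarrow> \<exists>N. opn N \<and> q \<in> N \<and> (\<forall>r\<in>N. b r = 0)"
    by (rule bump_function[OF V(1,2)]) blast
  have SF: "b \<in> SF" using b(1) by (simp add: smooth_functions_iff)
  have cut: "(\<lambda>p g. b p * Z p g) = (\<lambda>p g. b p * Z' p g)"
    if "Z \<in> VF" "Z' \<in> VF" "\<And>q. q \<in> V \<Longrightarrow> Z q = Z' q" for Z Z'
  proof (intro ext)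
    fix q g
    consider "q \<in> V" | "q \<in> pts" "q \<notin> V" | "q \<notin> pts" by blast
    then show "b q * Z q g = b q * Z' q g"
    proof cases
      case 2
      then show ?thesis using b(6) by fastforce
    qed (use that VF_outside in auto)
  qed
  have bp: "b p = 1" using b by simp
  have "nabla X Y p = nabla X' Y p"
  proof
    fix g
    have "b p * nabla X Y p g = b p * nabla X' Y p g"
      using arg_cong[OF cut[OF VF(1,2) V(3)], of "\<lambda>Z. nabla Z Y p g"]
        conn_left(2)[OF nabla SF VF(1,3)] conn_left(2)[OF nabla SF VF(2,3)] by simp
    then show "nabla X Y p g = nabla X' Y p g" using bp by simp
  qed
  moreover have "nabla X' Y p = nabla X' Y' p"
  proof
    fix g
    have "X' p b * Y p g + b p * nabla X' Y p g = X' p b * Y' p g + b p * nabla X' Y' p g"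
      using arg_cong[OF cut[OF VF(3,4) V(4)], of "\<lambda>Z. nabla X' Z p g"]
        conn_right(2)[OF nabla SF VF(2,3)] conn_right(2)[OF nabla SF VF(2,4)] by simp
    then show "nabla X' Y p g = nabla X' Y' p g" using V(2,4) bp by simp
  qed
  ultimately show ?thesis by simp
qed

lemma conn_zero_left: "conn nabla \<Longrightarrow> Y \<in> VF \<Longrightarrow> nabla (\<lambda>p g. 0) Y = (\<lambda>p g. 0)"
  using conn_left(2)[of nabla "\<lambda>p. 0" "\<lambda>p g. 0" Y] VF_zero
  by (simp add: smooth_functions_iff smooth_at_const)

lemma conn_zero_right: "conn nabla \<Longrightarrow> X \<in> VF \<Longrightarrow> nabla X (\<lambda>p g. 0) = (\<lambda>p g. 0)"
proof -
  assume "conn nabla" "X \<in> VF"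
  then show ?thesis
    using conn_right(2)[of nabla "\<lambda>p. 0" X "\<lambda>p g. 0"] VF_zero
    by (simp add: smooth_functions_iff smooth_at_const)
qed

lemma conn_sum_left:
  assumes "conn nabla" "\<And>i. i \<in> I \<Longrightarrow> f i \<in> SF" "\<And>i. i \<in> I \<Longrightarrow> X i \<in> VF" "Y \<in> VF"
  shows "nabla (\<lambda>p g. \<Sum>i\<in>I. f i p * X i p g) Y = (\<lambda>p g. \<Sum>i\<in>I. f i p * nabla (X i) Y p g)"
  using assms(2,3)
proof (induction I rule: infinite_finite_induct)
  case (insert i I)
  have "(\<lambda>p g. \<Sum>i\<in>I. f i p * X i p g) \<in> VF" "(\<lambda>p g. f i p * X i p g) \<in> VF"
    using insert.prems by (auto intro!: VF_sum VF_scale)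
  then show ?case
    using insert conn_left[OF assms(1)] assms(4) by simp
qed (simp_all add: conn_zero_left[OF assms(1,4)])

lemma conn_sum_right:
  assumes "conn nabla" "\<And>i. i \<in> I \<Longrightarrow> f i \<in> SF" "\<And>i. i \<in> I \<Longrightarrow> Y i \<in> VF" "X \<in> VF"
  shows "nabla X (\<lambda>p g. \<Sum>i\<in>I. f i p * Y i p g)
    = (\<lambda>p g. \<Sum>i\<in>I. X p (f i) * Y i p g + f i p * nabla X (Y i) p g)"
  using assms(2,3)
proof (induction I rule: infinite_finite_induct)
  case (insert i I)
  have "(\<lambda>p g. \<Sum>i\<in>I. f i p * Y i p g) \<in> VF" "(\<lambda>p g. f i p * Y i p g) \<in> VF"
    using insert.prems by (auto intro!: VF_sum VF_scale)
  then show ?case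
    using insert conn_right[OF assms(1)] assms(4) by simp
qed (simp_all add: conn_zero_right[OF assms(1,4)])


subsection \<open>Coefficients of a connection in the frames\<close>

text \<open>\<open>\<omega> k p u v\<close> is the vector which represents \<open>nabla\<^sub>V U\<close> at \<open>p\<close>, where \<open>U\<close> and \<open>V\<close> are the frame
  fields with the constant components \<open>u\<close> and \<open>v\<close>.  This is demanded for basis vectors only; bilinearity
  then fixes the values of \<open>\<omega>\<close> on all vectors.\<close>

definition has_coeffs where
  "has_coeffs nabla \<omega> \<longleftrightarrow>
     (\<forall>k\<in>J. \<forall>u\<in>Basis. \<forall>v\<in>Basis.
        connection_eq_on (ch ` J) nabla (cdom k) (\<lambda>p. frame k p v) (\<lambda>p. frame k p u)
          (\<lambda>p. frame k p (\<omega> k p u v)))"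

definition bilinear_coeffs :: "('k \<Rightarrow> 'p \<Rightarrow> 'e \<Rightarrow> 'e \<Rightarrow> 'e) \<Rightarrow> bool" where
  "bilinear_coeffs \<omega> \<longleftrightarrow> (\<forall>k\<in>J. \<forall>p\<in>cdom k. bilinear (\<omega> k p))"

definition smooth_coeffs :: "('k \<Rightarrow> 'p \<Rightarrow> 'e \<Rightarrow> 'e \<Rightarrow> 'e) \<Rightarrow> bool" where
  "smooth_coeffs \<omega> \<longleftrightarrow> (\<forall>k\<in>J. \<forall>p\<in>cdom k. \<forall>u\<in>Basis. \<forall>v\<in>Basis. smooth_at p (\<lambda>q. \<omega> k q u v))"

text \<open>The law \<open>B \<omega>(u, v) = \<omega>'(B u, B v) + d(B u)(v)\<close> for the change of frames \<open>B\<close> from \<open>k\<close> to \<open>l\<close>.  It is not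
  tensorial: the frame fields over \<open>k\<close> have non-constant components over \<open>l\<close>.\<close>

definition coeffs_transform :: "('k \<Rightarrow> 'p \<Rightarrow> 'e \<Rightarrow> 'e \<Rightarrow> 'e) \<Rightarrow> bool" where
  "coeffs_transform \<omega> \<longleftrightarrow>
     (\<forall>k\<in>J. \<forall>l\<in>J. \<forall>p\<in>cdom k \<inter> cdom l. \<forall>u\<in>Basis. \<forall>v\<in>Basis.
        chg k l p (\<omega> k p u v) = \<omega> l p (chg k l p u) (chg k l p v) + fderiv k (\<lambda>q. chg k l q u) p v)"

lemma bilinear_coeffsD:
  assumes "bilinear_coeffs \<omega>" "k \<in> J" "p \<in> cdom k"
  shows "linear (\<lambda>u. \<omega> k p u v)" "linear (\<omega> k p u)"
  using assms by (auto simp: bilinear_coeffs_def bilinear_def)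

lemma has_coeffsD:
  assumes "has_coeffs nabla \<omega>" "k \<in> J" "u \<in> Basis" "v \<in> Basis" "X \<in> VF" "Y \<in> VF"
    and "opn V" "V \<subseteq> cdom k" "p \<in> V"
    and "\<And>q. q \<in> V \<Longrightarrow> X q = frame k q v" "\<And>q. q \<in> V \<Longrightarrow> Y q = frame k q u"
  shows "nabla X Y p = frame k p (\<omega> k p u v)"
proof -
  have "connection_eq_on (ch ` J) nabla (cdom k) (\<lambda>p. frame k p v) (\<lambda>p. frame k p u)
          (\<lambda>p. frame k p (\<omega> k p u v))"
    using assms(1-4) by (simp add: has_coeffs_def)
  then show ?thesis
    unfolding connection_eq_on_def opn_def[symmetric] using assms(5-) by blast
qed

lemma has_coeffsI:
  assumes "\<And>k u v X Y V p. k \<in> J \<Longrightarrow> u \<in> Basis \<Longrightarrow> v \<in> Basis \<Longrightarrow> X \<in> VF \<Longrightarrow> Y \<in> VF \<Longrightarrow> opn V \<Longrightarrow>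
    V \<subseteq> cdom k \<Longrightarrow> p \<in> V \<Longrightarrow> (\<And>q. q \<in> V \<Longrightarrow> X q = frame k q v) \<Longrightarrow> (\<And>q. q \<in> V \<Longrightarrow> Y q = frame k q u) \<Longrightarrow>
    nabla X Y p = frame k p (\<omega> k p u v)"
  shows "has_coeffs nabla \<omega>"
  unfolding has_coeffs_def connection_eq_on_def opn_def[symmetric]
  using assms by blast

lemma frame_field:
  assumes "k \<in> J" "p \<in> cdom k"
  obtains X V where "X \<in> VF" "opn V" "p \<in> V" "V \<subseteq> cdom k" "\<And>q. q \<in> V \<Longrightarrow> X q = frame k q u"
proof -
  have sm: "smooth_at q (\<lambda>q. u)" if "q \<in> cdom k" for q
    using smooth_at_const that cdom_subset_pts[OF assms(1)] by blast
  show thesis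
    by (rule extend_vector_field[OF assms(1) opn_cdom[OF assms(1)] assms(2) order_refl sm])
      (use that in blast)+
qed

lemma opn_INT:
  assumes "finite I" "I \<noteq> {}" "\<And>i. i \<in> I \<Longrightarrow> opn (V i)"
  shows "opn (\<Inter>i\<in>I. V i)"
  using assms unfolding opn_def by (intro openin_INT2) auto

text \<open>Near \<open>p\<close> the fields \<open>X\<close> and \<open>Y\<close> coincide with combinations of global extensions of the basis
  fields with global functions as coefficients; as the connection is local, its axioms then
  determine the value at \<open>p\<close>.\<close>

lemma conn_formula:
  assumes nabla: "conn nabla" and \<omega>: "has_coeffs nabla \<omega>" "bilinear_coeffs \<omega>"
    and VF: "X \<in> VF" "Y \<in> VF" and k: "k \<in> J" "p \<in> cdom k"
  shows "nabla X Y p = frame k p (fderiv k (coords k Y) p (coords k X p) + \<omega> k p (coords k Y p) (coords k X p))"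
proof -
  have "\<exists>E V. E \<in> VF \<and> opn V \<and> p \<in> V \<and> V \<subseteq> cdom k \<and> (\<forall>q\<in>V. E q = frame k q b)" for b
    using frame_field[OF k, of b] by metis
  then obtain E V where E: "\<And>b. E b \<in> VF" "\<And>b. opn (V b)" "\<And>b. p \<in> V b" "\<And>b. V b \<subseteq> cdom k"
    "\<And>b q. q \<in> V b \<Longrightarrow> E b q = frame k q b" by metis
  have "\<exists>g W. (\<forall>q\<in>pts. smooth_at q g) \<and> opn W \<and> p \<in> W \<and> W \<subseteq> cdom k \<and> (\<forall>q\<in>W. g q = coords k Z q)"
    if "Z \<in> VF" for Z
    using extend_smooth[OF opn_cdom[OF k(1)] k(2) VF_coords(2)[OF that k(1)]] by metis
  note ext = this
  obtain x WX where x: "\<And>q. q \<in> pts \<Longrightarrow> smooth_at q x" "opn WX" "p \<in> WX" "WX \<subseteq> cdom k"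
    "\<And>q. q \<in> WX \<Longrightarrow> x q = coords k X q" using ext[OF VF(1)] by metis
  obtain y WY where y: "\<And>q. q \<in> pts \<Longrightarrow> smooth_at q y" "opn WY" "p \<in> WY" "WY \<subseteq> cdom k"
    "\<And>q. q \<in> WY \<Longrightarrow> y q = coords k Y q" using ext[OF VF(2)] by metis
  \<comment> \<open>on \<open>U\<close> all the extensions agree with the local objects at once\<close>
  define U where "U = (\<Inter>b\<in>Basis. V b) \<inter> (WX \<inter> WY)"
  have U: "opn U" "p \<in> U" "U \<subseteq> cdom k"
    using E(2,3) x(2-4) y(2-4) unfolding U_def by (auto intro!: opn_Int opn_INT)
  have EU: "E b q = frame k q b" if "b \<in> Basis" "q \<in> U" for b q
    using E(5) that by (auto simp: U_def)
  have SF: "(\<lambda>q. x q \<bullet> b) \<in> SF" "(\<lambda>q. y q \<bullet> b) \<in> SF" for b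
    using x(1) y(1) by (auto simp: smooth_functions_iff intro!: smooth_at_inner)
  let ?S = "\<lambda>z q g. \<Sum>b\<in>Basis. (z q \<bullet> b) * E b q g"
  have S: "?S x \<in> VF" "?S y \<in> VF" using SF E(1) by (auto intro!: VF_sum VF_scale)
  have comb: "frame k q z g = (\<Sum>b\<in>Basis. (z \<bullet> b) * E b q g)" if "q \<in> U" for q z g
  proof -
    have q: "q \<in> cdom k" using that U(3) by auto
    have "frame k q (\<Sum>b\<in>Basis. (z \<bullet> b) *\<^sub>R b) g = (\<Sum>b\<in>Basis. (z \<bullet> b) * frame k q b g)"
      by (simp only: frame_sum[OF k(1) q] frame_scaleR[OF k(1) q])
    then show ?thesis using EU[OF _ that] by (simp add: euclidean_representation)
  qed
  have XS: "X q = ?S x q" "Y q = ?S y q" if "q \<in> U" for q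
  proof -
    have q: "q \<in> cdom k" "q \<in> WX" "q \<in> WY" using that U(3) by (auto simp: U_def)
    show "X q = ?S x q" "Y q = ?S y q"
      using VF_coords(1)[OF VF(1) k(1) q(1)] VF_coords(1)[OF VF(2) k(1) q(1)] x(5)[OF q(2)] y(5)[OF q(3)]
        comb[OF that] by (auto simp: fun_eq_iff)
  qed
  let ?\<eta> = "fderiv k y p" and ?\<omega> = "\<omega> k p"
  have pp: "p \<in> pts" using k cdom_subset_pts by auto
  have y': "E b p (\<lambda>q. y q \<bullet> c) = ?\<eta> b \<bullet> c" if "b \<in> Basis" for b c
  proof -
    have "fderiv k (\<lambda>q. y q \<bullet> c) p b = ?\<eta> b \<bullet> c"
      unfolding fderiv_def by (rule cderiv_bounded_linear[OF bounded_linear_inner_left y(1)[OF pp] k])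
    then show ?thesis using EU[OF that U(2)] SF by (simp add: frame_apply)
  qed
  have EE: "nabla (E b) (E c) p = frame k p (?\<omega> c b)" if "b \<in> Basis" "c \<in> Basis" for b c
    by (rule has_coeffsD[OF \<omega>(1) k(1) that(2,1) E(1) E(1) U(1,3,2)]) (use EU that in auto)
  have EY: "nabla (E b) (?S y) p g = frame k p (?\<eta> b + ?\<omega> (y p) b) g" if b: "b \<in> Basis" for b g
  proof -
    have "nabla (E b) (?S y) p g
        = (\<Sum>c\<in>Basis. (?\<eta> b \<bullet> c) * E c p g + (y p \<bullet> c) * frame k p (?\<omega> c b) g)"
      using conn_sum_right[OF nabla, where I = Basis and f = "\<lambda>c q. y q \<bullet> c" and Y = E and X = "E b"]
        SF(2) E(1) y'[OF b] EE[OF b]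
      by (auto simp: fun_eq_iff intro!: sum.cong)
    also have "\<dots> = frame k p (?\<eta> b) g + frame k p (\<Sum>c\<in>Basis. (y p \<bullet> c) *\<^sub>R ?\<omega> c b) g"
      by (simp add: sum.distrib comb[OF U(2), of "?\<eta> b"] frame_sum[OF k] frame_scaleR[OF k])
    also have "(\<Sum>c\<in>Basis. (y p \<bullet> c) *\<^sub>R ?\<omega> c b) = ?\<omega> (y p) b"
      by (rule linear_Basis_expansion[OF bilinear_coeffsD(1)[OF \<omega>(2) k], symmetric])
    finally show ?thesis by (simp add: frame_add[OF k])
  qed
  have lin: "linear (\<lambda>v. ?\<eta> v + ?\<omega> (y p) v)"
    by (intro linear_compose_add linear_fderiv[OF y(1)[OF pp] k] bilinear_coeffsD(2)[OF \<omega>(2) k])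
  have "nabla (?S x) (?S y) p g = frame k p (?\<eta> (x p) + ?\<omega> (y p) (x p)) g" for g
  proof -
    have "nabla (?S x) (?S y) p g = (\<Sum>b\<in>Basis. (x p \<bullet> b) * nabla (E b) (?S y) p g)"
      using conn_sum_left[OF nabla, where I = Basis and f = "\<lambda>b q. x q \<bullet> b" and X = E and Y = "?S y"]
        SF(1) E(1) S(2) by (simp add: fun_eq_iff)
    also have "\<dots> = frame k p (\<Sum>b\<in>Basis. (x p \<bullet> b) *\<^sub>R (?\<eta> b + ?\<omega> (y p) b)) g"
      by (simp add: EY frame_sum[OF k] frame_scaleR[OF k])
    also have "(\<Sum>b\<in>Basis. (x p \<bullet> b) *\<^sub>R (?\<eta> b + ?\<omega> (y p) b)) = ?\<eta> (x p) + ?\<omega> (y p) (x p)"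
      by (rule linear_Basis_expansion[OF lin, symmetric])
    finally show ?thesis .
  qed
  moreover have "nabla X Y p = nabla (?S x) (?S y) p"
    by (rule conn_local[OF nabla VF(1) S(1) VF(2) S(2) U(1,2) XS])
  moreover have "?\<eta> v = fderiv k (coords k Y) p v" for v
    by (rule fderiv_cong[OF y(2,3,5) k])
  ultimately show ?thesis
    using x(5)[OF x(3)] y(5)[OF y(3)] by (simp add: fun_eq_iff)
qed

text \<open>For the frame fields over \<open>k\<close> with constant components \<open>u\<close> and \<open>v\<close>, the formula for the connection is
  evaluated in the frame over \<open>l\<close>, where these fields have the components \<open>chg k l q u\<close> and
  \<open>chg k l q v\<close>.\<close>

lemma coeffs_transform_necessary:
  assumes nabla: "conn nabla" and \<omega>: "has_coeffs nabla \<omega>" "bilinear_coeffs \<omega>"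
  shows "coeffs_transform \<omega>"
  unfolding coeffs_transform_def
proof (intro ballI)
  fix k l p and u v :: 'e
  assume kl: "k \<in> J" "l \<in> J" and "p \<in> cdom k \<inter> cdom l" and uv: "u \<in> Basis" "v \<in> Basis"
  then have p: "p \<in> cdom k" "p \<in> cdom l" by auto
  obtain Y V where Y: "Y \<in> VF" "opn V" "p \<in> V" "V \<subseteq> cdom k" "\<And>q. q \<in> V \<Longrightarrow> Y q = frame k q u"
    by (rule frame_field[OF kl(1) p(1), of u]) blast
  obtain X W where X: "X \<in> VF" "opn W" "p \<in> W" "W \<subseteq> cdom k" "\<And>q. q \<in> W \<Longrightarrow> X q = frame k q v"
    by (rule frame_field[OF kl(1) p(1), of v]) blast
  define U where "U = V \<inter> W \<inter> cdom l"
  have U: "opn U" "p \<in> U" "U \<subseteq> cdom k" "U \<subseteq> cdom l"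
    using X Y p kl by (auto simp: U_def opn_Int opn_cdom)
  have coords: "coords l Y q = chg k l q u" "coords l X q = chg k l q v" if "q \<in> U" for q
  proof -
    have q: "q \<in> cdom k" "q \<in> cdom l" "q \<in> V" "q \<in> W" using that U by (auto simp: U_def)
    show "coords l Y q = chg k l q u" "coords l X q = chg k l q v"
      using Y(5)[OF q(3)] X(5)[OF q(4)] coords_eqI[OF kl(2) q(2)] frame_chg[OF kl q(1,2)] by metis+
  qed
  have sm: "smooth_at p (\<lambda>q. chg k l q u)"
    by (intro smooth_at_chg kl p smooth_at_const) (use p kl cdom_subset_pts in auto)
  have "frame l p (chg k l p (\<omega> k p u v)) = nabla X Y p"
    using has_coeffsD[OF \<omega>(1) kl(1) uv X(1) Y(1) U(1,3,2)] X(5) Y(5) frame_chg[OF kl p]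
    by (auto simp: U_def)
  also have "\<dots> = frame l p (fderiv l (coords l Y) p (chg k l p v) + \<omega> l p (chg k l p u) (chg k l p v))"
    using conn_formula[OF nabla \<omega> X(1) Y(1) kl(2) p(2)] coords[OF U(2)] by simp
  also have "fderiv l (coords l Y) p (chg k l p v) = fderiv l (\<lambda>q. chg k l q u) p (chg k l p v)"
    by (rule fderiv_cong[OF U(1,2) coords(1) kl(2) p(2)])
  also have "\<dots> = fderiv k (\<lambda>q. chg k l q u) p v"
    using fderiv_chg[OF sm kl p] by simp
  finally show "chg k l p (\<omega> k p u v)
      = \<omega> l p (chg k l p u) (chg k l p v) + fderiv k (\<lambda>q. chg k l q u) p v"
    using frame_inject[OF kl(2) p(2)] by (simp add: add.commute)
qed

lemma coeffs_unique:
  assumes "has_coeffs nabla \<omega>" "has_coeffs nabla \<omega>'" "k \<in> J" "p \<in> cdom k" "u \<in> Basis" "v \<in> Basis"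
  shows "\<omega> k p u v = \<omega>' k p u v"
proof -
  obtain Y V where Y: "Y \<in> VF" "opn V" "p \<in> V" "V \<subseteq> cdom k" "\<And>q. q \<in> V \<Longrightarrow> Y q = frame k q u"
    by (rule frame_field[OF assms(3,4), of u]) blast
  obtain X W where X: "X \<in> VF" "opn W" "p \<in> W" "W \<subseteq> cdom k" "\<And>q. q \<in> W \<Longrightarrow> X q = frame k q v"
    by (rule frame_field[OF assms(3,4), of v]) blast
  have U: "opn (V \<inter> W)" "V \<inter> W \<subseteq> cdom k" "p \<in> V \<inter> W" using X Y by (auto intro: opn_Int)
  show ?thesis
    using has_coeffsD[OF assms(1,3,5,6) X(1) Y(1) U] has_coeffsD[OF assms(2,3,5,6) X(1) Y(1) U]
      X(5) Y(5) frame_inject[OF assms(3,4)] by auto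
qed

lemma sum_Basis_inner:
  fixes f :: "'a::euclidean_space \<Rightarrow> 'b::real_vector"
  assumes "u \<in> Basis"
  shows "(\<Sum>b\<in>Basis. (u \<bullet> b) *\<^sub>R f b) = f u"
proof -
  have "(\<Sum>b\<in>Basis. (u \<bullet> b) *\<^sub>R f b) = (\<Sum>b\<in>Basis. if b = u then f b else 0)"
    using assms by (intro sum.cong) (auto simp: inner_Basis)
  then show ?thesis using assms by simp
qed

text \<open>The coefficients at \<open>p\<close> are the components of \<open>nabla\<^sub>V U\<close> for global fields that extend the frame fields
  near \<open>p\<close>.  By locality they do not depend on the extensions; as one extension serves for all points of
  a neighbourhood, they depend smoothly on \<open>p\<close>.\<close>

lemma coeffs_exist:
  assumes nabla: "conn nabla"
  obtains \<omega> where "bilinear_coeffs \<omega>" "smooth_coeffs \<omega>" "has_coeffs nabla \<omega>"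
proof -
  \<comment> \<open>\<open>w\<close> is an admissible value of the coefficient at \<open>p\<close>, for all extensions at once\<close>
  define ok where "ok k p u v w \<longleftrightarrow> (\<forall>X\<in>VF. \<forall>Y\<in>VF. \<forall>V. opn V \<and> p \<in> V \<and> V \<subseteq> cdom k \<and>
     (\<forall>q\<in>V. X q = frame k q v) \<and> (\<forall>q\<in>V. Y q = frame k q u) \<longrightarrow> nabla X Y p = frame k p w)" for k p u v w
  define \<omega>0 where "\<omega>0 k p u v = (SOME w. ok k p u v w)" for k p u v
  define \<omega> where "\<omega> k p u v = (\<Sum>b\<in>Basis. (u \<bullet> b) *\<^sub>R (\<Sum>c\<in>Basis. (v \<bullet> c) *\<^sub>R \<omega>0 k p b c))" for k p u v
  have basis: "\<omega> k p u v = \<omega>0 k p u v" if "u \<in> Basis" "v \<in> Basis" for k p u v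
    using that by (simp add: \<omega>_def sum_Basis_inner)
  have near: "\<exists>X\<in>VF. \<exists>Y\<in>VF. \<exists>V. opn V \<and> p \<in> V \<and> V \<subseteq> cdom k \<and>
     (\<forall>q\<in>V. X q = frame k q v) \<and> (\<forall>q\<in>V. Y q = frame k q u) \<and>
     (\<forall>q\<in>V. \<omega>0 k q u v = coords k (nabla X Y) q \<and> ok k q u v (\<omega>0 k q u v))"
    if k: "k \<in> J" "p \<in> cdom k" for k p u v
  proof -
    obtain Y V where Y: "Y \<in> VF" "opn V" "p \<in> V" "V \<subseteq> cdom k" "\<And>q. q \<in> V \<Longrightarrow> Y q = frame k q u"
      by (rule frame_field[OF k, of u]) blast
    obtain X W where X: "X \<in> VF" "opn W" "p \<in> W" "W \<subseteq> cdom k" "\<And>q. q \<in> W \<Longrightarrow> X q = frame k q v"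
      by (rule frame_field[OF k, of v]) blast
    have nXY: "nabla X Y \<in> VF" by (rule conn_VF[OF nabla X(1) Y(1)])
    have "\<omega>0 k q u v = coords k (nabla X Y) q \<and> ok k q u v (\<omega>0 k q u v)" if q: "q \<in> V \<inter> W" for q
    proof -
      have qk: "q \<in> cdom k" using q X by auto
      have ok: "ok k q u v (coords k (nabla X Y) q)"
        unfolding ok_def
      proof (intro ballI allI impI, elim conjE)
        fix X' Y' V' assume A: "X' \<in> VF" "Y' \<in> VF" "opn V'" "q \<in> V'"
          "\<forall>q\<in>V'. X' q = frame k q v" "\<forall>q\<in>V'. Y' q = frame k q u"
        have "nabla X' Y' q = nabla X Y q"
          by (rule conn_local[OF nabla A(1) X(1) A(2) Y(1), of "V' \<inter> (V \<inter> W)"])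
            (use A X Y q in \<open>auto intro: opn_Int\<close>)
        then show "nabla X' Y' q = frame k q (coords k (nabla X Y) q)"
          using VF_coords(1)[OF nXY k(1) qk] by simp
      qed
      then have ok0: "ok k q u v (\<omega>0 k q u v)" unfolding \<omega>0_def by (rule someI)
      have "nabla X Y q = frame k q (\<omega>0 k q u v)"
        using ok0 X Y q unfolding ok_def
        by (metis Int_iff inf_le2 le_infI2 opn_Int)
      then show ?thesis using ok0 coords_eqI[OF k(1) qk] by metis
    qed
    note main = this
    show ?thesis
      by (rule bexI[OF _ X(1)], rule bexI[OF _ Y(1)], rule exI[of _ "V \<inter> W"])
        (intro conjI ballI; use X Y main in \<open>blast intro: opn_Int\<close>)
  qed
  show thesis
  proof
    show "bilinear_coeffs \<omega>"
      unfolding bilinear_coeffs_def bilinear_def \<omega>_def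
      by (auto intro!: linearI simp: inner_add_left algebra_simps sum.distrib scaleR_sum_right)
    show "smooth_coeffs \<omega>"
      unfolding smooth_coeffs_def
    proof (intro ballI)
      fix k p and u v :: 'e assume k: "k \<in> J" "p \<in> cdom k" and uv: "u \<in> Basis" "v \<in> (Basis :: 'e set)"
      obtain X Y V where XY: "X \<in> VF" "Y \<in> VF" "opn V" "p \<in> V"
        "\<And>q. q \<in> V \<Longrightarrow> \<omega>0 k q u v = coords k (nabla X Y) q"
        using near[OF k, of v u] by blast
      have "smooth_at p (coords k (nabla X Y))"
        by (rule VF_coords(2)[OF conn_VF[OF nabla XY(1,2)] k])
      then show "smooth_at p (\<lambda>q. \<omega> k q u v)"
        by (rule smooth_at_cong[OF _ XY(3,4)]) (simp add: XY(5) basis[OF uv])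
    qed
    show "has_coeffs nabla \<omega>"
    proof (rule has_coeffsI)
      fix k V p and u v :: 'e and X Y
      assume A: "k \<in> J" "u \<in> Basis" "v \<in> Basis" "X \<in> VF" "Y \<in> VF" "opn V" "V \<subseteq> cdom k" "p \<in> V"
        "\<And>q. q \<in> V \<Longrightarrow> X q = frame k q v" "\<And>q. q \<in> V \<Longrightarrow> Y q = frame k q u"
      have "p \<in> cdom k" using A by auto
      then have "ok k p u v (\<omega>0 k p u v)" using near[OF A(1), of p v u] by blast
      then have "nabla X Y p = frame k p (\<omega>0 k p u v)"
        unfolding ok_def using A by blast
      then show "nabla X Y p = frame k p (\<omega> k p u v)" using basis A(2,3) by simp
    qed
  qed
qed


subsection \<open>The connection with given coefficients\<close>

text \<open>Both sides are bilinear in \<open>u\<close> and \<open>v\<close>, so that the law for basis vectors implies the general one.\<close>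

lemma coeffs_transformD:
  assumes "bilinear_coeffs \<omega>" "coeffs_transform \<omega>" "k \<in> J" "l \<in> J" "p \<in> cdom k" "p \<in> cdom l"
  shows "chg k l p (\<omega> k p u v) = \<omega> l p (chg k l p u) (chg k l p v) + fderiv k (\<lambda>q. chg k l q u) p v"
proof -
  note lin = bilinear_coeffsD[OF assms(1)] linear_chg[OF assms(3-6)]
  let ?L = "\<lambda>u v. chg k l p (\<omega> k p u v)"
  let ?R = "\<lambda>u v. \<omega> l p (chg k l p u) (chg k l p v) + fderiv k (\<lambda>q. chg k l q u) p v"
  have o: "opn (cdom k \<inter> cdom l)" "p \<in> cdom k \<inter> cdom l" using assms by (auto intro: opn_Int opn_cdom)
  have sm: "smooth_at p (\<lambda>q. chg k l q u)" for u
    using assms cdom_subset_pts by (intro smooth_at_chg smooth_at_const) auto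
  have "linear (\<lambda>u. ?L u v)" "linear (\<lambda>v. ?L u v)" for u v
    using linear_compose[OF lin(1) lin(3)] linear_compose[OF lin(2) lin(3)] assms by (auto simp: o_def)
  moreover have "linear (\<lambda>u. \<omega> l p (chg k l p u) (chg k l p v))"
    "linear (\<lambda>v. \<omega> l p (chg k l p u) (chg k l p v))" for u v
    using linear_compose[OF lin(3) lin(1)] linear_compose[OF lin(3) lin(2)] assms by (auto simp: o_def)
  moreover have "linear (\<lambda>u. fderiv k (\<lambda>q. chg k l q u) p v)" for v
  proof (rule linearI)
    fix u u' :: 'e and a :: real
    have "fderiv k (\<lambda>q. chg k l q (u + u')) p v = fderiv k (\<lambda>q. chg k l q u + chg k l q u') p v"
      by (rule fderiv_cong[OF o]) (use assms linear_add[OF linear_chg] in auto)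
    then show "fderiv k (\<lambda>q. chg k l q (u + u')) p v
        = fderiv k (\<lambda>q. chg k l q u) p v + fderiv k (\<lambda>q. chg k l q u') p v"
      using assms by (simp add: fderiv_def cderiv_add[OF sm sm])
    have "fderiv k (\<lambda>q. chg k l q (a *\<^sub>R u)) p v = fderiv k (\<lambda>q. a *\<^sub>R chg k l q u) p v"
      by (rule fderiv_cong[OF o]) (use assms linear_scale[OF linear_chg] in auto)
    then show "fderiv k (\<lambda>q. chg k l q (a *\<^sub>R u)) p v = a *\<^sub>R fderiv k (\<lambda>q. chg k l q u) p v"
      using assms by (simp add: fderiv_def cderiv_bounded_linear[OF bounded_linear_scaleR_right sm])
  qed
  ultimately have L: "bilinear ?L" and R: "bilinear ?R"
    using linear_fderiv[OF sm assms(3,5)] by (auto simp: bilinear_def intro!: linear_compose_add)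
  have "?L = ?R"
    by (rule bilinear_eq_stdbasis[OF L R]) (use assms in \<open>auto simp: coeffs_transform_def\<close>)
  then show ?thesis by meson
qed

text \<open>Components in the frame over \<open>k\<close> of the derivative of \<open>Y\<close> along \<open>X\<close>; compare \<open>conn_formula\<close>.\<close>

definition conn_value where
  "conn_value \<omega> k X Y p = fderiv k (coords k Y) p (coords k X p) + \<omega> k p (coords k Y p) (coords k X p)"

text \<open>The chart at each point is chosen arbitrarily; by \<open>conn_value_chg\<close> the value does not depend on the
  choice.  Outside the vector fields the operator is undefined, as \<open>linear_connection\<close> demands.\<close>

definition conn_of where
  "conn_of \<omega> = (\<lambda>X\<in>VF. \<lambda>Y\<in>VF. \<lambda>p.
     if p \<in> pts then (let k = SOME k. k \<in> J \<and> p \<in> cdom k in frame k p (conn_value \<omega> k X Y p))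
     else (\<lambda>f. 0))"

text \<open>Differentiating the components \<open>chg k l q (coords k Y q)\<close> of \<open>Y\<close> over \<open>l\<close> produces, besides the derivative of
  the components over \<open>k\<close>, the derivative of the change of frames.  The transformation law says that the
  change of the coefficients compensates it.\<close>

lemma conn_value_chg:
  assumes \<omega>: "bilinear_coeffs \<omega>" "coeffs_transform \<omega>" and VF: "X \<in> VF" "Y \<in> VF"
    and kl: "k \<in> J" "l \<in> J" "p \<in> cdom k" "p \<in> cdom l"
  shows "conn_value \<omega> l X Y p = chg k l p (conn_value \<omega> k X Y p)"
proof -
  have coords: "coords l Z q = chg k l q (coords k Z q)"
    if "Z \<in> VF" "q \<in> cdom k \<inter> cdom l" for Z q
    using VF_coords(1)[OF that(1) kl(1)] that(2) frame_chg[OF kl(1,2)] by (auto intro!: coords_eqI[OF kl(2)])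
  let ?\<xi> = "coords k X p" and ?\<eta> = "coords k Y p"
  have o: "opn (cdom k \<inter> cdom l)" "p \<in> cdom k \<inter> cdom l" using kl by (auto intro: opn_Int opn_cdom)
  have sm: "smooth_at p (\<lambda>q. chg k l q u)" for u
    using kl cdom_subset_pts by (intro smooth_at_chg smooth_at_const) auto
  have "fderiv l (coords l Y) p (chg k l p ?\<xi>) = fderiv k (coords l Y) p ?\<xi>"
    using fderiv_chg[OF VF_coords(2)[OF VF(2) kl(2,4)] kl] by simp
  also have "\<dots> = fderiv k (\<lambda>q. chg k l q (coords k Y q)) p ?\<xi>"
    by (rule fderiv_cong[OF o coords[OF VF(2)] kl(1,3)])
  also have "\<dots> = fderiv k (\<lambda>q. chg k l q ?\<eta>) p ?\<xi> + chg k l p (fderiv k (coords k Y) p ?\<xi>)"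
    unfolding fderiv_def
    by (rule cderiv_linear_field[OF o _ sm VF_coords(2)[OF VF(2) kl(1,3)] kl(1,3)])
      (use linear_chg[OF kl(1,2)] in auto)
  finally show ?thesis
    using coeffs_transformD[OF \<omega> kl, of ?\<eta> ?\<xi>] coords[OF VF(1) o(2)] coords[OF VF(2) o(2)]
    by (simp add: conn_value_def linear_add[OF linear_chg[OF kl]])
qed

lemma conn_of_chart:
  assumes \<omega>: "bilinear_coeffs \<omega>" "coeffs_transform \<omega>" and VF: "X \<in> VF" "Y \<in> VF"
    and l: "l \<in> J" "p \<in> cdom l"
  shows "conn_of \<omega> X Y p = frame l p (conn_value \<omega> l X Y p)"
proof -
  define k where "k = (SOME k. k \<in> J \<and> p \<in> cdom k)"
  have k: "k \<in> J" "p \<in> cdom k" using someI_ex[of "\<lambda>k. k \<in> J \<and> p \<in> cdom k"] l unfolding k_def by blast+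
  have "p \<in> pts" using l cdom_subset_pts by auto
  then have "conn_of \<omega> X Y p = frame k p (conn_value \<omega> k X Y p)"
    using VF by (simp add: conn_of_def k_def Let_def)
  then show ?thesis
    using frame_chg[OF k(1) l(1) k(2) l(2)] conn_value_chg[OF \<omega> VF k(1) l(1) k(2) l(2)] by simp
qed

lemma smooth_at_coeffs:
  assumes "bilinear_coeffs \<omega>" "smooth_coeffs \<omega>" "k \<in> J" "p \<in> cdom k" "smooth_at p \<xi>" "smooth_at p \<eta>"
  shows "smooth_at p (\<lambda>q. \<omega> k q (\<eta> q) (\<xi> q))"
proof (rule smooth_at_linear_field[OF opn_cdom[OF assms(3)] assms(4) _ _ assms(5)])
  show "linear (\<omega> k q (\<eta> q))" if "q \<in> cdom k" for q
    by (rule bilinear_coeffsD(2)[OF assms(1,3) that])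
  show "smooth_at p (\<lambda>q. \<omega> k q (\<eta> q) b)" if "b \<in> Basis" for b
    by (rule smooth_at_linear_field[where L = "\<lambda>q u. \<omega> k q u b", OF opn_cdom[OF assms(3)] assms(4) _ _ assms(6)])
      (use assms that bilinear_coeffsD(1)[OF assms(1,3)] in \<open>auto simp: smooth_coeffs_def\<close>)
qed

lemma conn_of_VF:
  assumes \<omega>: "bilinear_coeffs \<omega>" "smooth_coeffs \<omega>" "coeffs_transform \<omega>" and VF: "X \<in> VF" "Y \<in> VF"
  shows "conn_of \<omega> X Y \<in> VF"
proof (rule VF_I_chartwise[where \<xi> = "\<lambda>k. conn_value \<omega> k X Y"])
  show "conn_of \<omega> X Y p = (\<lambda>f. 0)" if "p \<notin> pts" for p
    using VF that by (simp add: conn_of_def)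
  show "conn_of \<omega> X Y p = frame k p (conn_value \<omega> k X Y p)" if "k \<in> J" "p \<in> cdom k" for k p
    by (rule conn_of_chart[OF \<omega>(1,3) VF that])
  show "smooth_at p (conn_value \<omega> k X Y)" if "k \<in> J" "p \<in> cdom k" for k p
    unfolding conn_value_def[abs_def]
    by (rule smooth_at_add[OF
        smooth_at_fderiv[OF VF_coords(2)[OF VF(2) that] VF_coords(2)[OF VF(1) that] that]
        smooth_at_coeffs[OF \<omega>(1,2) that VF_coords(2)[OF VF(1) that] VF_coords(2)[OF VF(2) that]]])
qed

lemma frame_field_apply:
  assumes "X \<in> VF" "f \<in> SF" "k \<in> J" "p \<in> cdom k"
  shows "X p f = fderiv k f p (coords k X p)"
  using VF_coords(1)[OF assms(1,3,4)] assms(2) by (metis frame_apply)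

lemma conn_of_conn:
  assumes \<omega>: "bilinear_coeffs \<omega>" "smooth_coeffs \<omega>" "coeffs_transform \<omega>"
  shows "conn (conn_of \<omega>)"
proof -
  have eqI: "Z = Z'" if "\<And>p g. p \<notin> pts \<Longrightarrow> Z p g = Z' p g"
    "\<And>k p g. k \<in> J \<Longrightarrow> p \<in> cdom k \<Longrightarrow> Z p g = Z' p g" for Z Z' :: "'p \<Rightarrow> 'p tangent"
  proof (intro ext)
    fix p g
    show "Z p g = Z' p g" by (cases "p \<in> pts") (use that in \<open>auto elim: ptsE\<close>)
  qed
  note chart = conn_of_chart[OF \<omega>(1,3)]
  note lin = bilinear_coeffsD[OF \<omega>(1)]
  have out: "conn_of \<omega> X Y p g = 0" if "X \<in> VF" "Y \<in> VF" "p \<notin> pts" for X Y p g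
    using that by (simp add: conn_of_def)
  have lin\<eta>: "linear (fderiv k (coords k Y) p)" if "Y \<in> VF" "k \<in> J" "p \<in> cdom k" for Y k p
    by (rule linear_fderiv[OF VF_coords(2)[OF that] that(2,3)])
  show ?thesis
    unfolding linear_connection_def
  proof (intro conjI ballI)
    show "conn_of \<omega> \<in> VF \<rightarrow>\<^sub>E VF \<rightarrow>\<^sub>E VF"
    proof (rule PiE_I)
      show "conn_of \<omega> X \<in> VF \<rightarrow>\<^sub>E VF" if "X \<in> VF" for X
        by (rule PiE_I) (use that conn_of_VF[OF \<omega>] in \<open>auto simp: conn_of_def\<close>)
    qed (auto simp: conn_of_def)
  next
    fix X X' Y assume VF: "X \<in> VF" "X' \<in> VF" "Y \<in> VF"
    note S = VF_add[OF VF(1,2)]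
    show "conn_of \<omega> (\<lambda>p g. X p g + X' p g) Y = (\<lambda>p g. conn_of \<omega> X Y p g + conn_of \<omega> X' Y p g)"
    proof (rule eqI)
      fix k p g assume k: "k \<in> J" "p \<in> cdom k"
      show "conn_of \<omega> (\<lambda>p g. X p g + X' p g) Y p g = conn_of \<omega> X Y p g + conn_of \<omega> X' Y p g"
        by (simp add: chart[OF S VF(3) k] chart[OF VF(1,3) k] chart[OF VF(2,3) k] conn_value_def
            coords_add[OF VF(1,2) k] linear_add[OF lin\<eta>[OF VF(3) k]] linear_add[OF lin(2)[OF k]]
            frame_add[OF k])
    qed (simp add: out VF S)
  next
    fix f X Y assume f: "f \<in> SF" and VF: "X \<in> VF" "Y \<in> VF"
    note S = VF_scale[OF f VF(1)]
    show "conn_of \<omega> (\<lambda>p g. f p * X p g) Y = (\<lambda>p g. f p * conn_of \<omega> X Y p g)"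
    proof (rule eqI)
      fix k p g assume k: "k \<in> J" "p \<in> cdom k"
      show "conn_of \<omega> (\<lambda>p g. f p * X p g) Y p g = f p * conn_of \<omega> X Y p g"
        by (simp add: chart[OF S VF(2) k] chart[OF VF k] conn_value_def
            coords_scale[OF VF(1) k] linear_scale[OF lin\<eta>[OF VF(2) k]] linear_scale[OF lin(2)[OF k]]
            frame_add[OF k] frame_scaleR[OF k] algebra_simps)
    qed (simp add: out VF S)
  next
    fix X Y Y' assume VF: "X \<in> VF" "Y \<in> VF" "Y' \<in> VF"
    note S = VF_add[OF VF(2,3)]
    show "conn_of \<omega> X (\<lambda>p g. Y p g + Y' p g) = (\<lambda>p g. conn_of \<omega> X Y p g + conn_of \<omega> X Y' p g)"
    proof (rule eqI)
      fix k p g assume k: "k \<in> J" "p \<in> cdom k"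
      have "fderiv k (coords k (\<lambda>p g. Y p g + Y' p g)) p v
          = fderiv k (\<lambda>q. coords k Y q + coords k Y' q) p v" for v
        by (rule fderiv_cong[OF opn_cdom[OF k(1)] k(2) coords_add[OF VF(2,3) k(1)] k])
      then have "fderiv k (coords k (\<lambda>p g. Y p g + Y' p g)) p v
          = fderiv k (coords k Y) p v + fderiv k (coords k Y') p v" for v
        unfolding fderiv_def by (simp add: cderiv_add VF_coords(2) VF k)
      then show "conn_of \<omega> X (\<lambda>p g. Y p g + Y' p g) p g = conn_of \<omega> X Y p g + conn_of \<omega> X Y' p g"
        by (simp add: chart[OF VF(1) S k] chart[OF VF(1,2) k] chart[OF VF(1,3) k] conn_value_def
            coords_add[OF VF(2,3) k] linear_add[OF lin(1)[OF k]] frame_add[OF k])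
    qed (simp add: out VF S)
  next
    fix f X Y assume f: "f \<in> SF" and VF: "X \<in> VF" "Y \<in> VF"
    note S = VF_scale[OF f VF(2)]
    show "conn_of \<omega> X (\<lambda>p g. f p * Y p g) = (\<lambda>p g. X p f * Y p g + f p * conn_of \<omega> X Y p g)"
    proof (rule eqI)
      fix k p g assume k: "k \<in> J" "p \<in> cdom k"
      have "fderiv k (coords k (\<lambda>p g. f p * Y p g)) p v
          = fderiv k (\<lambda>q. f q *\<^sub>R coords k Y q) p v" for v
        by (rule fderiv_cong[OF opn_cdom[OF k(1)] k(2) coords_scale[OF VF(2) k(1)] k])
      then have "fderiv k (coords k (\<lambda>p g. f p * Y p g)) p v
          = f p *\<^sub>R fderiv k (coords k Y) p v + fderiv k f p v *\<^sub>R coords k Y p" for v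
        unfolding fderiv_def
        by (simp add: cderiv_bounded_bilinear[OF bounded_bilinear_scaleR SF_smooth_at[OF f k]
              VF_coords(2)[OF VF(2) k] k])
      moreover have "Y p g = frame k p (coords k Y p) g"
        using VF_coords(1)[OF VF(2) k] by simp
      ultimately show "conn_of \<omega> X (\<lambda>p g. f p * Y p g) p g = X p f * Y p g + f p * conn_of \<omega> X Y p g"
        by (simp add: chart[OF VF(1) S k] chart[OF VF k] conn_value_def frame_field_apply[OF VF(1) f k]
            coords_scale[OF VF(2) k] linear_scale[OF lin(1)[OF k]] frame_add[OF k] frame_scaleR[OF k]
            algebra_simps)
    qed (simp add: out VF S VF_outside)
  qed
qed

lemma conn_of_has_coeffs:
  assumes \<omega>: "bilinear_coeffs \<omega>" "coeffs_transform \<omega>"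
  shows "has_coeffs (conn_of \<omega>) \<omega>"
proof (rule has_coeffsI)
  fix k u v X Y V p
  assume A: "k \<in> J" "X \<in> VF" "Y \<in> VF" "opn V" "V \<subseteq> cdom k" "p \<in> V"
    "\<And>q. q \<in> V \<Longrightarrow> X q = frame k q v" "\<And>q. q \<in> V \<Longrightarrow> Y q = frame k q u"
  have p: "p \<in> cdom k" using A by auto
  have coords: "coords k X q = v" "coords k Y q = u" if "q \<in> V" for q
    using A(5,7,8) that by (auto intro!: coords_eqI[OF A(1)])
  have "fderiv k (coords k Y) p v = fderiv k (\<lambda>q. u) p v"
    by (rule fderiv_cong[OF A(4,6) coords(2) A(1) p])
  then show "conn_of \<omega> X Y p = frame k p (\<omega> k p u v)"
    using conn_of_chart[OF \<omega> A(2,3,1) p] coords[OF A(6)]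
    by (simp add: conn_value_def fderiv_def cderiv_const)
qed

lemma conn_unique:
  assumes "conn nabla" "conn nabla'" "has_coeffs nabla \<omega>" "has_coeffs nabla' \<omega>" "bilinear_coeffs \<omega>"
  shows "nabla = nabla'"
proof (rule PiE_ext[where s = "\<lambda>_. VF \<rightarrow>\<^sub>E VF" and k = VF])
  show "nabla \<in> VF \<rightarrow>\<^sub>E VF \<rightarrow>\<^sub>E VF" "nabla' \<in> VF \<rightarrow>\<^sub>E VF \<rightarrow>\<^sub>E VF"
    using assms(1,2) unfolding linear_connection_def by (simp_all only:)
  then have mem: "nabla X \<in> VF \<rightarrow>\<^sub>E VF" "nabla' X \<in> VF \<rightarrow>\<^sub>E VF" if "X \<in> VF" for X
    using that by (blast dest: PiE_mem)+
  fix X assume X: "X \<in> VF"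
  show "nabla X = nabla' X"
  proof (rule PiE_ext[OF mem[OF X]])
    fix Y assume Y: "Y \<in> VF"
    show "nabla X Y = nabla' X Y"
    proof
      fix p
      show "nabla X Y p = nabla' X Y p"
      proof (cases "p \<in> pts")
        case True
        then obtain k where k: "k \<in> J" "p \<in> cdom k" by (rule ptsE)
        show ?thesis
          using conn_formula[OF assms(1,3,5) X Y k] conn_formula[OF assms(2,4,5) X Y k] by simp
      next
        case False
        then show ?thesis
          using VF_outside[OF conn_VF[OF assms(1) X Y]] VF_outside[OF conn_VF[OF assms(2) X Y]] by simp
      qed
    qed
  qed
qed


subsection \<open>Connections which preserve a parallel field of projections\<close>

text \<open>An operator \<open>h\<close> on vector fields which is a constant linear map \<open>P\<close> in every frame is
  parallel if and only if the coefficients commute with \<open>P\<close>: the derivative term in the formula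
  for the connection commutes with \<open>P\<close> anyway.\<close>

lemma parallel_iff:
  assumes nabla: "conn nabla" and \<omega>: "has_coeffs nabla \<omega>" "bilinear_coeffs \<omega>" and P: "linear P"
    and h: "\<And>X k p. X \<in> VF \<Longrightarrow> k \<in> J \<Longrightarrow> p \<in> cdom k \<Longrightarrow> h X p = frame k p (P (coords k X p))"
    and out: "\<And>X p. p \<notin> pts \<Longrightarrow> h X p = (\<lambda>f. 0)"
  shows "(\<forall>X\<in>VF. \<forall>Y\<in>VF. nabla X (h Y) = h (nabla X Y)) \<longleftrightarrow>
    (\<forall>k\<in>J. \<forall>p\<in>cdom k. \<forall>u\<in>Basis. \<forall>v\<in>Basis. \<omega> k p (P u) v = P (\<omega> k p u v))"
proof -
  have bP: "bounded_linear P" using P linear_conv_bounded_linear by blast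
  have hVF: "h Y \<in> VF" if "Y \<in> VF" for Y
    by (rule VF_I_chartwise[OF out h[OF that]])
      (use that VF_coords(2) in \<open>auto intro!: smooth_at_bounded_linear[OF bP]\<close>)
  have hcoords: "coords k (h Y) p = P (coords k Y p)" if "Y \<in> VF" "k \<in> J" "p \<in> cdom k" for Y k p
    by (rule coords_eqI) (use that h in auto)
  have main: "nabla X (h Y) p = frame k p (P (fderiv k (coords k Y) p (coords k X p))
        + \<omega> k p (P (coords k Y p)) (coords k X p))"
    "h (nabla X Y) p = frame k p (P (fderiv k (coords k Y) p (coords k X p))
        + P (\<omega> k p (coords k Y p) (coords k X p)))"
    if VF: "X \<in> VF" "Y \<in> VF" and k: "k \<in> J" "p \<in> cdom k" for X Y k p
  proof -
    have "fderiv k (coords k (h Y)) p v = fderiv k (\<lambda>q. P (coords k Y q)) p v" for v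
      by (rule fderiv_cong[OF opn_cdom[OF k(1)] k(2) hcoords[OF VF(2) k(1)] k])
    then have "fderiv k (coords k (h Y)) p v = P (fderiv k (coords k Y) p v)" for v
      unfolding fderiv_def by (simp add: cderiv_bounded_linear[OF bP] VF_coords(2) VF k)
    then show "nabla X (h Y) p = frame k p (P (fderiv k (coords k Y) p (coords k X p))
        + \<omega> k p (P (coords k Y p)) (coords k X p))"
      using conn_formula[OF nabla \<omega> VF(1) hVF[OF VF(2)] k] by (simp add: hcoords[OF VF(2) k])
    have "coords k (nabla X Y) p
      = fderiv k (coords k Y) p (coords k X p) + \<omega> k p (coords k Y p) (coords k X p)"
      by (rule coords_eqI[OF k]) (rule conn_formula[OF nabla \<omega> VF k])
    then show "h (nabla X Y) p = frame k p (P (fderiv k (coords k Y) p (coords k X p))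
        + P (\<omega> k p (coords k Y p) (coords k X p)))"
      using h[OF conn_VF[OF nabla VF] k] by (simp add: linear_add[OF P])
  qed
  show ?thesis
  proof
    assume R: "\<forall>X\<in>VF. \<forall>Y\<in>VF. nabla X (h Y) = h (nabla X Y)"
    show "\<forall>k\<in>J. \<forall>p\<in>cdom k. \<forall>u\<in>Basis. \<forall>v\<in>Basis. \<omega> k p (P u) v = P (\<omega> k p u v)"
    proof (intro ballI)
      fix k p and u v :: 'e assume k: "k \<in> J" "p \<in> cdom k"
      obtain Y V where Y: "Y \<in> VF" "p \<in> V" "\<And>q. q \<in> V \<Longrightarrow> Y q = frame k q u"
        by (rule frame_field[OF k, of u]) blast
      obtain X W where X: "X \<in> VF" "p \<in> W" "\<And>q. q \<in> W \<Longrightarrow> X q = frame k q v"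
        by (rule frame_field[OF k, of v]) blast
      have coords: "coords k Y p = u" "coords k X p = v"
        using X(3)[OF X(2)] Y(3)[OF Y(2)] coords_eqI[OF k] by blast+
      have "nabla X (h Y) p = h (nabla X Y) p" using R X Y by simp
      then show "\<omega> k p (P u) v = P (\<omega> k p u v)"
        unfolding main[OF X(1) Y(1) k] coords using frame_inject[OF k] by fastforce
    qed
  next
    assume R: "\<forall>k\<in>J. \<forall>p\<in>cdom k. \<forall>u\<in>Basis. \<forall>v\<in>Basis. \<omega> k p (P u) v = P (\<omega> k p u v)"
    have all: "\<omega> k p (P u) v = P (\<omega> k p u v)" if k: "k \<in> J" "p \<in> cdom k" for k p u v
    proof -
      note lin = bilinear_coeffsD[OF \<omega>(2) k]
      have "bilinear (\<lambda>u v. \<omega> k p (P u) v)" "bilinear (\<lambda>u v. P (\<omega> k p u v))"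
        using linear_compose[OF P lin(1)] linear_compose[OF lin(1) P] linear_compose[OF lin(2) P] lin(2)
        by (auto simp: bilinear_def o_def)
      then have "(\<lambda>u v. \<omega> k p (P u) v) = (\<lambda>u v. P (\<omega> k p u v))"
        by (rule bilinear_eq_stdbasis) (use R k in auto)
      then show ?thesis by meson
    qed
    show "\<forall>X\<in>VF. \<forall>Y\<in>VF. nabla X (h Y) = h (nabla X Y)"
    proof (intro ballI ext)
      fix X Y p g assume VF: "X \<in> VF" "Y \<in> VF"
      show "nabla X (h Y) p g = h (nabla X Y) p g"
      proof (cases "p \<in> pts")
        case True
        then obtain k where k: "k \<in> J" "p \<in> cdom k" by (rule ptsE)
        show ?thesis by (simp add: main[OF VF k] all[OF k])
      next
        case False
        then show ?thesis using VF_outside[OF conn_VF[OF nabla VF(1) hVF[OF VF(2)]]] out by simp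
      qed
    qed
  qed
qed

end


section \<open>The manifold structure of the jet bundle\<close>

subsection \<open>Charts of the time axis\<close>

abbreviation std_time :: "(real, real) chart" where "std_time \<equiv> (UNIV, \<lambda>t. t)"

lemma chart_inv_std_time [simp]: "chart_inv std_time = (\<lambda>t. t)"
  by (auto simp: chart_inv_def fun_eq_iff intro!: inv_into_f_eq)

lemma time_atlas_iff:
  "\<tau> \<in> time_atlas \<longleftrightarrow> is_chart \<tau> \<and> open (fst \<tau>) \<and>
     smooth_on (snd \<tau> ` fst \<tau>) (chart_inv \<tau>) \<and> smooth_on (fst \<tau>) (snd \<tau>)"
  unfolding time_atlas_def max_atlas_def points_def compatible_def
  by (auto simp: is_chart_def)

lemma std_time_in_time_atlas: "std_time \<in> time_atlas"
  by (simp add: time_atlas_iff is_chart_def smooth_on_ident)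

lemma time_chart_inv:
  assumes "\<tau> \<in> time_atlas"
  shows "t \<in> fst \<tau> \<Longrightarrow> chart_inv \<tau> (snd \<tau> t) = t"
    and "s \<in> snd \<tau> ` fst \<tau> \<Longrightarrow> chart_inv \<tau> s \<in> fst \<tau> \<and> snd \<tau> (chart_inv \<tau> s) = s"
  using assms by (auto simp: time_atlas_iff is_chart_def chart_inv_def)

lemma open_time_image:
  assumes "\<tau> \<in> time_atlas" "open U"
  shows "open (snd \<tau> ` (fst \<tau> \<inter> U))"
proof -
  have "snd \<tau> ` (fst \<tau> \<inter> U) = snd \<tau> ` fst \<tau> \<inter> chart_inv \<tau> -` U"
    using time_chart_inv[OF assms(1)] by auto
  moreover have "open \<dots>"
    using assms by (intro continuous_open_preimage smooth_on_continuous_on)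
      (auto simp: time_atlas_iff is_chart_def)
  ultimately show ?thesis by simp
qed

definition time_change :: "(real, real) chart \<Rightarrow> (real, real) chart \<Rightarrow> real \<Rightarrow> real" where
  "time_change \<tau> \<tau>' s = snd \<tau>' (chart_inv \<tau> s)"

text \<open>The derivative of the time coordinate \<open>\<tau>'\<close> with respect to the time coordinate \<open>\<tau>\<close>.\<close>

definition time_factor :: "(real, real) chart \<Rightarrow> (real, real) chart \<Rightarrow> real \<Rightarrow> real" where
  "time_factor \<tau> \<tau>' s = frechet_derivative (time_change \<tau> \<tau>') (at s) 1"

lemma smooth_time_change:
  assumes "\<tau> \<in> time_atlas" "\<tau>' \<in> time_atlas"
  shows "smooth_on (snd \<tau> ` (fst \<tau> \<inter> fst \<tau>')) (time_change \<tau> \<tau>')"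
  unfolding time_change_def[abs_def]
proof (rule smooth_on_compose[where f = "chart_inv \<tau>" and g = "snd \<tau>'" and T = "fst \<tau>'"])
  show "open (snd \<tau> ` (fst \<tau> \<inter> fst \<tau>'))"
    using assms by (intro open_time_image) (auto simp: time_atlas_iff)
  show "open (fst \<tau>')" "smooth_on (fst \<tau>') (snd \<tau>')" using assms(2) by (auto simp: time_atlas_iff)
  show "smooth_on (snd \<tau> ` (fst \<tau> \<inter> fst \<tau>')) (chart_inv \<tau>)"
    using assms(1) by (auto simp: time_atlas_iff intro: smooth_on_subset)
  show "chart_inv \<tau> ` snd \<tau> ` (fst \<tau> \<inter> fst \<tau>') \<subseteq> fst \<tau>'"
    using time_chart_inv[OF assms(1)] by auto
qed

lemma smooth_time_factor:
  assumes "\<tau> \<in> time_atlas" "\<tau>' \<in> time_atlas"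
  shows "smooth_on (snd \<tau> ` (fst \<tau> \<inter> fst \<tau>')) (time_factor \<tau> \<tau>')"
  unfolding time_factor_def[abs_def]
  by (rule smooth_on_frechet_derivative[OF smooth_time_change[OF assms]])


subsection \<open>Velocities of curves\<close>

locale jet_bundle =
  fixes A :: "('m, real ^ 'n::finite) chart set"
  assumes manifold: "smooth_manifold A"
begin

lemma is_chart_A: "c \<in> A \<Longrightarrow> is_chart c"
  and compatible_A: "c \<in> A \<Longrightarrow> d \<in> A \<Longrightarrow> compatible c d"
  and hausdorff_A: "Hausdorff_space (atlas_topology A)"
  using manifold by (auto simp: smooth_manifold_def)

lemma chart_inv_A:
  assumes "c \<in> A"
  shows "m \<in> fst c \<Longrightarrow> chart_inv c (snd c m) = m"
    and "u \<in> snd c ` fst c \<Longrightarrow> chart_inv c u \<in> fst c \<and> snd c (chart_inv c u) = u"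
  using is_chart_A[OF assms] by (auto simp: is_chart_def chart_inv_def)

definition space_change where "space_change c c' u = snd c' (chart_inv c u)"

lemma smooth_space_change:
  assumes "c \<in> A" "c' \<in> A"
  shows "open (snd c ` (fst c \<inter> fst c'))"
    "smooth_on (snd c ` (fst c \<inter> fst c')) (space_change c c')"
  using compatible_A[OF assms] by (auto simp: compatible_def space_change_def[abs_def])

text \<open>The coordinates \<open>y\<^sub>1\<^sup>i\<close> of the jet of \<open>\<gamma>\<close> at \<open>t\<close>, as a vector.\<close>

definition vel :: "(real, real) chart \<Rightarrow> ('m, real ^ 'n) chart \<Rightarrow> (real \<Rightarrow> 'm) \<Rightarrow> real \<Rightarrow> real ^ 'n" where
  "vel \<tau> c \<gamma> t = vector_derivative (\<lambda>s. snd c (\<gamma> (chart_inv \<tau> s))) (at (snd \<tau> t))"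

lemma curve_in_chart:
  assumes "smooth_near A t \<gamma>" "c \<in> A" "\<gamma> t \<in> fst c"
  obtains U where "open U" "t \<in> U" "\<gamma> ` U \<subseteq> fst c" "smooth_on U (\<lambda>s. snd c (\<gamma> s))"
proof -
  obtain d U0 where d: "d \<in> A" "open U0" "t \<in> U0" "\<gamma> ` U0 \<subseteq> fst d" "smooth_on U0 (\<lambda>s. snd d (\<gamma> s))"
    using assms(1) by (auto simp: smooth_near_def)
  let ?W = "snd d ` (fst d \<inter> fst c)"
  note sc = smooth_space_change[OF d(1) assms(2)]
  define U where "U = U0 \<inter> (\<lambda>s. snd d (\<gamma> s)) -` ?W"
  have o: "open U" unfolding U_def
    by (intro continuous_open_preimage smooth_on_continuous_on d sc)
  have in_c: "\<gamma> s \<in> fst c \<and> s \<in> U0 \<and> \<gamma> s \<in> fst d" if sU: "s \<in> U" for s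
  proof -
    have s: "s \<in> U0" "\<gamma> s \<in> fst d" using sU d(4) by (auto simp: U_def)
    obtain m where m: "m \<in> fst d" "m \<in> fst c" "snd d (\<gamma> s) = snd d m"
      using sU by (auto simp: U_def)
    have "inj_on (snd d) (fst d)" using is_chart_A[OF d(1)] by (simp add: is_chart_def)
    then have "\<gamma> s = m" by (rule inj_onD[OF _ m(3) s(2) m(1)])
    then show ?thesis using s m by simp
  qed
  have "smooth_on U (\<lambda>s. space_change d c (snd d (\<gamma> s)))"
    by (rule smooth_on_compose[OF o sc(1) smooth_on_subset[OF d(5)] sc(2)]) (auto simp: U_def)
  then have "smooth_on U (\<lambda>s. snd c (\<gamma> s))"
  proof (rule smooth_on_cong_imp[OF o])
    show "space_change d c (snd d (\<gamma> s)) = snd c (\<gamma> s)" if "s \<in> U" for s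
      using chart_inv_A(1)[OF d(1), of "\<gamma> s"] in_c[OF that] by (simp add: space_change_def)
  qed
  then show thesis
  proof (rule that[OF o, rotated 2])
    obtain m where "\<gamma> t = m" "m \<in> fst d" "m \<in> fst c" using assms(3) d(3,4) by auto
    then show "t \<in> U" using d(3) by (auto simp: U_def)
    show "\<gamma> ` U \<subseteq> fst c" using in_c by auto
  qed
qed

lemma vel_has_derivative:
  assumes "smooth_near A t \<gamma>" "c \<in> A" "\<gamma> t \<in> fst c" "\<tau> \<in> time_atlas" "t \<in> fst \<tau>"
  shows "((\<lambda>s. snd c (\<gamma> (chart_inv \<tau> s))) has_derivative (\<lambda>h. h *\<^sub>R vel \<tau> c \<gamma> t)) (at (snd \<tau> t))"
proof -
  obtain U where U: "open U" "t \<in> U" "\<gamma> ` U \<subseteq> fst c" "smooth_on U (\<lambda>s. snd c (\<gamma> s))"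
    by (rule curve_in_chart[OF assms(1-3)])
  have 1: "chart_inv \<tau> differentiable (at (snd \<tau> t))"
    using assms(4,5) smooth_on_has_derivative[of _ "chart_inv \<tau>"]
    unfolding time_atlas_iff differentiable_def by blast
  have 2: "(\<lambda>s. snd c (\<gamma> s)) differentiable (at (chart_inv \<tau> (snd \<tau> t)))"
    using U(2) smooth_on_has_derivative[OF U(4)] time_chart_inv(1)[OF assms(4,5)]
    unfolding differentiable_def by auto
  have "(\<lambda>s. snd c (\<gamma> (chart_inv \<tau> s))) differentiable (at (snd \<tau> t))"
    using differentiable_chain_at[OF 1 2] by (simp add: o_def)
  then show ?thesis
    using vector_derivative_works unfolding vel_def has_vector_derivative_def by blast
qed

text \<open>In the new charts the curve reads \<open>\<phi> \<circ> (c \<circ> \<gamma> \<circ> \<tau>\<^sup>-\<^sup>1) \<circ> \<theta>\<close> with the changes of coordinates \<open>\<phi>\<close> on \<open>M\<close> and \<open>\<theta>\<close> of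
  time from \<open>\<tau>'\<close> to \<open>\<tau>\<close>; the claim is the chain rule.\<close>

lemma vel_change:
  assumes \<gamma>: "smooth_near A t \<gamma>" and c: "c \<in> A" "\<gamma> t \<in> fst c" and c': "c' \<in> A" "\<gamma> t \<in> fst c'"
    and \<tau>: "\<tau> \<in> time_atlas" "t \<in> fst \<tau>" and \<tau>': "\<tau>' \<in> time_atlas" "t \<in> fst \<tau>'"
  shows "vel \<tau>' c' \<gamma> t = frechet_derivative (space_change c c') (at (snd c (\<gamma> t)))
     (time_factor \<tau>' \<tau> (snd \<tau>' t) *\<^sub>R vel \<tau> c \<gamma> t)"
proof -
  obtain U where U: "open U" "t \<in> U" "\<gamma> ` U \<subseteq> fst c" by (rule curve_in_chart[OF \<gamma> c]) auto
  let ?D = "frechet_derivative (space_change c c') (at (snd c (\<gamma> t)))"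
  let ?\<theta> = "time_change \<tau>' \<tau>"
  have \<theta>t: "?\<theta> (snd \<tau>' t) = snd \<tau> t" using time_chart_inv(1)[OF \<tau>'] by (simp add: time_change_def)
  have D\<theta>: "(?\<theta> has_derivative frechet_derivative ?\<theta> (at (snd \<tau>' t))) (at (snd \<tau>' t))"
    using \<tau> \<tau>' by (intro smooth_on_has_derivative[OF smooth_time_change[OF \<tau>'(1) \<tau>(1)]]) auto
  have D\<phi>: "(space_change c c' has_derivative ?D) (at (snd c (\<gamma> t)))"
    using c c' by (intro smooth_on_has_derivative[OF smooth_space_change(2)[OF c(1) c'(1)]]) auto
  have f1: "frechet_derivative ?\<theta> (at (snd \<tau>' t)) h = h * time_factor \<tau>' \<tau> (snd \<tau>' t)" for h
    using linear_scale[OF has_derivative_linear[OF D\<theta>], of h 1] by (simp add: time_factor_def)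
  have lin: "linear ?D" by (rule has_derivative_linear[OF D\<phi>])
  have D\<gamma>: "((\<lambda>s. snd c (\<gamma> (chart_inv \<tau> s))) has_derivative (\<lambda>h. h *\<^sub>R vel \<tau> c \<gamma> t))
      (at (?\<theta> (snd \<tau>' t)))"
    unfolding \<theta>t by (rule vel_has_derivative[OF \<gamma> c \<tau>])
  have D\<gamma>\<theta>: "((\<lambda>s. snd c (\<gamma> (chart_inv \<tau> (?\<theta> s)))) has_derivative
      (\<lambda>h. frechet_derivative ?\<theta> (at (snd \<tau>' t)) h *\<^sub>R vel \<tau> c \<gamma> t)) (at (snd \<tau>' t))"
    by (rule has_derivative_compose[OF D\<theta> D\<gamma>])
  have \<gamma>t: "snd c (\<gamma> (chart_inv \<tau> (?\<theta> (snd \<tau>' t)))) = snd c (\<gamma> t)"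
    using \<theta>t time_chart_inv(1)[OF \<tau>] by simp
  have "((\<lambda>s. space_change c c' (snd c (\<gamma> (chart_inv \<tau> (?\<theta> s))))) has_derivative
      (\<lambda>h. ?D (frechet_derivative ?\<theta> (at (snd \<tau>' t)) h *\<^sub>R vel \<tau> c \<gamma> t))) (at (snd \<tau>' t))"
    by (rule has_derivative_compose[OF D\<gamma>\<theta>, where g = "space_change c c'"])
      (unfold \<gamma>t, rule D\<phi>)
  moreover have "(\<lambda>h. ?D (frechet_derivative ?\<theta> (at (snd \<tau>' t)) h *\<^sub>R vel \<tau> c \<gamma> t))
      = (\<lambda>h. h *\<^sub>R ?D (time_factor \<tau>' \<tau> (snd \<tau>' t) *\<^sub>R vel \<tau> c \<gamma> t))"
    by (simp only: f1 scaleR_scaleR[symmetric] linear_scale[OF lin])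
  ultimately have "((\<lambda>s. space_change c c' (snd c (\<gamma> (chart_inv \<tau> (?\<theta> s))))) has_derivative
      (\<lambda>h. h *\<^sub>R ?D (time_factor \<tau>' \<tau> (snd \<tau>' t) *\<^sub>R vel \<tau> c \<gamma> t))) (at (snd \<tau>' t))"
    by simp
  then have "((\<lambda>s. snd c' (\<gamma> (chart_inv \<tau>' s))) has_derivative
      (\<lambda>h. h *\<^sub>R ?D (time_factor \<tau>' \<tau> (snd \<tau>' t) *\<^sub>R vel \<tau> c \<gamma> t))) (at (snd \<tau>' t))"
  proof (rule has_derivative_transform_within_open[where s = "snd \<tau>' ` (fst \<tau>' \<inter> (fst \<tau> \<inter> U))"])
    show "open (snd \<tau>' ` (fst \<tau>' \<inter> (fst \<tau> \<inter> U)))"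
      using U \<tau> by (intro open_time_image \<tau>' open_Int) (auto simp: time_atlas_iff)
    show "snd \<tau>' t \<in> snd \<tau>' ` (fst \<tau>' \<inter> (fst \<tau> \<inter> U))" using U \<tau> \<tau>' by auto
    fix s assume "s \<in> snd \<tau>' ` (fst \<tau>' \<inter> (fst \<tau> \<inter> U))"
    then obtain r where r: "s = snd \<tau>' r" "r \<in> fst \<tau>'" "r \<in> fst \<tau>" "r \<in> U" by auto
    have "\<gamma> r \<in> fst c" using U(3) r(4) by auto
    then show "space_change c c' (snd c (\<gamma> (chart_inv \<tau> (?\<theta> s)))) = snd c' (\<gamma> (chart_inv \<tau>' s))"
      using r time_chart_inv(1)[OF \<tau>(1)] time_chart_inv(1)[OF \<tau>'(1)] chart_inv_A(1)[OF c(1)]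
      by (simp add: time_change_def space_change_def)
  qed
  then show ?thesis
    unfolding vel_def by (intro vector_derivative_at) (simp add: has_vector_derivative_def)
qed

lemma same_1jet_iff:
  "same_1jet A t \<gamma> \<sigma> \<longleftrightarrow>
     \<gamma> t = \<sigma> t \<and> (\<forall>c\<in>A. \<gamma> t \<in> fst c \<longrightarrow> vel std_time c \<gamma> t = vel std_time c \<sigma> t)"
  by (simp add: same_1jet_def vel_def)

text \<open>By \<open>vel_change\<close> the velocity in one pair of charts determines the velocity in every other one.\<close>

lemma same_1jetI:
  assumes "smooth_near A t \<gamma>" "smooth_near A t \<sigma>" "\<gamma> t = \<sigma> t" "c \<in> A" "\<gamma> t \<in> fst c"
    "\<tau> \<in> time_atlas" "t \<in> fst \<tau>" "vel \<tau> c \<gamma> t = vel \<tau> c \<sigma> t"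
  shows "same_1jet A t \<gamma> \<sigma>"
  unfolding same_1jet_iff
proof (intro conjI ballI impI)
  fix c' assume c': "c' \<in> A" "\<gamma> t \<in> fst c'"
  have t: "t \<in> fst std_time" by simp
  have s: "\<sigma> t \<in> fst c" "\<sigma> t \<in> fst c'" using c' assms by auto
  show "vel std_time c' \<gamma> t = vel std_time c' \<sigma> t"
    using vel_change[OF assms(1,4,5) c' assms(6,7) std_time_in_time_atlas t]
      vel_change[OF assms(2,4) s(1) c'(1) s(2) assms(6,7) std_time_in_time_atlas t] assms(3,8) by simp
qed fact

lemma same_1jet_vel:
  assumes "same_1jet A t \<gamma> \<sigma>" "smooth_near A t \<gamma>" "smooth_near A t \<sigma>" "c \<in> A" "\<gamma> t \<in> fst c"
    "\<tau> \<in> time_atlas" "t \<in> fst \<tau>"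
  shows "vel \<tau> c \<gamma> t = vel \<tau> c \<sigma> t"
proof -
  have t: "t \<in> fst std_time" by simp
  have eq: "\<gamma> t = \<sigma> t" "vel std_time c \<gamma> t = vel std_time c \<sigma> t"
    using assms by (auto simp: same_1jet_iff)
  then have s: "\<sigma> t \<in> fst c" using assms by simp
  show ?thesis
    using vel_change[OF assms(2,4,5,4,5) std_time_in_time_atlas t assms(6,7)]
      vel_change[OF assms(3,4) s assms(4) s std_time_in_time_atlas t assms(6,7)] eq by simp
qed


subsection \<open>Jets\<close>

lemma fst_jet1 [simp]: "fst (jet1 A t \<gamma>) = t"
  by (simp add: jet1_def)

lemma jet1_eq_iff:
  assumes "smooth_near A t \<gamma>"
  shows "jet1 A t \<gamma> = jet1 A t \<sigma> \<longleftrightarrow> same_1jet A t \<gamma> \<sigma>"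
proof
  assume "jet1 A t \<gamma> = jet1 A t \<sigma>"
  moreover have "\<gamma> \<in> snd (jet1 A t \<gamma>)" using assms by (simp add: jet1_def same_1jet_def)
  ultimately show "same_1jet A t \<gamma> \<sigma>" by (simp add: jet1_def same_1jet_def)
next
  assume "same_1jet A t \<gamma> \<sigma>"
  then show "jet1 A t \<gamma> = jet1 A t \<sigma>" by (auto simp: jet1_def same_1jet_def)
qed

lemma jet_rep_jet1:
  assumes "smooth_near A t \<gamma>"
  shows "smooth_near A t (jet_rep (jet1 A t \<gamma>))" "same_1jet A t \<gamma> (jet_rep (jet1 A t \<gamma>))"
proof -
  have "\<gamma> \<in> snd (jet1 A t \<gamma>)" using assms by (simp add: jet1_def same_1jet_def)
  then have "jet_rep (jet1 A t \<gamma>) \<in> snd (jet1 A t \<gamma>)" unfolding jet_rep_def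
    by (rule someI[of "\<lambda>\<sigma>. \<sigma> \<in> snd (jet1 A t \<gamma>)"])
  then show "smooth_near A t (jet_rep (jet1 A t \<gamma>))" "same_1jet A t \<gamma> (jet_rep (jet1 A t \<gamma>))"
    by (auto simp: jet1_def)
qed

lemma jet_rep:
  assumes "p \<in> jet_space A"
  shows "smooth_near A (fst p) (jet_rep p)" "p = jet1 A (fst p) (jet_rep p)"
proof -
  obtain t \<gamma> where p: "p = jet1 A t \<gamma>" "smooth_near A t \<gamma>"
    using assms by (auto simp: jet_space_def)
  have t: "fst p = t" using p by (simp add: jet1_def)
  show "smooth_near A (fst p) (jet_rep p)" "p = jet1 A (fst p) (jet_rep p)"
    using jet_rep_jet1[OF p(2)] jet1_eq_iff[OF p(2)] t p(1) by auto
qed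

lemma jet_chart_apply:
  "snd (jet_chart A (\<tau>, c)) p = (snd \<tau> (fst p), snd c (jet_base p), vel \<tau> c (jet_rep p) (fst p))"
  by (simp add: jet_chart_def vel_def)

lemma jet_chart_dom: "fst (jet_chart A (\<tau>, c)) = {p \<in> jet_space A. fst p \<in> fst \<tau> \<and> jet_base p \<in> fst c}"
  by (simp add: jet_chart_def)

lemma jet_indices_iff: "(\<tau>, c) \<in> jet_indices A \<longleftrightarrow> \<tau> \<in> time_atlas \<and> c \<in> A"
  by (simp add: jet_indices_def)

text \<open>The jet is represented by the curve whose coordinates run along the straight line with velocity \<open>y\<close>
  with respect to the time coordinate \<open>\<tau>\<close>.\<close>

lemma jet_of_coordinates:
  assumes \<tau>: "\<tau> \<in> time_atlas" "t \<in> fst \<tau>" and c: "c \<in> A" "m \<in> fst c"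
  obtains p where "p \<in> jet_space A" "fst p = t" "jet_base p = m"
    "snd (jet_chart A (\<tau>, c)) p = (snd \<tau> t, snd c m, y)"
proof -
  define line where "line s = snd c m + (snd \<tau> s + - snd \<tau> t) *\<^sub>R y" for s
  \<comment> \<open>near \<open>t\<close> only; elsewhere the line may leave the chart, but the jet does not see this\<close>
  define \<gamma> where "\<gamma> s = chart_inv c (line s)" for s
  have o\<tau>: "open (fst \<tau>)" using \<tau> by (simp add: time_atlas_iff)
  have sm: "smooth_on (fst \<tau>) line"
    unfolding line_def[abs_def] using \<tau>
    by (intro smooth_on_add smooth_on_const smooth_on_bounded_linear[OF bounded_linear_scaleR_left] o\<tau>)
      (auto simp: time_atlas_iff)
  define U where "U = fst \<tau> \<inter> line -` (snd c ` fst c)"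
  have U: "open U" unfolding U_def
    using is_chart_A[OF c(1)] by (intro continuous_open_preimage smooth_on_continuous_on sm o\<tau>)
      (simp add: is_chart_def)
  have tU: "t \<in> U" using \<tau> c by (simp add: U_def line_def)
  have \<gamma>U: "\<gamma> s \<in> fst c \<and> snd c (\<gamma> s) = line s" if "s \<in> U" for s
    using chart_inv_A(2)[OF c(1), of "line s"] that by (simp add: U_def \<gamma>_def)
  have \<gamma>t: "\<gamma> t = m" using chart_inv_A(1)[OF c] by (simp add: \<gamma>_def line_def)
  have "smooth_on U (\<lambda>s. snd c (\<gamma> s))"
    by (rule smooth_on_cong_imp[OF U smooth_on_subset[OF sm]]) (use \<gamma>U in \<open>auto simp: U_def\<close>)
  then have near: "smooth_near A t \<gamma>"
    unfolding smooth_near_def using c(1) U tU \<gamma>U by blast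
  have vel: "vel \<tau> c \<gamma> t = y"
    unfolding vel_def
  proof (rule vector_derivative_at)
    have "((\<lambda>s. snd c m + (s - snd \<tau> t) *\<^sub>R y) has_vector_derivative y) (at (snd \<tau> t))"
      by (auto intro!: derivative_eq_intros)
    then show "((\<lambda>s. snd c (\<gamma> (chart_inv \<tau> s))) has_vector_derivative y) (at (snd \<tau> t))"
    proof (rule has_vector_derivative_transform_within_open[where S = "snd \<tau> ` (fst \<tau> \<inter> U)"])
      show "open (snd \<tau> ` (fst \<tau> \<inter> U))" by (rule open_time_image[OF \<tau>(1) U])
      fix s assume "s \<in> snd \<tau> ` (fst \<tau> \<inter> U)"
      then obtain r where "s = snd \<tau> r" "r \<in> fst \<tau>" "r \<in> U" by auto
      then show "snd c m + (s - snd \<tau> t) *\<^sub>R y = snd c (\<gamma> (chart_inv \<tau> s))"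
        using \<gamma>U time_chart_inv(1)[OF \<tau>(1)] by (simp add: line_def)
    qed (use \<tau> tU in auto)
  qed
  let ?p = "jet1 A t \<gamma>"
  note rep = jet_rep_jet1[OF near]
  have base: "jet_base ?p = m"
    using rep(2) \<gamma>t unfolding jet_base_def same_1jet_def fst_jet1 by simp
  show thesis
  proof
    show "?p \<in> jet_space A" using near by (auto simp: jet_space_def)
    show "fst ?p = t" by simp
    show "jet_base ?p = m" by (rule base)
    show "snd (jet_chart A (\<tau>, c)) ?p = (snd \<tau> t, snd c m, y)"
      using same_1jet_vel[OF rep(2) near rep(1) c(1) _ \<tau>] \<gamma>t c(2) base vel
      by (simp add: jet_chart_apply)
  qed
qed

lemma jet_chart_image:
  assumes "\<tau> \<in> time_atlas" "c \<in> A" "S \<subseteq> fst \<tau>" "W \<subseteq> fst c"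
  shows "snd (jet_chart A (\<tau>, c)) ` {p \<in> jet_space A. fst p \<in> S \<and> jet_base p \<in> W}
    = (snd \<tau> ` S) \<times> (snd c ` W) \<times> UNIV"
proof safe
  fix s m and y :: "real ^ 'n" assume "s \<in> S" "m \<in> W"
  then obtain p where "p \<in> jet_space A" "fst p = s" "jet_base p = m"
    "snd (jet_chart A (\<tau>, c)) p = (snd \<tau> s, snd c m, y)"
    using jet_of_coordinates[OF assms(1) _ assms(2), of s m y] assms by blast
  then show "(snd \<tau> s, snd c m, y) \<in> snd (jet_chart A (\<tau>, c)) ` {p \<in> jet_space A. fst p \<in> S \<and> jet_base p \<in> W}"
    using \<open>s \<in> S\<close> \<open>m \<in> W\<close> by (intro image_eqI[of _ _ p]) auto
qed (auto simp: jet_chart_apply)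

lemma jet_chart_inj:
  assumes "\<tau> \<in> time_atlas" "c \<in> A"
  shows "inj_on (snd (jet_chart A (\<tau>, c))) (fst (jet_chart A (\<tau>, c)))"
proof (rule inj_onI)
  fix p q assume pq: "p \<in> fst (jet_chart A (\<tau>, c))" "q \<in> fst (jet_chart A (\<tau>, c))"
    and eq: "snd (jet_chart A (\<tau>, c)) p = snd (jet_chart A (\<tau>, c)) q"
  then have d: "p \<in> jet_space A" "fst p \<in> fst \<tau>" "jet_base p \<in> fst c"
    "q \<in> jet_space A" "fst q \<in> fst \<tau>" "jet_base q \<in> fst c" by (auto simp: jet_chart_dom)
  have t: "fst p = fst q"
    using eq d assms(1) by (auto simp: jet_chart_apply time_atlas_iff is_chart_def dest: inj_onD)
  have b: "jet_base p = jet_base q"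
    using eq d is_chart_A[OF assms(2)] by (auto simp: jet_chart_apply is_chart_def dest: inj_onD)
  have "same_1jet A (fst p) (jet_rep p) (jet_rep q)"
    by (rule same_1jetI[OF _ _ _ assms(2) _ assms(1)])
      (use jet_rep[OF d(1)] jet_rep[OF d(4)] t b eq d in \<open>auto simp: jet_base_def jet_chart_apply\<close>)
  then show "p = q"
    using jet1_eq_iff[OF jet_rep(1)[OF d(1)], of "jet_rep q"] jet_rep(2)[OF d(1)] jet_rep(2)[OF d(4)] t
    by metis
qed

lemma jet_chart_is_chart:
  assumes "k \<in> jet_indices A"
  shows "is_chart (jet_chart A k)"
proof -
  obtain \<tau> c where k: "k = (\<tau>, c)" "\<tau> \<in> time_atlas" "c \<in> A"
    using assms by (cases k) (auto simp: jet_indices_iff)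
  have "open ((snd \<tau> ` fst \<tau>) \<times> (snd c ` fst c) \<times> (UNIV :: (real ^ 'n) set))"
    using k is_chart_A[OF k(3)] by (intro open_Times) (auto simp: time_atlas_iff is_chart_def)
  then show ?thesis
    using jet_chart_inj[OF k(2,3)] jet_chart_image[OF k(2,3) order_refl order_refl]
    by (simp add: k(1) is_chart_def jet_chart_dom)
qed

text \<open>The change of jet coordinates \<open>(t, x, y)\<close> from \<open>k\<close> to \<open>k'\<close>; its last component is
  \<open>(\<partial>x'/\<partial>x) (dt/dt') y\<close>.\<close>

definition jet_change where
  "jet_change k k' u =
     (time_change (fst k) (fst k') (fst u), space_change (snd k) (snd k') (fst (snd u)),
      frechet_derivative (space_change (snd k) (snd k')) (at (fst (snd u)))
        (time_factor (fst k') (fst k) (time_change (fst k) (fst k') (fst u)) *\<^sub>R snd (snd u)))"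

lemma jet_chart_change:
  assumes "k \<in> jet_indices A" "k' \<in> jet_indices A" "p \<in> fst (jet_chart A k) \<inter> fst (jet_chart A k')"
  shows "snd (jet_chart A k') p = jet_change k k' (snd (jet_chart A k) p)"
proof -
  obtain \<tau> c where k: "k = (\<tau>, c)" "\<tau> \<in> time_atlas" "c \<in> A"
    using assms by (cases k) (auto simp: jet_indices_iff)
  obtain \<tau>' c' where k': "k' = (\<tau>', c')" "\<tau>' \<in> time_atlas" "c' \<in> A"
    using assms by (cases k') (auto simp: jet_indices_iff)
  have p: "p \<in> jet_space A" "fst p \<in> fst \<tau>" "jet_base p \<in> fst c" "fst p \<in> fst \<tau>'" "jet_base p \<in> fst c'"
    using assms(3) by (auto simp: jet_chart_dom k(1) k'(1))
  show ?thesis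
    using vel_change[OF jet_rep(1)[OF p(1)] k(3) _ k'(3) _ k(2) p(2) k'(2) p(4)] p
      time_chart_inv(1)[OF k(2) p(2)] chart_inv_A(1)[OF k(3) p(3)]
    by (simp add: k(1) k'(1) jet_chart_apply jet_change_def time_change_def space_change_def jet_base_def)
qed

lemma jet_overlap_image:
  assumes "(\<tau>, c) \<in> jet_indices A" "(\<tau>', c') \<in> jet_indices A"
  shows "snd (jet_chart A (\<tau>, c)) ` (fst (jet_chart A (\<tau>, c)) \<inter> fst (jet_chart A (\<tau>', c')))
      = (snd \<tau> ` (fst \<tau> \<inter> fst \<tau>')) \<times> (snd c ` (fst c \<inter> fst c')) \<times> UNIV"
proof -
  have "fst (jet_chart A (\<tau>, c)) \<inter> fst (jet_chart A (\<tau>', c'))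
      = {p \<in> jet_space A. fst p \<in> fst \<tau> \<inter> fst \<tau>' \<and> jet_base p \<in> fst c \<inter> fst c'}"
    by (auto simp: jet_chart_dom)
  then show ?thesis
    using assms jet_chart_image[of \<tau> c "fst \<tau> \<inter> fst \<tau>'" "fst c \<inter> fst c'"]
    by (simp add: jet_indices_iff)
qed

lemma smooth_jet_change:
  assumes "(\<tau>, c) \<in> jet_indices A" "(\<tau>', c') \<in> jet_indices A"
  shows "smooth_on ((snd \<tau> ` (fst \<tau> \<inter> fst \<tau>')) \<times> (snd c ` (fst c \<inter> fst c')) \<times> UNIV)
    (jet_change (\<tau>, c) (\<tau>', c'))" (is "smooth_on ?S _")
proof -
  have A: "\<tau> \<in> time_atlas" "\<tau>' \<in> time_atlas" "c \<in> A" "c' \<in> A"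
    using assms by (auto simp: jet_indices_iff)
  have ot: "open (snd \<tau> ` (fst \<tau> \<inter> fst \<tau>'))" "open (snd \<tau>' ` (fst \<tau>' \<inter> fst \<tau>))"
    using A by (auto intro!: open_time_image simp: time_atlas_iff)
  note ox = smooth_space_change(1)[OF A(3,4)]
  note S\<phi> = smooth_space_change(2)[OF A(3,4)]
  have o: "open ?S" using ot ox by (intro open_Times) auto
  have fst_sm: "smooth_on ?S (\<lambda>u. fst u)" "smooth_on ?S (\<lambda>u. fst (snd u))" "smooth_on ?S (\<lambda>u. snd (snd u))"
    by (auto intro!: smooth_on_linear o bounded_linear_fst bounded_linear_snd
        bounded_linear_compose[OF bounded_linear_fst] bounded_linear_compose[OF bounded_linear_snd])
  have 1: "smooth_on ?S (\<lambda>u. time_change \<tau> \<tau>' (fst u))"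
    by (rule smooth_on_compose[OF o ot(1) fst_sm(1) smooth_time_change[OF A(1,2)]]) auto
  have 2: "smooth_on ?S (\<lambda>u. space_change c c' (fst (snd u)))"
    by (rule smooth_on_compose[OF o ox fst_sm(2) S\<phi>]) auto
  have 3: "smooth_on ?S (\<lambda>u. time_factor \<tau>' \<tau> (time_change \<tau> \<tau>' (fst u)))"
    by (rule smooth_on_compose[OF o ot(2) 1 smooth_time_factor[OF A(2,1)]])
      (use time_chart_inv(1)[OF A(1)] in \<open>auto simp: time_change_def\<close>)
  have 4: "smooth_on ?S (\<lambda>u. frechet_derivative (space_change c c') (at (fst (snd u)))
        (time_factor \<tau>' \<tau> (time_change \<tau> \<tau>' (fst u)) *\<^sub>R snd (snd u)))"
  proof (rule smooth_on_linear_field[where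
        L = "\<lambda>u. frechet_derivative (space_change c c') (at (fst (snd u)))", OF o])
    show "linear (frechet_derivative (space_change c c') (at (fst (snd u))))" if "u \<in> ?S" for u
      by (rule has_derivative_linear[OF smooth_on_has_derivative[OF S\<phi>]]) (use that in auto)
    show "smooth_on ?S (\<lambda>u. frechet_derivative (space_change c c') (at (fst (snd u))) b)" for b
      by (rule smooth_on_compose[OF o ox fst_sm(2) smooth_on_frechet_derivative[OF S\<phi>]]) auto
    show "smooth_on ?S (\<lambda>u. time_factor \<tau>' \<tau> (time_change \<tau> \<tau>' (fst u)) *\<^sub>R snd (snd u))"
      by (rule smooth_on_bounded_bilinear[OF bounded_bilinear_scaleR o 3 fst_sm(3)])
  qed
  show ?thesis
    unfolding jet_change_def[abs_def] fst_conv snd_conv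
    by (rule smooth_on_Pair[OF o 1 smooth_on_Pair[OF o 2 4]])
qed

lemma jet_chart_compatible:
  assumes "k \<in> jet_indices A" "k' \<in> jet_indices A"
  shows "compatible (jet_chart A k) (jet_chart A k')"
proof -
  have half: "open (snd (jet_chart A k) ` (fst (jet_chart A k) \<inter> fst (jet_chart A k'))) \<and>
     smooth_on (snd (jet_chart A k) ` (fst (jet_chart A k) \<inter> fst (jet_chart A k')))
       (\<lambda>u. snd (jet_chart A k') (chart_inv (jet_chart A k) u))"
    if kk: "k \<in> jet_indices A" "k' \<in> jet_indices A" for k k'
  proof -
    obtain \<tau> c \<tau>' c' where k: "k = (\<tau>, c)" "k' = (\<tau>', c')" by (cases k, cases k')
    have A: "\<tau> \<in> time_atlas" "\<tau>' \<in> time_atlas" "c \<in> A" "c' \<in> A"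
      using kk by (auto simp: jet_indices_iff k)
    let ?S = "snd (jet_chart A k) ` (fst (jet_chart A k) \<inter> fst (jet_chart A k'))"
    note S = jet_overlap_image[OF kk[unfolded k], folded k]
    have o: "open ?S"
      unfolding S using A smooth_space_change(1)[OF A(3,4)]
      by (intro open_Times open_time_image) (auto simp: time_atlas_iff)
    have "smooth_on ?S (jet_change k k')"
      unfolding S using smooth_jet_change[OF kk[unfolded k]] k by simp
    then have "smooth_on ?S (\<lambda>u. snd (jet_chart A k') (chart_inv (jet_chart A k) u))"
    proof (rule smooth_on_cong_imp[OF o])
      fix u assume "u \<in> ?S"
      then obtain p where p: "u = snd (jet_chart A k) p" "p \<in> fst (jet_chart A k) \<inter> fst (jet_chart A k')"
        by auto
      then have "chart_inv (jet_chart A k) u = p"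
        using jet_chart_is_chart[OF kk(1)] by (simp add: chart_inv_def is_chart_def)
      then show "jet_change k k' u = snd (jet_chart A k') (chart_inv (jet_chart A k) u)"
        using jet_chart_change[OF kk p(2)] p(1) by simp
    qed
    then show ?thesis using o by blast
  qed
  show ?thesis
    using half[OF assms] half[OF assms(2,1)] unfolding compatible_def by (simp add: Int_commute)
qed

sublocale charted "jet_indices A" "jet_chart A"
  by standard (auto intro: jet_chart_is_chart jet_chart_compatible)

lemma pts_jet: "pts = jet_space A"
proof
  show "pts \<subseteq> jet_space A" by (auto simp: points_def jet_chart_def)
  show "jet_space A \<subseteq> pts"
  proof
    fix p assume p: "p \<in> jet_space A"
    then obtain c where c: "c \<in> A" "jet_rep p (fst p) \<in> fst c"
      using jet_rep(1)[OF p] unfolding smooth_near_def by blast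
    then have "p \<in> cdom (std_time, c)" using p by (simp add: jet_chart_dom jet_base_def)
    then show "p \<in> pts"
      using c std_time_in_time_atlas unfolding points_def by (auto simp: jet_indices_iff)
  qed
qed

lemma opn_base:
  assumes "open U" "openin (atlas_topology A) W"
  shows "opn {p \<in> jet_space A. fst p \<in> U \<and> jet_base p \<in> W}"
  unfolding opn_iff
proof safe
  show "p \<in> pts" if "p \<in> jet_space A" for p using that by (simp add: pts_jet)
  fix \<tau> c assume k: "(\<tau>, c) \<in> jet_indices A"
  then have A: "\<tau> \<in> time_atlas" "c \<in> A" by (auto simp: jet_indices_iff)
  have "{p \<in> jet_space A. fst p \<in> U \<and> jet_base p \<in> W} \<inter> cdom (\<tau>, c)
      = {p \<in> jet_space A. fst p \<in> fst \<tau> \<inter> U \<and> jet_base p \<in> W \<inter> fst c}"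
    by (auto simp: jet_chart_dom)
  moreover have "open (snd c ` (W \<inter> fst c))"
    using assms(2) A(2) openin_atlas_topology[of A W] is_chart_A by auto
  ultimately show "open (co (\<tau>, c) ` ({p \<in> jet_space A. fst p \<in> U \<and> jet_base p \<in> W} \<inter> cdom (\<tau>, c)))"
    using jet_chart_image[OF A, of "fst \<tau> \<inter> U" "W \<inter> fst c"] open_time_image[OF A(1) assms(1)]
    by (simp add: open_Times)
qed

text \<open>Two jets at different times, or at different points of \<open>M\<close>, are separated by open sets of the base.  The
  remaining pairs of jets lie in a common chart.\<close>

lemma jet_hausdorff: "Hausdorff_space (atlas_topology (jet_chart A ` jet_indices A))"
  unfolding Hausdorff_space_def
proof (intro allI impI, elim conjE)
  fix p q assume pq: "p \<in> topspace (atlas_topology (jet_chart A ` jet_indices A))"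
    "q \<in> topspace (atlas_topology (jet_chart A ` jet_indices A))" "p \<noteq> q"
  have "topspace (atlas_topology (jet_chart A ` jet_indices A)) \<subseteq> pts"
    using opn_subset_pts unfolding opn_def by blast
  then have J: "p \<in> jet_space A" "q \<in> jet_space A" using pq pts_jet by auto
  have base_top: "jet_base r \<in> topspace (atlas_topology A)" if r: "r \<in> jet_space A" for r
  proof -
    obtain c where c: "c \<in> A" "jet_rep r (fst r) \<in> fst c"
      using jet_rep(1)[OF r] unfolding smooth_near_def by blast
    have "openin (atlas_topology A) (fst c)"
    proof (subst openin_atlas_topology)
      show "fst c \<subseteq> points A \<and> (\<forall>d\<in>A. open (snd d ` (fst c \<inter> fst d)))"
        using c(1) compatible_A[OF c(1)] by (auto simp: points_def compatible_def)
    qed (rule is_chart_A)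
    then show ?thesis using c(2) openin_subset unfolding jet_base_def by blast
  qed
  consider "fst p \<noteq> fst q" | "jet_base p \<noteq> jet_base q" | "fst p = fst q" "jet_base p = jet_base q" by blast
  then have "\<exists>U V. opn U \<and> opn V \<and> p \<in> U \<and> q \<in> V \<and> disjnt U V"
  proof cases
    case 1
    then obtain U V where UV: "open U" "open V" "fst p \<in> U" "fst q \<in> V" "U \<inter> V = {}"
      by (metis hausdorff)
    have "openin (atlas_topology A) (topspace (atlas_topology A))" by simp
    then show ?thesis
      using opn_base[OF UV(1)] opn_base[OF UV(2)] UV J base_top
      by (intro exI[of _ "{p \<in> jet_space A. fst p \<in> U \<and> jet_base p \<in> topspace (atlas_topology A)}"]
          exI[of _ "{p \<in> jet_space A. fst p \<in> V \<and> jet_base p \<in> topspace (atlas_topology A)}"])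
        (auto simp: disjnt_def)
  next
    case 2
    then obtain U V where UV: "openin (atlas_topology A) U" "openin (atlas_topology A) V"
      "jet_base p \<in> U" "jet_base q \<in> V" "disjnt U V"
      using hausdorff_A base_top[OF J(1)] base_top[OF J(2)] unfolding Hausdorff_space_def by metis
    show ?thesis
      using opn_base[OF open_UNIV UV(1)] opn_base[OF open_UNIV UV(2)] UV J
      by (intro exI[of _ "{p \<in> jet_space A. fst p \<in> UNIV \<and> jet_base p \<in> U}"]
          exI[of _ "{p \<in> jet_space A. fst p \<in> UNIV \<and> jet_base p \<in> V}"])
        (auto simp: disjnt_def)
  next
    case 3
    obtain k where k: "k \<in> jet_indices A" "p \<in> cdom k" using J(1) pts_jet ptsE by metis
    then have q: "q \<in> cdom k" using 3 J by (cases k) (auto simp: jet_chart_dom)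
    have "co k p \<noteq> co k q"
      using pq(3) k q chart[OF k(1)] by (auto simp: is_chart_def dest: inj_onD)
    then obtain U V where UV: "open U" "open V" "co k p \<in> U" "co k q \<in> V" "U \<inter> V = {}"
      by (metis hausdorff)
    show ?thesis
      using opn_preimage[OF k(1) UV(1)] opn_preimage[OF k(1) UV(2)] UV k q
      by (intro exI[of _ "{q \<in> cdom k. co k q \<in> U}"] exI[of _ "{q \<in> cdom k. co k q \<in> V}"])
        (auto simp: disjnt_def)
  qed
  then show "\<exists>U V. openin (atlas_topology (jet_chart A ` jet_indices A)) U \<and>
      openin (atlas_topology (jet_chart A ` jet_indices A)) V \<and> p \<in> U \<and> q \<in> V \<and> disjnt U V"
    by (simp add: opn_def)
qed

sublocale hausdorff_charted "jet_indices A" "jet_chart A"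
  by standard (rule jet_hausdorff)

end


section \<open>Derivatives of the changes of jet coordinates\<close>

lemma vec_eq_sum_axis: "(x :: real ^ 'n) = (\<Sum>i\<in>UNIV. x $ i *\<^sub>R axis i 1)"
  using basis_expansion[of x] by (simp add: scalar_mult_eq_scaleR)

lemma linear_vec_expansion:
  fixes x :: "real ^ 'n"
  assumes "linear L"
  shows "L x = (\<Sum>i\<in>UNIV. x $ i *\<^sub>R L (axis i 1))"
proof -
  have "L x = L (\<Sum>i\<in>UNIV. x $ i *\<^sub>R axis i 1)" using vec_eq_sum_axis[of x] by simp
  also have "\<dots> = (\<Sum>i\<in>UNIV. x $ i *\<^sub>R L (axis i 1))"
    by (simp only: linear_sum[OF assms] linear_scale[OF assms])
  finally show ?thesis .
qed

context jet_bundle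
begin

abbreviation J :: "('m, 'n) jet_index set" where "J \<equiv> jet_indices A"

lemma in_pts: "k \<in> J \<Longrightarrow> p \<in> cdom k \<Longrightarrow> p \<in> pts"
  using cdom_subset_pts by blast

lemma opn_overlap: "k \<in> J \<Longrightarrow> k' \<in> J \<Longrightarrow> opn (cdom k \<inter> cdom k')"
  by (intro opn_Int opn_cdom)

lemma overlap_coordinates:
  assumes "k \<in> J" "k' \<in> J" "q \<in> cdom k \<inter> cdom k'"
  shows "fst (co k q) \<in> snd (fst k) ` (fst (fst k) \<inter> fst (fst k'))"
    "fst (snd (co k q)) \<in> snd (snd k) ` (fst (snd k) \<inter> fst (snd k'))"
    "t_coord A k' q = time_change (fst k) (fst k') (fst (co k q))"
    "fst (snd (co k' q)) = space_change (snd k) (snd k') (fst (snd (co k q)))"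
    "snd (snd (co k' q)) = frechet_derivative (space_change (snd k) (snd k')) (at (fst (snd (co k q))))
        (time_factor (fst k') (fst k) (t_coord A k' q) *\<^sub>R snd (snd (co k q)))"
proof -
  obtain \<tau> c \<tau>' c' where k: "k = (\<tau>, c)" "k' = (\<tau>', c')" by (cases k, cases k')
  show "fst (co k q) \<in> snd (fst k) ` (fst (fst k) \<inter> fst (fst k'))"
    "fst (snd (co k q)) \<in> snd (snd k) ` (fst (snd k) \<inter> fst (snd k'))"
    using assms(3) by (auto simp: k jet_chart_dom jet_chart_apply)
qed (use jet_chart_change[OF assms] in \<open>auto simp: jet_change_def t_coord_def\<close>)

lemma atlas_components: "k \<in> J \<Longrightarrow> fst k \<in> time_atlas \<and> snd k \<in> A"
  by (cases k) (simp add: jet_indices_iff)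

lemma bounded_linear_parts:
  "bounded_linear (\<lambda>w :: real \<times> (real ^ 'n) \<times> (real ^ 'n). fst w)"
  "bounded_linear (\<lambda>w :: real \<times> (real ^ 'n) \<times> (real ^ 'n). fst (snd w))"
  "bounded_linear (\<lambda>w :: real \<times> (real ^ 'n) \<times> (real ^ 'n). snd (snd w))"
  "bounded_linear (\<lambda>w :: real \<times> (real ^ 'n) \<times> (real ^ 'n). fst (snd w) $ i)"
  "bounded_linear (\<lambda>w :: real \<times> (real ^ 'n) \<times> (real ^ 'n). snd (snd w) $ i)"
  by (auto intro!: bounded_linear_fst bounded_linear_snd bounded_linear_compose[OF bounded_linear_fst]
      bounded_linear_compose[OF bounded_linear_snd] bounded_linear_compose[OF bounded_linear_vec_nth])

lemma smooth_at_coords: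
  assumes "k \<in> J" "p \<in> cdom k"
  shows "smooth_at p (t_coord A k)" "smooth_at p (x_coord A k i)" "smooth_at p (y_coord A k i)"
  using bounded_linear_parts[THEN smooth_at_bounded_linear, OF smooth_at_co[OF assms]]
  by (simp_all add: t_coord_def[abs_def] x_coord_def[abs_def] y_coord_def[abs_def])

lemma cderiv_coords:
  assumes "k \<in> J" "p \<in> cdom k" "k' \<in> J" "p \<in> cdom k'"
  shows "cderiv k (t_coord A k') p w = fst (cderiv k (co k') p w)"
    "cderiv k (x_coord A k' i) p w = fst (snd (cderiv k (co k') p w)) $ i"
    "cderiv k (y_coord A k' i) p w = snd (snd (cderiv k (co k') p w)) $ i"
  using bounded_linear_parts[THEN cderiv_bounded_linear, OF smooth_at_co[OF assms(3,4)] assms(1,2)]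
  by (simp_all add: t_coord_def[abs_def] x_coord_def[abs_def] y_coord_def[abs_def])

text \<open>A function of the time coordinate alone has derivatives in the direction of time only, and a
  function of the coordinates of \<open>M\<close> in the directions of \<open>M\<close> only.\<close>

lemma cderiv_time:
  fixes f :: "'m jet \<Rightarrow> real"
  assumes k: "k \<in> J" "p \<in> cdom k" and U: "opn U" "p \<in> U" "\<And>q. q \<in> U \<Longrightarrow> f q = g (fst (co k q))"
    and g: "fst (co k p) \<in> T" "smooth_on T g"
  shows "cderiv k f p w = fst w * cderiv k f p t_dir"
proof -
  have D: "cderiv k f p v = frechet_derivative g (at (fst (co k p))) (fst v)" for v
  proof -
    have "cderiv k f p v = cderiv k (\<lambda>q. g (fst (co k q))) p v"
      by (rule cderiv_cong[OF U k])
    also have "\<dots> = frechet_derivative g (at (fst (co k p))) (cderiv k (\<lambda>q. fst (co k q)) p v)"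
      by (rule cderiv_compose[where f = "\<lambda>q. fst (co k q)", OF _ g k])
        (rule smooth_at_bounded_linear[OF bounded_linear_parts(1) smooth_at_co[OF k]])
    finally show ?thesis
      by (simp add: cderiv_bounded_linear[OF bounded_linear_parts(1) smooth_at_co[OF k] k]
          cderiv_co_self[OF k])
  qed
  have "linear (frechet_derivative g (at (fst (co k p))))"
    using smooth_on_has_derivative[OF g(2,1)] by (rule has_derivative_linear)
  from linear_scale[OF this, of "fst w" 1] show ?thesis by (simp add: D t_dir_def)
qed

lemma cderiv_space:
  fixes f :: "'m jet \<Rightarrow> real"
  assumes k: "k \<in> J" "p \<in> cdom k" and U: "opn U" "p \<in> U" "\<And>q. q \<in> U \<Longrightarrow> f q = g (fst (snd (co k q)))"
    and g: "fst (snd (co k p)) \<in> T" "smooth_on T g"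
  shows "cderiv k f p w = (\<Sum>i\<in>UNIV. fst (snd w) $ i * cderiv k f p (x_dir i))"
proof -
  have D: "cderiv k f p v = frechet_derivative g (at (fst (snd (co k p)))) (fst (snd v))" for v
  proof -
    have "cderiv k f p v = cderiv k (\<lambda>q. g (fst (snd (co k q)))) p v"
      by (rule cderiv_cong[OF U k])
    also have "\<dots> = frechet_derivative g (at (fst (snd (co k p)))) (cderiv k (\<lambda>q. fst (snd (co k q))) p v)"
      by (rule cderiv_compose[where f = "\<lambda>q. fst (snd (co k q))", OF _ g k])
        (rule smooth_at_bounded_linear[OF bounded_linear_parts(2) smooth_at_co[OF k]])
    finally show ?thesis
      by (simp add: cderiv_bounded_linear[OF bounded_linear_parts(2) smooth_at_co[OF k] k]
          cderiv_co_self[OF k])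
  qed
  have "linear (frechet_derivative g (at (fst (snd (co k p)))))"
    using smooth_on_has_derivative[OF g(2,1)] by (rule has_derivative_linear)
  from linear_vec_expansion[OF this, of "fst (snd w)"] show ?thesis by (simp add: D x_dir_def)
qed

lemma partials_eq_cderiv:
  "d_tt A k k' = (\<lambda>q. cderiv k (t_coord A k') q t_dir)"
  "d2_tt A k k' = (\<lambda>q. cderiv k (d_tt A k k') q t_dir)"
  "d_xx A k k' r i = (\<lambda>q. cderiv k (x_coord A k' r) q (x_dir i))"
  "d2_xx A k k' r i j = (\<lambda>q. cderiv k (d_xx A k k' r j) q (x_dir i))"
  "d_yt A k k' r = (\<lambda>q. cderiv k (y_coord A k' r) q t_dir)"
  "d_yx A k k' r i = (\<lambda>q. cderiv k (y_coord A k' r) q (x_dir i))"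
  by (simp_all add: fun_eq_iff d_tt_def d2_tt_def d_xx_def d2_xx_def d_yt_def d_yx_def chart_deriv_cderiv)

context
  fixes k k' :: "('m, 'n) jet_index" and p :: "'m jet"
  assumes k: "k \<in> J" and k': "k' \<in> J" and p: "p \<in> cdom k \<inter> cdom k'"
begin

lemma smooth_at_partials:
  "smooth_at p (d_tt A k k')" "smooth_at p (d_xx A k k' r i)" "smooth_at p (d_tt A k' k)"
proof -
  have p': "p \<in> cdom k" "p \<in> cdom k'" using p by auto
  note c = smooth_at_const[OF in_pts[OF k p'(1)]]
  show "smooth_at p (d_tt A k k')" "smooth_at p (d_xx A k k' r i)" "smooth_at p (d_tt A k' k)"
    unfolding partials_eq_cderiv(1,3)
    by (rule smooth_at_cderiv smooth_at_coords c k k' p')+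
qed

text \<open>The partial derivatives are defined on the jet bundle; the next two lemmas identify them with
  derivatives of the changes of coordinates of \<open>\<real>\<close> and of \<open>M\<close>.  Hence the former depend on \<open>t\<close> only and
  the latter on \<open>x\<close> only.\<close>

lemma d_tt_time_factor: "d_tt A k k' p = time_factor (fst k) (fst k') (fst (co k p))"
proof -
  have T: "smooth_on (snd (fst k) ` (fst (fst k) \<inter> fst (fst k'))) (time_change (fst k) (fst k'))"
    using smooth_time_change atlas_components[OF k] atlas_components[OF k'] by blast
  have "d_tt A k k' p = cderiv k (\<lambda>q. time_change (fst k) (fst k') (fst (co k q))) p t_dir"
    unfolding partials_eq_cderiv
    by (rule cderiv_cong[OF opn_overlap[OF k k'] p overlap_coordinates(3)[OF k k']]) (use k p in auto)
  also have "\<dots> = frechet_derivative (time_change (fst k) (fst k')) (at (fst (co k p)))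
      (cderiv k (\<lambda>q. fst (co k q)) p t_dir)"
    by (rule cderiv_compose[where f = "\<lambda>q. fst (co k q)", OF _ overlap_coordinates(1)[OF k k' p] T])
      (use k p smooth_at_bounded_linear[OF bounded_linear_parts(1) smooth_at_co] in auto)
  also have "cderiv k (\<lambda>q. fst (co k q)) p t_dir = 1"
    using k p by (simp add: cderiv_bounded_linear[OF bounded_linear_parts(1)] smooth_at_co
        cderiv_co_self t_dir_def)
  finally show ?thesis by (simp add: time_factor_def)
qed

lemma d_xx_space_change:
  "d_xx A k k' r i p = frechet_derivative (space_change (snd k) (snd k')) (at (fst (snd (co k p)))) (axis i 1) $ r"
proof -
  have T: "smooth_on (snd (snd k) ` (fst (snd k) \<inter> fst (snd k'))) (space_change (snd k) (snd k'))"
    using smooth_space_change(2) atlas_components[OF k] atlas_components[OF k'] by blast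
  have sm: "smooth_at p (\<lambda>q. fst (snd (co k q)))"
    using k p smooth_at_bounded_linear[OF bounded_linear_parts(2) smooth_at_co] by auto
  have "d_xx A k k' r i p = cderiv k (\<lambda>q. fst (snd (co k' q))) p (x_dir i) $ r"
    using k k' p by (simp add: partials_eq_cderiv cderiv_coords cderiv_bounded_linear[OF bounded_linear_parts(2)]
        smooth_at_co)
  also have "cderiv k (\<lambda>q. fst (snd (co k' q))) p (x_dir i)
      = cderiv k (\<lambda>q. space_change (snd k) (snd k') (fst (snd (co k q)))) p (x_dir i)"
    by (rule cderiv_cong[OF opn_overlap[OF k k'] p overlap_coordinates(4)[OF k k']]) (use k p in auto)
  also have "\<dots> = frechet_derivative (space_change (snd k) (snd k')) (at (fst (snd (co k p))))
      (cderiv k (\<lambda>q. fst (snd (co k q))) p (x_dir i))"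
    by (rule cderiv_compose[where f = "\<lambda>q. fst (snd (co k q))", OF sm overlap_coordinates(2)[OF k k' p] T])
      (use k p in auto)
  also have "cderiv k (\<lambda>q. fst (snd (co k q))) p (x_dir i) = axis i 1"
    using k p by (simp add: cderiv_bounded_linear[OF bounded_linear_parts(2)] smooth_at_co
        cderiv_co_self x_dir_def)
  finally show ?thesis .
qed

lemma y_coord_change:
  "y_coord A k' r p = (\<Sum>j\<in>UNIV. d_xx A k k' r j p * time_factor (fst k') (fst k) (t_coord A k' p) * y_coord A k j p)"
proof -
  have T: "smooth_on (snd (snd k) ` (fst (snd k) \<inter> fst (snd k'))) (space_change (snd k) (snd k'))"
    using smooth_space_change(2) atlas_components[OF k] atlas_components[OF k'] by blast
  let ?L = "frechet_derivative (space_change (snd k) (snd k')) (at (fst (snd (co k p))))"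
  have lin: "linear ?L"
    using smooth_on_has_derivative[OF T overlap_coordinates(2)[OF k k' p]] by (rule has_derivative_linear)
  let ?v = "time_factor (fst k') (fst k) (t_coord A k' p) *\<^sub>R snd (snd (co k p))"
  have "y_coord A k' r p = ?L ?v $ r"
    by (simp add: y_coord_def overlap_coordinates(5)[OF k k' p])
  also have "?L ?v = (\<Sum>j\<in>UNIV. ?v $ j *\<^sub>R ?L (axis j 1))"
    by (rule linear_vec_expansion[OF lin])
  also have "\<dots> $ r = (\<Sum>j\<in>UNIV. ?v $ j * d_xx A k k' r j p)"
    by (simp add: d_xx_space_change)
  finally show ?thesis by (simp add: y_coord_def mult_ac)
qed

lemma cderiv_t_coord: "cderiv k (t_coord A k') p w = fst w * d_tt A k k' p"
  unfolding partials_eq_cderiv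
  by (rule cderiv_time[where g = "time_change (fst k) (fst k')",
        OF k _ opn_overlap[OF k k'] p overlap_coordinates(3)[OF k k'] overlap_coordinates(1)[OF k k' p]])
    (use p smooth_time_change atlas_components[OF k] atlas_components[OF k'] in auto)

lemma cderiv_x_coord: "cderiv k (x_coord A k' r) p w = (\<Sum>i\<in>UNIV. fst (snd w) $ i * d_xx A k k' r i p)"
  unfolding partials_eq_cderiv
proof (rule cderiv_space[where g = "\<lambda>u. space_change (snd k) (snd k') u $ r",
      OF k _ opn_overlap[OF k k'] p _ overlap_coordinates(2)[OF k k' p]])
  show "x_coord A k' r q = space_change (snd k) (snd k') (fst (snd (co k q))) $ r"
    if "q \<in> cdom k \<inter> cdom k'" for q
    using overlap_coordinates(4)[OF k k' that] by (simp add: x_coord_def)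
  show "smooth_on (snd (snd k) ` (fst (snd k) \<inter> fst (snd k'))) (\<lambda>u. space_change (snd k) (snd k') u $ r)"
    using smooth_space_change atlas_components[OF k] atlas_components[OF k']
    by (intro smooth_on_bounded_linear[OF bounded_linear_vec_nth]) auto
qed (use p in auto)

end

context
  fixes k k' :: "('m, 'n) jet_index" and p :: "'m jet"
  assumes k: "k \<in> J" and k': "k' \<in> J" and p: "p \<in> cdom k \<inter> cdom k'"
begin

lemma cderiv_d_tt: "cderiv k (d_tt A k k') p w = fst w * d2_tt A k k' p"
  unfolding partials_eq_cderiv(2)
  by (rule cderiv_time[where g = "time_factor (fst k) (fst k')",
        OF k _ opn_overlap[OF k k'] p d_tt_time_factor[OF k k'] overlap_coordinates(1)[OF k k' p]])
    (use p smooth_time_factor atlas_components[OF k] atlas_components[OF k'] in auto)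

lemma cderiv_d_xx: "cderiv k (d_xx A k k' r j) p w = (\<Sum>i\<in>UNIV. fst (snd w) $ i * d2_xx A k k' r i j p)"
  unfolding partials_eq_cderiv(4)
proof (rule cderiv_space[where
      g = "\<lambda>u. frechet_derivative (space_change (snd k) (snd k')) (at u) (axis j 1) $ r",
      OF k _ opn_overlap[OF k k'] p d_xx_space_change[OF k k'] overlap_coordinates(2)[OF k k' p]])
  show "smooth_on (snd (snd k) ` (fst (snd k) \<inter> fst (snd k')))
      (\<lambda>u. frechet_derivative (space_change (snd k) (snd k')) (at u) (axis j 1) $ r)"
    using smooth_space_change atlas_components[OF k] atlas_components[OF k']
    by (intro smooth_on_bounded_linear[OF bounded_linear_vec_nth] smooth_on_frechet_derivative) auto
qed (use p in auto)

lemma d2_xx_symmetric: "d2_xx A k k' r i j p = d2_xx A k k' r j i p"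
  unfolding partials_eq_cderiv(3,4)
  by (rule cderiv_symmetric) (use k k' p smooth_at_coords in auto)

text \<open>The factor \<open>dt/dt'\<close> is a function of \<open>t'\<close>, so that its derivatives are first computed in the chart \<open>k'\<close>.\<close>

lemma cderiv_d_tt_inverse: "cderiv k (d_tt A k' k) p w = fst w * (d_tt A k k' p * d2_tt A k' k p)"
proof -
  have p': "p \<in> cdom k' \<inter> cdom k" using p by auto
  have "cderiv k (d_tt A k' k) p w = cderiv k' (d_tt A k' k) p (cderiv k (co k') p w)"
    by (rule cderiv_change) (use k k' p smooth_at_partials(1)[OF k' k p'] in auto)
  also have "\<dots> = fst (cderiv k (co k') p w) * d2_tt A k' k p"
    unfolding partials_eq_cderiv(2)
    by (rule cderiv_time[where g = "time_factor (fst k') (fst k)",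
            OF k' _ opn_overlap[OF k' k] p' d_tt_time_factor[OF k' k] overlap_coordinates(1)[OF k' k p']])
        (use p smooth_time_factor atlas_components[OF k] atlas_components[OF k'] in auto)
  also have "fst (cderiv k (co k') p w) = fst w * d_tt A k k' p"
    using cderiv_t_coord[OF k k' p] cderiv_coords(1)[OF k _ k', of p w] p by simp
  finally show ?thesis by simp
qed

lemma y_coord_change': "y_coord A k' r p = (\<Sum>j\<in>UNIV. d_xx A k k' r j p * d_tt A k' k p * y_coord A k j p)"
proof -
  have "p \<in> cdom k' \<inter> cdom k" using p by auto
  from y_coord_change[OF k k' p] d_tt_time_factor[OF k' k this] show ?thesis
    by (simp add: t_coord_def)
qed

end

context
  fixes k k' :: "('m, 'n) jet_index" and p :: "'m jet"
  assumes k: "k \<in> J" and k': "k' \<in> J" and p: "p \<in> cdom k \<inter> cdom k'"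
begin

text \<open>The coordinates \<open>y'\<close> are linear in \<open>y\<close> with coefficients that depend on \<open>t\<close> and \<open>x\<close> only; these
  coefficients are constant in vertical directions.\<close>

lemma cderiv_y_coord_vertical:
  assumes "fst w = 0" "fst (snd w) = 0"
  shows "cderiv k (y_coord A k' r) p w = (\<Sum>j\<in>UNIV. d_xx A k k' r j p * d_tt A k' k p * snd (snd w) $ j)"
proof -
  have pk: "p \<in> cdom k" "p \<in> pts" using p in_pts[OF k] by auto
  note sm = smooth_at_mult[OF smooth_at_partials(2,3)[OF k k' p]] smooth_at_coords(3)[OF k pk(1)]
  have "cderiv k (y_coord A k' r) p w
      = cderiv k (\<lambda>q. \<Sum>j\<in>UNIV. d_xx A k k' r j q * d_tt A k' k q * y_coord A k j q) p w"
    by (rule cderiv_cong[OF opn_overlap[OF k k'] p y_coord_change'[OF k k'] k pk(1)])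
  also have "\<dots> = (\<Sum>j\<in>UNIV. cderiv k (\<lambda>q. d_xx A k k' r j q * d_tt A k' k q * y_coord A k j q) p w)"
    by (intro cderiv_sum pk k smooth_at_mult sm)
  also have "\<dots> = (\<Sum>j\<in>UNIV. d_xx A k k' r j p * d_tt A k' k p * snd (snd w) $ j)"
  proof (rule sum.cong[OF refl])
    fix j
    have "cderiv k (\<lambda>q. d_xx A k k' r j q * d_tt A k' k q) p w = 0"
      using assms
      by (simp add: cderiv_bounded_bilinear[OF bounded_bilinear_mult smooth_at_partials(2,3)[OF k k' p] k pk(1)]
          cderiv_d_xx[OF k k' p] cderiv_d_tt_inverse[OF k k' p])
    moreover have "cderiv k (y_coord A k j) p w = snd (snd w) $ j"
      by (simp add: cderiv_coords(3)[OF k pk(1) k pk(1)] cderiv_co_self[OF k pk(1)])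
    ultimately show "cderiv k (\<lambda>q. d_xx A k k' r j q * d_tt A k' k q * y_coord A k j q) p w
        = d_xx A k k' r j p * d_tt A k' k p * snd (snd w) $ j"
      by (simp add: cderiv_bounded_bilinear[OF bounded_bilinear_mult sm k pk(1)])
  qed
  finally show ?thesis .
qed

lemma cderiv_y_coord:
  "cderiv k (y_coord A k' r) p w = fst w * d_yt A k k' r p + (\<Sum>i\<in>UNIV. fst (snd w) $ i * d_yx A k k' r i p)
     + (\<Sum>j\<in>UNIV. d_xx A k k' r j p * d_tt A k' k p * snd (snd w) $ j)"
proof -
  have lin: "linear (cderiv k (y_coord A k' r) p)"
    using linear_cderiv smooth_at_coords(3) k k' p by blast
  have "w = fst w *\<^sub>R t_dir + (0, fst (snd w), 0) + (0, 0, snd (snd w))"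
    by (simp add: t_dir_def prod_eq_iff)
  then have "cderiv k (y_coord A k' r) p w
      = cderiv k (y_coord A k' r) p (fst w *\<^sub>R t_dir + (0, fst (snd w), 0) + (0, 0, snd (snd w)))" by simp
  also have "\<dots> = fst w * d_yt A k k' r p + cderiv k (y_coord A k' r) p (0, fst (snd w), 0)
       + cderiv k (y_coord A k' r) p (0, 0, snd (snd w))"
    by (simp add: linear_add[OF lin] linear_scale[OF lin] partials_eq_cderiv(5))
  also have "(0, fst (snd w), 0) = (\<Sum>i\<in>UNIV. fst (snd w) $ i *\<^sub>R x_dir i)"
    using vec_eq_sum_axis[of "fst (snd w)"]
    by (simp add: x_dir_def prod_eq_iff fst_sum snd_sum)
  also have "cderiv k (y_coord A k' r) p \<dots> = (\<Sum>i\<in>UNIV. fst (snd w) $ i * d_yx A k k' r i p)"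
    by (simp add: linear_sum[OF lin] linear_scale[OF lin] partials_eq_cderiv(6))
  finally show ?thesis by (simp add: cderiv_y_coord_vertical)
qed

lemma cderiv_jet_coords:
  "cderiv k (co k') p w =
    (fst w * d_tt A k k' p, \<chi> r. \<Sum>i\<in>UNIV. fst (snd w) $ i * d_xx A k k' r i p,
     \<chi> r. fst w * d_yt A k k' r p + (\<Sum>i\<in>UNIV. fst (snd w) $ i * d_yx A k k' r i p)
       + (\<Sum>j\<in>UNIV. d_xx A k k' r j p * d_tt A k' k p * snd (snd w) $ j))"
proof -
  note c = cderiv_coords[OF k _ k', of p, symmetric]
  show ?thesis
    using p by (simp add: prod_eq_iff vec_eq_iff c cderiv_t_coord[OF k k' p] cderiv_x_coord[OF k k' p]
        cderiv_y_coord)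
qed

end

text \<open>The derivatives of the two changes of jet coordinates between \<open>k\<close> and \<open>k'\<close> are inverse to each other;
  these are the blocks for \<open>t\<close> and for \<open>x\<close>.\<close>

lemma partials_inverse:
  assumes k: "k \<in> J" and k': "k' \<in> J" and p: "p \<in> cdom k \<inter> cdom k'"
  shows "d_tt A k k' p * d_tt A k' k p = 1"
    and "(\<Sum>s\<in>UNIV. d_xx A k' k r s p * d_xx A k k' s i p) = (if r = i then 1 else 0)"
proof -
  have p': "p \<in> cdom k' \<inter> cdom k" and pk: "p \<in> cdom k" "p \<in> cdom k'" using p by auto
  have inv: "cderiv k' (co k) p (cderiv k (co k') p w) = w" for w
    using cderiv_change[OF smooth_at_co[OF k pk(1)] k pk(1) k' pk(2)] cderiv_co_self[OF k pk(1)] by metis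
  have "d_tt A k k' p * d_tt A k' k p = fst (cderiv k' (co k) p (cderiv k (co k') p t_dir))"
    by (simp add: cderiv_jet_coords[OF k' k p'] cderiv_jet_coords[OF k k' p] t_dir_def)
  then show "d_tt A k k' p * d_tt A k' k p = 1" unfolding inv by (simp add: t_dir_def)
  have "(\<Sum>s\<in>UNIV. d_xx A k' k r s p * d_xx A k k' s i p)
      = fst (snd (cderiv k' (co k) p (cderiv k (co k') p (x_dir i)))) $ r"
    by (simp add: cderiv_jet_coords[OF k' k p'] cderiv_jet_coords[OF k k' p] x_dir_def axis_def
        if_distrib[where f = "\<lambda>x. x * _"] mult.commute cong: if_cong)
  then show "(\<Sum>s\<in>UNIV. d_xx A k' k r s p * d_xx A k k' s i p) = (if r = i then 1 else 0)"
    unfolding inv by (simp add: x_dir_def axis_def)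
qed

end


section \<open>Adapted frames of a nonlinear connection\<close>

definition part_t :: "real \<times> (real ^ 'n) \<times> (real ^ 'n) \<Rightarrow> real \<times> (real ^ 'n) \<times> (real ^ 'n)" where
  "part_t w = (fst w, 0, 0)"

definition part_x :: "real \<times> (real ^ 'n) \<times> (real ^ 'n) \<Rightarrow> real \<times> (real ^ 'n) \<times> (real ^ 'n)" where
  "part_x w = (0, fst (snd w), 0)"

definition part_y :: "real \<times> (real ^ 'n) \<times> (real ^ 'n) \<Rightarrow> real \<times> (real ^ 'n) \<times> (real ^ 'n)" where
  "part_y w = (0, 0, snd (snd w))"

lemmas part_defs = part_t_def part_x_def part_y_def

lemma part_eqs:
  "part_t (part_t w) = part_t w" "part_t (part_x w) = 0" "part_t (part_y w) = 0"
  "part_x (part_t w) = 0" "part_x (part_x w) = part_x w" "part_x (part_y w) = 0"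
  "part_y (part_t w) = 0" "part_y (part_x w) = 0" "part_y (part_y w) = part_y w"
  by (simp_all add: part_defs zero_prod_def)

lemma linear_parts: "linear part_t" "linear part_x" "linear part_y"
  by (auto intro!: linearI simp: part_defs)

lemma parts_sum: "part_t w + part_x w + part_y w = w"
  by (simp add: part_defs prod_eq_iff)

lemma dir_simps [simp]:
  "fst t_dir = 1" "fst (snd t_dir) = 0" "snd (snd t_dir) = 0"
  "fst (x_dir i) = 0" "fst (snd (x_dir i)) = axis i 1" "snd (snd (x_dir i)) = 0"
  "fst (y_dir i) = 0" "fst (snd (y_dir i)) = 0" "snd (snd (y_dir i)) = axis i 1"
  by (simp_all add: t_dir_def x_dir_def y_dir_def)

lemma part_dirs [simp]:
  "part_t t_dir = t_dir" "part_t (x_dir i) = 0" "part_t (y_dir i) = 0"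
  "part_x t_dir = 0" "part_x (x_dir i) = x_dir i" "part_x (y_dir i) = 0"
  "part_y t_dir = 0" "part_y (x_dir i) = 0" "part_y (y_dir i) = y_dir i"
  by (simp_all add: part_defs zero_prod_def prod_eq_iff)

lemma sum_axis [simp]:
  fixes f :: "'n::finite \<Rightarrow> real"
  shows "(\<Sum>i\<in>UNIV. axis a 1 $ i * f i) = f a" "(\<Sum>i\<in>UNIV. f i * axis a 1 $ i) = f a"
  by (simp_all add: axis_def if_distrib[where f = "\<lambda>x. x * _"] if_distrib[where f = "\<lambda>x. _ * x"]
      cong: if_cong)

lemma ball_Basis_jet:
  "(\<forall>u\<in>Basis. P u) \<longleftrightarrow> P t_dir \<and> (\<forall>i. P (x_dir i)) \<and> (\<forall>i. P (y_dir (i::'n::finite)))"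
  by (auto simp: Basis_prod_def Basis_vec_def t_dir_def x_dir_def y_dir_def zero_prod_def ball_Un)

lemma jet_vector_expansion:
  "w = fst w *\<^sub>R t_dir + (\<Sum>i\<in>UNIV. fst (snd w) $ i *\<^sub>R x_dir i) + (\<Sum>i\<in>UNIV. snd (snd w) $ i *\<^sub>R y_dir i)"
  using vec_eq_sum_axis[of "fst (snd w)"] vec_eq_sum_axis[of "snd (snd w)"]
  by (simp add: prod_eq_iff fst_sum snd_sum)

locale jet_nonlinear = jet_bundle A
  for A :: "('m, real ^ 'n::finite) chart set" +
  fixes \<Gamma> :: "('m, 'n) nonlinear_comps"
  assumes nonlinear: "nonlinear_connection A \<Gamma>"
begin

text \<open>The coordinates of the vector with components \<open>w\<close> in the adapted basis are those of \<open>w\<close>, except that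
  \<open>shift k p w\<close> is subtracted from the vertical ones.\<close>

definition shift :: "('m, 'n) jet_index \<Rightarrow> 'm jet \<Rightarrow> real \<times> (real ^ 'n) \<times> (real ^ 'n) \<Rightarrow> real ^ 'n" where
  "shift k p w = (\<chi> j. fst w * M_comp \<Gamma> k j p + (\<Sum>i\<in>UNIV. fst (snd w) $ i * N_comp \<Gamma> k j i p))"

definition adapt where "adapt k p w = (fst w, fst (snd w), snd (snd w) - shift k p w)"
definition unadapt where "unadapt k p w = (fst w, fst (snd w), snd (snd w) + shift k p w)"

lemma linear_shift: "linear (shift k p)"
  by (rule linearI) (simp_all add: shift_def vec_eq_iff algebra_simps sum.distrib sum_distrib_left)

lemma shift_cong: "fst w = fst w' \<Longrightarrow> fst (snd w) = fst (snd w') \<Longrightarrow> shift k p w = shift k p w'"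
  by (simp add: shift_def)

lemma smooth_at_shift:
  assumes "k \<in> J" "p \<in> cdom k"
  shows "smooth_at p (\<lambda>q. shift k q w)"
proof -
  have "smooth_at p (M_comp \<Gamma> k j)" "smooth_at p (N_comp \<Gamma> k j i)" for j i
    using nonlinear assms smooth_in_chart_iff[OF assms(1)] unfolding nonlinear_connection_def by blast+
  then show ?thesis
    unfolding shift_def
    by (intro smooth_at_vec smooth_at_add smooth_at_sum smooth_at_mult smooth_at_const in_pts[OF assms])
qed

lemma linear_adapt: "linear (adapt k p)" "linear (unadapt k p)"
  by (rule linearI; simp add: adapt_def unadapt_def prod_eq_iff linear_add[OF linear_shift]
      linear_scale[OF linear_shift] algebra_simps)+

sublocale framed "jet_indices A" "jet_chart A" adapt unadapt
proof (intro framed.intro framed_axioms.intro)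
  show "hausdorff_charted J (jet_chart A)" by unfold_locales
next
  fix k :: "('m, 'n) jet_index" and p :: "'m jet"
  show "linear (adapt k p)" "linear (unadapt k p)" by (rule linear_adapt)+
  assume k: "k \<in> J" "p \<in> cdom k"
  show "unadapt k p (adapt k p v) = v" "adapt k p (unadapt k p v) = v" for v
    using shift_cong[of "adapt k p v" v k p] shift_cong[of "unadapt k p v" v k p]
    by (simp_all add: adapt_def unadapt_def)
  note sh = smooth_at_shift[OF k] and c = smooth_at_const[OF in_pts[OF k]]
  show "smooth_at p (\<lambda>q. adapt k q v)" "smooth_at p (\<lambda>q. unadapt k q v)" for v
    unfolding adapt_def unadapt_def
    by (intro smooth_at_Pair smooth_at_diff smooth_at_add sh c)+
qed

lemma adapt_simps [simp]: "fst (adapt k p w) = fst w" "fst (snd (adapt k p w)) = fst (snd w)"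
  by (simp_all add: adapt_def)

text \<open>The transformation law of \<open>\<Gamma>\<close>, solved for the derivatives of \<open>y'\<close>: the first equation is multiplied by
  \<open>dt'/dt\<close>, the second one is contracted with the inverse of the matrix \<open>\<partial>x/\<partial>x'\<close>.\<close>

lemma nonlinear_transform:
  assumes k: "k \<in> J" and k': "k' \<in> J" and p: "p \<in> cdom k \<inter> cdom k'"
  shows "d_yt A k k' r p + d_tt A k k' p * M_comp \<Gamma> k' r p
      = (\<Sum>j\<in>UNIV. d_xx A k k' r j p * d_tt A k' k p * M_comp \<Gamma> k j p)" (is ?M)
    and "d_yx A k k' r i p + (\<Sum>l\<in>UNIV. d_xx A k k' l i p * N_comp \<Gamma> k' r l p)
      = (\<Sum>j\<in>UNIV. d_xx A k k' r j p * d_tt A k' k p * N_comp \<Gamma> k j i p)" (is ?N)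
proof -
  have p': "p \<in> jet_dom A k \<inter> jet_dom A k'" using p by (simp add: jet_dom_def)
  have M: "M_comp \<Gamma> k' r p = (\<Sum>j\<in>UNIV. M_comp \<Gamma> k j p * (d_tt A k' k p)\<^sup>2 * d_xx A k k' r j p)
           - d_tt A k' k p * d_yt A k k' r p"
    and N: "N_comp \<Gamma> k' r l p = (\<Sum>i\<in>UNIV. \<Sum>j\<in>UNIV.
              N_comp \<Gamma> k j i p * d_tt A k' k p * d_xx A k' k i l p * d_xx A k k' r j p)
           - (\<Sum>i\<in>UNIV. d_xx A k' k i l p * d_yx A k k' r i p)" for l
    using nonlinear k k' p' unfolding nonlinear_connection_def by blast+
  show ?M
  proof -
    have eqs: "d_tt A k k' p * (m * (d_tt A k' k p)\<^sup>2 * x) = x * d_tt A k' k p * m"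
      "d_tt A k k' p * (d_tt A k' k p * m) = m" for m x
      using partials_inverse(1)[OF k k' p] by algebra+
    show ?thesis unfolding M by (simp only: right_diff_distrib sum_distrib_left eqs)
  qed
  \<comment> \<open>contracting with \<open>\<partial>x/\<partial>x'\<close> gives the law for \<open>N\<close>, so that contracting back recovers \<open>Q\<close>\<close>
  define Q where "Q i = (\<Sum>j\<in>UNIV. d_xx A k k' r j p * d_tt A k' k p * N_comp \<Gamma> k j i p) - d_yx A k k' r i p" for i
  have "N_comp \<Gamma> k' r l p = (\<Sum>i\<in>UNIV. d_xx A k' k i l p * Q i)" for l
    unfolding N Q_def by (simp add: right_diff_distrib sum_subtractf sum_distrib_left mult_ac)
  then have "(\<Sum>l\<in>UNIV. d_xx A k k' l i p * N_comp \<Gamma> k' r l p)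
      = (\<Sum>l\<in>UNIV. \<Sum>m\<in>UNIV. Q m * (d_xx A k' k m l p * d_xx A k k' l i p))"
    by (simp add: sum_distrib_left mult_ac)
  also have "\<dots> = (\<Sum>m\<in>UNIV. \<Sum>l\<in>UNIV. Q m * (d_xx A k' k m l p * d_xx A k k' l i p))"
    by (rule sum.swap)
  also have "\<dots> = (\<Sum>m\<in>UNIV. Q m * (if m = i then 1 else 0))"
    by (simp only: sum_distrib_left[symmetric] partials_inverse(2)[OF k k' p])
  also have "\<dots> = Q i" by (simp add: if_distrib[where f = "\<lambda>x. _ * x"] cong: if_cong)
  finally show ?N by (simp add: Q_def)
qed

text \<open>The transformation law of a nonlinear connection says exactly that the change of adapted
  frames is block diagonal.\<close>

lemma chg_block:
  assumes k: "k \<in> J" and k': "k' \<in> J" and p: "p \<in> cdom k \<inter> cdom k'"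
  shows "chg k k' p w = (d_tt A k k' p * fst w, \<chi> r. \<Sum>i\<in>UNIV. d_xx A k k' r i p * fst (snd w) $ i,
     \<chi> r. \<Sum>i\<in>UNIV. d_xx A k k' r i p * d_tt A k' k p * snd (snd w) $ i)"
proof -
  let ?u = "cderiv k (co k') p (adapt k p w)"
  note u = cderiv_jet_coords[OF k k' p, of "adapt k p w"]
  have "snd (snd ?u) $ r + shift k' p ?u $ r
      = (\<Sum>i\<in>UNIV. d_xx A k k' r i p * d_tt A k' k p * snd (snd w) $ i)" for r
  proof -
    let ?D = "\<lambda>j. d_xx A k k' r j p * d_tt A k' k p"
    have "snd (snd ?u) $ r = fst w * d_yt A k k' r p + (\<Sum>i\<in>UNIV. fst (snd w) $ i * d_yx A k k' r i p)
       + ((\<Sum>j\<in>UNIV. ?D j * snd (snd w) $ j) - (\<Sum>j\<in>UNIV. ?D j * shift k p w $ j))"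
      unfolding u by (simp add: adapt_def right_diff_distrib sum_subtractf)
    moreover have "shift k' p ?u $ r = fst w * (d_tt A k k' p * M_comp \<Gamma> k' r p)
       + (\<Sum>i\<in>UNIV. fst (snd w) $ i * (\<Sum>l\<in>UNIV. d_xx A k k' l i p * N_comp \<Gamma> k' r l p))"
    proof -
      have "(\<Sum>l\<in>UNIV. (\<Sum>i\<in>UNIV. fst (snd w) $ i * d_xx A k k' l i p) * N_comp \<Gamma> k' r l p)
          = (\<Sum>i\<in>UNIV. fst (snd w) $ i * (\<Sum>l\<in>UNIV. d_xx A k k' l i p * N_comp \<Gamma> k' r l p))"
        by (simp only: sum_distrib_left sum_distrib_right mult.assoc) (rule sum.swap)
      then show ?thesis by (simp add: shift_def u)
    qed
    moreover have "(\<Sum>j\<in>UNIV. ?D j * shift k p w $ j) = fst w * (\<Sum>j\<in>UNIV. ?D j * M_comp \<Gamma> k j p)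
       + (\<Sum>i\<in>UNIV. fst (snd w) $ i * (\<Sum>j\<in>UNIV. ?D j * N_comp \<Gamma> k j i p))"
    proof -
      have "(\<Sum>j\<in>UNIV. ?D j * (\<Sum>i\<in>UNIV. fst (snd w) $ i * N_comp \<Gamma> k j i p))
          = (\<Sum>j\<in>UNIV. \<Sum>i\<in>UNIV. fst (snd w) $ i * (?D j * N_comp \<Gamma> k j i p))"
        by (simp only: sum_distrib_left mult_ac)
      also have "\<dots> = (\<Sum>i\<in>UNIV. fst (snd w) $ i * (\<Sum>j\<in>UNIV. ?D j * N_comp \<Gamma> k j i p))"
        by (subst sum.swap) (simp only: sum_distrib_left)
      finally show ?thesis
        by (simp add: shift_def distrib_left sum.distrib sum_distrib_left mult_ac)
    qed
    ultimately show ?thesis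
      by (simp add: nonlinear_transform[OF k k' p, symmetric] distrib_left sum.distrib)
  qed
  then show ?thesis
    unfolding chg_def unadapt_def by (simp add: prod_eq_iff vec_eq_iff) (simp add: u mult.commute)
qed

lemma chg_parts:
  assumes k: "k \<in> J" and k': "k' \<in> J" and p: "p \<in> cdom k \<inter> cdom k'"
  shows "chg k k' p (part_t w) = part_t (chg k k' p w)" "chg k k' p (part_x w) = part_x (chg k k' p w)"
    "chg k k' p (part_y w) = part_y (chg k k' p w)"
  by (simp_all add: chg_block[OF assms] part_defs zero_vec_def)

lemma frame_adapted:
  assumes k: "k \<in> J" "p \<in> cdom k"
  shows "frame k p t_dir = delta_t A \<Gamma> k p" "frame k p (x_dir i) = delta_x A \<Gamma> k i p"
    "frame k p (y_dir i) = del_y A k i p"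
proof -
  let ?c = "\<lambda>w f. coord_vector (jet_atlas A) (jet_chart A k) w p f"
  have lin: "linear (\<lambda>w. ?c w f)" for f
  proof (cases "f \<in> SF")
    case True
    then show ?thesis
      using linear_cderiv[OF SF_smooth_at[OF True k] k]
      by (simp add: coord_vector_def chart_deriv_cderiv jet_atlas_def)
  next
    case False
    then show ?thesis by (simp add: coord_vector_def jet_atlas_def linear_zero)
  qed
  have y: "(0, 0, \<chi> j. m j) = (\<Sum>j\<in>UNIV. m j *\<^sub>R y_dir j)" for m :: "'n \<Rightarrow> real"
    using vec_eq_sum_axis[of "\<chi> j. m j"] by (simp add: prod_eq_iff fst_sum snd_sum)
  have a: "adapt k p t_dir = t_dir - (\<Sum>j\<in>UNIV. M_comp \<Gamma> k j p *\<^sub>R y_dir j)"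
    "adapt k p (x_dir i) = x_dir i - (\<Sum>j\<in>UNIV. N_comp \<Gamma> k j i p *\<^sub>R y_dir j)"
    "adapt k p (y_dir i) = y_dir i"
    unfolding y[symmetric] by (simp_all add: adapt_def shift_def prod_eq_iff vec_eq_iff)
  have f: "frame k p w = ?c (adapt k p w)" for w by (simp add: frame_def jet_atlas_def)
  have d: "?c (v - (\<Sum>j\<in>UNIV. m j *\<^sub>R y_dir j)) f = ?c v f - (\<Sum>j\<in>UNIV. m j * ?c (y_dir j) f)"
    for v f and m :: "'n \<Rightarrow> real"
    by (simp add: linear_diff[OF lin] linear_sum[OF lin] linear_scale[OF lin])
  show "frame k p t_dir = delta_t A \<Gamma> k p" "frame k p (x_dir i) = delta_x A \<Gamma> k i p"
    "frame k p (y_dir i) = del_y A k i p"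
    by (simp_all add: f a d fun_eq_iff delta_t_def delta_x_def del_t_def del_x_def del_y_def)
qed

lemma frame_expansion:
  assumes k: "k \<in> J" "p \<in> cdom k"
  shows "frame k p w f = fst w * delta_t A \<Gamma> k p f + (\<Sum>i\<in>UNIV. fst (snd w) $ i * delta_x A \<Gamma> k i p f)
     + (\<Sum>i\<in>UNIV. snd (snd w) $ i * del_y A k i p f)"
proof -
  have "frame k p w f = frame k p (fst w *\<^sub>R t_dir + (\<Sum>i\<in>UNIV. fst (snd w) $ i *\<^sub>R x_dir i)
      + (\<Sum>i\<in>UNIV. snd (snd w) $ i *\<^sub>R y_dir i)) f"
    using jet_vector_expansion[of w] by simp
  then show ?thesis
    by (simp only: frame_add[OF k] frame_sum[OF k] frame_scaleR[OF k] frame_adapted[OF k])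
qed

text \<open>The summands are defined by means of all charts at \<open>p\<close>, but a single one suffices because the changes of
  frames preserve the blocks.\<close>

lemma spans:
  assumes k: "k \<in> J" "p \<in> cdom k"
  shows "span_t A \<Gamma> p = range (\<lambda>w. frame k p (part_t w))"
    "span_x A \<Gamma> p = range (\<lambda>w. frame k p (part_x w))"
    "span_y A p = range (\<lambda>w. frame k p (part_y w))"
proof -
  have t: "frame l p (part_t w) = (\<lambda>f. fst w * delta_t A \<Gamma> l p f)"
    and x: "frame l p (part_x w) = (\<lambda>f. \<Sum>i\<in>UNIV. fst (snd w) $ i * delta_x A \<Gamma> l i p f)"
    and y: "frame l p (part_y w) = (\<lambda>f. \<Sum>i\<in>UNIV. snd (snd w) $ i * del_y A l i p f)"
    if "l \<in> J" "p \<in> cdom l" for l w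
    by (simp_all add: fun_eq_iff frame_expansion[OF that] part_defs)
  have move: "frame l p (part_t w) = frame k p (part_t (chg l k p w))"
    "frame l p (part_x w) = frame k p (part_x (chg l k p w))"
    "frame l p (part_y w) = frame k p (part_y (chg l k p w))" if "l \<in> J" "p \<in> cdom l" for l w
    using frame_chg[OF that(1) k(1) that(2) k(2)] chg_parts[OF that(1) k(1), of p w] that k by auto
  show "span_t A \<Gamma> p = range (\<lambda>w. frame k p (part_t w))"
  proof (intro equalityI subsetI)
    fix U assume "U \<in> span_t A \<Gamma> p"
    then obtain a l where l: "l \<in> J" "p \<in> cdom l" "U = (\<lambda>f. a * delta_t A \<Gamma> l p f)"
      by (auto simp: span_t_def jet_dom_def)
    have "U = frame l p (part_t (a, 0, 0))" using t[OF l(1,2)] l(3) by simp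
    then show "U \<in> range (\<lambda>w. frame k p (part_t w))" using move(1)[OF l(1,2)] by simp
  next
    fix U assume "U \<in> range (\<lambda>w. frame k p (part_t w))"
    then obtain w where "U = (\<lambda>f. fst w * delta_t A \<Gamma> k p f)" using t[OF k] by auto
    then show "U \<in> span_t A \<Gamma> p" using k unfolding span_t_def jet_dom_def by blast
  qed
  show "span_x A \<Gamma> p = range (\<lambda>w. frame k p (part_x w))"
  proof (intro equalityI subsetI)
    fix U assume "U \<in> span_x A \<Gamma> p"
    then obtain a l where l: "l \<in> J" "p \<in> cdom l" "U = (\<lambda>f. \<Sum>i\<in>UNIV. a i * delta_x A \<Gamma> l i p f)"
      by (auto simp: span_x_def jet_dom_def)
    have "U = frame l p (part_x (0, \<chi> i. a i, 0))" using x[OF l(1,2)] l(3) by simp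
    then show "U \<in> range (\<lambda>w. frame k p (part_x w))" using move(2)[OF l(1,2)] by simp
  next
    fix U assume "U \<in> range (\<lambda>w. frame k p (part_x w))"
    then obtain w where "U = (\<lambda>f. \<Sum>i\<in>UNIV. fst (snd w) $ i * delta_x A \<Gamma> k i p f)"
      using x[OF k] by auto
    then show "U \<in> span_x A \<Gamma> p" using k unfolding span_x_def jet_dom_def by blast
  qed
  show "span_y A p = range (\<lambda>w. frame k p (part_y w))"
  proof (intro equalityI subsetI)
    fix U assume "U \<in> span_y A p"
    then obtain a l where l: "l \<in> J" "p \<in> cdom l" "U = (\<lambda>f. \<Sum>i\<in>UNIV. a i * del_y A l i p f)"
      by (auto simp: span_y_def jet_dom_def)
    have "U = frame l p (part_y (0, 0, \<chi> i. a i))" using y[OF l(1,2)] l(3) by simp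
    then show "U \<in> range (\<lambda>w. frame k p (part_y w))" using move(3)[OF l(1,2)] by simp
  next
    fix U assume "U \<in> range (\<lambda>w. frame k p (part_y w))"
    then obtain w where "U = (\<lambda>f. \<Sum>i\<in>UNIV. snd (snd w) $ i * del_y A k i p f)"
      using y[OF k] by auto
    then show "U \<in> span_y A p" using k unfolding span_y_def jet_dom_def by blast
  qed
qed

text \<open>In a frame the three summands are the images of complementary constant projections.\<close>

lemma proj_summand_frame:
  assumes k: "k \<in> J" "p \<in> cdom k" and X: "X p = frame k p v"
    and H: "HP p = range (\<lambda>w. frame k p (P w))" "HQ p = range (\<lambda>w. frame k p (Q w))"
      "HR p = range (\<lambda>w. frame k p (R w))"
    and proj: "linear P" "\<And>w. P w + Q w + R w = w" "\<And>w. P (P w) = P w"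
      "\<And>w. P (Q w) = 0" "\<And>w. P (R w) = 0"
  shows "proj_summand (jet_space A) HP HQ HR X p = frame k p (P v)"
proof -
  have p: "p \<in> jet_space A" using in_pts[OF k] pts_jet by simp
  have sum: "(\<lambda>f. frame k p a f + frame k p b f + frame k p c f) = frame k p (a + b + c)" for a b c
    by (simp add: fun_eq_iff frame_add[OF k])
  have "(THE U. U \<in> HP p \<and> (\<exists>V\<in>HQ p. \<exists>W\<in>HR p. X p = (\<lambda>f. U f + V f + W f))) = frame k p (P v)"
  proof (rule the_equality)
    have "X p = (\<lambda>f. frame k p (P v) f + frame k p (Q v) f + frame k p (R v) f)"
      unfolding sum proj(2) by (rule X)
    then show "frame k p (P v) \<in> HP p \<and>
        (\<exists>V\<in>HQ p. \<exists>W\<in>HR p. X p = (\<lambda>f. frame k p (P v) f + V f + W f))"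
      unfolding H by blast
  next
    fix U assume "U \<in> HP p \<and> (\<exists>V\<in>HQ p. \<exists>W\<in>HR p. X p = (\<lambda>f. U f + V f + W f))"
    then obtain a b c where U: "U = frame k p (P a)" and
      "X p = (\<lambda>f. frame k p (P a) f + frame k p (Q b) f + frame k p (R c) f)"
      unfolding H by blast
    then have "frame k p v = frame k p (P a + Q b + R c)" using X sum by simp
    then have "v = P a + Q b + R c" by (rule frame_inject[OF k])
    then show "U = frame k p (P v)" by (simp add: U linear_add[OF proj(1)] proj)
  qed
  then show ?thesis using p by (simp add: proj_summand_def)
qed

lemma projections_frame:
  assumes "X \<in> VF" "k \<in> J" "p \<in> cdom k"
  shows "h_R A \<Gamma> X p = frame k p (part_t (coords k X p))"
    "h_M A \<Gamma> X p = frame k p (part_x (coords k X p))"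
    "v_proj A \<Gamma> X p = frame k p (part_y (coords k X p))"
proof -
  note X = VF_coords(1)[OF assms]
  note S = spans[OF assms(2,3)]
  show "h_R A \<Gamma> X p = frame k p (part_t (coords k X p))"
    unfolding h_R_def by (rule proj_summand_frame[where P = part_t and Q = part_x and R = part_y
          and X = X and HP = "span_t A \<Gamma>" and HQ = "span_x A \<Gamma>" and HR = "span_y A",
          OF assms(2,3) X S(1,2,3)]) (simp_all add: linear_parts part_eqs parts_sum)
  show "h_M A \<Gamma> X p = frame k p (part_x (coords k X p))"
    unfolding h_M_def by (rule proj_summand_frame[where P = part_x and Q = part_t and R = part_y
          and X = X and HP = "span_x A \<Gamma>" and HQ = "span_t A \<Gamma>" and HR = "span_y A",
          OF assms(2,3) X S(2,1,3)]) (simp_all add: linear_parts part_eqs, simp add: part_defs prod_eq_iff)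
  show "v_proj A \<Gamma> X p = frame k p (part_y (coords k X p))"
    unfolding v_proj_def by (rule proj_summand_frame[where P = part_y and Q = part_t and R = part_x
          and X = X and HP = "span_y A" and HQ = "span_t A \<Gamma>" and HR = "span_x A \<Gamma>",
          OF assms(2,3) X S(3,1,2)]) (simp_all add: linear_parts part_eqs, simp add: part_defs prod_eq_iff)
qed

lemma projections_outside:
  assumes "p \<notin> pts"
  shows "h_R A \<Gamma> X p = (\<lambda>f. 0)" "h_M A \<Gamma> X p = (\<lambda>f. 0)" "v_proj A \<Gamma> X p = (\<lambda>f. 0)"
  using assms by (simp_all add: h_R_def h_M_def v_proj_def proj_summand_def pts_jet)

lemma gamma_linear_iff:
  assumes "conn nabla" "has_coeffs nabla \<omega>" "bilinear_coeffs \<omega>"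
  shows "gamma_linear_connection A \<Gamma> nabla \<longleftrightarrow>
    (\<forall>P\<in>{part_t, part_x, part_y}. \<forall>k\<in>J. \<forall>p\<in>cdom k. \<forall>u\<in>Basis. \<forall>v\<in>Basis. \<omega> k p (P u) v = P (\<omega> k p u v))"
proof -
  note iff = parallel_iff[OF assms]
  show ?thesis
    using iff[OF linear_parts(1) projections_frame(1) projections_outside(1)]
      iff[OF linear_parts(2) projections_frame(2) projections_outside(2)]
      iff[OF linear_parts(3) projections_frame(3) projections_outside(3)] assms(1)
    by (simp add: gamma_linear_connection_def jet_atlas_def)
qed

end


section \<open>Adapted coefficients\<close>

text \<open>The nine families of adapted components are the blocks of one bilinear map.\<close>

definition jet_coeffs ::
  "('m, 'n::finite) adapted_comps \<Rightarrow> ('m, 'n) jet_index \<Rightarrow> 'm jet \<Rightarrow>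
   real \<times> (real ^ 'n) \<times> (real ^ 'n) \<Rightarrow> real \<times> (real ^ 'n) \<times> (real ^ 'n) \<Rightarrow>
   real \<times> (real ^ 'n) \<times> (real ^ 'n)" where
  "jet_coeffs K k p u v =
     (fst u * (G_bar K k p * fst v + (\<Sum>j\<in>UNIV. L_bar K k j p * fst (snd v) $ j)
        + (\<Sum>j\<in>UNIV. C_bar K k j p * snd (snd v) $ j)),
      \<chi> r. \<Sum>i\<in>UNIV. fst (snd u) $ i * (G_x K k r i p * fst v
        + (\<Sum>j\<in>UNIV. L_x K k r i j p * fst (snd v) $ j) + (\<Sum>j\<in>UNIV. C_x K k r i j p * snd (snd v) $ j)),
      \<chi> r. \<Sum>i\<in>UNIV. snd (snd u) $ i * (G_y K k r i p * fst v
        + (\<Sum>j\<in>UNIV. L_y K k r i j p * fst (snd v) $ j) + (\<Sum>j\<in>UNIV. C_y K k r i j p * snd (snd v) $ j)))"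

lemma bilinear_jet_coeffs: "bilinear (jet_coeffs K k p)"
  unfolding bilinear_def
  by (auto intro!: linearI simp: jet_coeffs_def vec_eq_iff algebra_simps sum.distrib sum_distrib_left)

lemma jet_coeffs_basis:
  "jet_coeffs K k p t_dir t_dir = (G_bar K k p, 0, 0)"
  "jet_coeffs K k p (x_dir i) t_dir = (0, \<chi> r. G_x K k r i p, 0)"
  "jet_coeffs K k p (y_dir i) t_dir = (0, 0, \<chi> r. G_y K k r i p)"
  "jet_coeffs K k p t_dir (x_dir j) = (L_bar K k j p, 0, 0)"
  "jet_coeffs K k p (x_dir i) (x_dir j) = (0, \<chi> r. L_x K k r i j p, 0)"
  "jet_coeffs K k p (y_dir i) (x_dir j) = (0, 0, \<chi> r. L_y K k r i j p)"
  "jet_coeffs K k p t_dir (y_dir j) = (C_bar K k j p, 0, 0)"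
  "jet_coeffs K k p (x_dir i) (y_dir j) = (0, \<chi> r. C_x K k r i j p, 0)"
  "jet_coeffs K k p (y_dir i) (y_dir j) = (0, 0, \<chi> r. C_y K k r i j p)"
  by (simp_all add: jet_coeffs_def zero_vec_def)

lemma jet_coeffs_parts:
  "jet_coeffs K k p (part_t u) v = part_t (jet_coeffs K k p u v)"
  "jet_coeffs K k p (part_x u) v = part_x (jet_coeffs K k p u v)"
  "jet_coeffs K k p (part_y u) v = part_y (jet_coeffs K k p u v)"
  by (simp_all add: jet_coeffs_def part_defs zero_vec_def)

lemma connection_eq_on_cong:
  assumes "\<And>p. p \<in> D \<Longrightarrow> X p = X' p" "\<And>p. p \<in> D \<Longrightarrow> Y p = Y' p" "\<And>p. p \<in> D \<Longrightarrow> Z p = Z' p"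
  shows "connection_eq_on A nabla D X Y Z \<longleftrightarrow> connection_eq_on A nabla D X' Y' Z'"
proof -
  have imp: "connection_eq_on A nabla D X' Y' Z'"
    if eq: "connection_eq_on A nabla D X Y Z" "\<And>p. p \<in> D \<Longrightarrow> X p = X' p" "\<And>p. p \<in> D \<Longrightarrow> Y p = Y' p"
      "\<And>p. p \<in> D \<Longrightarrow> Z p = Z' p" for X Y Z X' Y' Z'
    unfolding connection_eq_on_def
  proof (intro allI ballI impI, elim conjE)
    fix V X0 Y0 p
    assume V: "X0 \<in> vector_fields A" "Y0 \<in> vector_fields A" "p \<in> V"
      "openin (atlas_topology A) V" "V \<subseteq> D" "\<forall>p\<in>V. X0 p = X' p" "\<forall>p\<in>V. Y0 p = Y' p"
    have "\<forall>q\<in>V. X0 q = X q" "\<forall>q\<in>V. Y0 q = Y q" using V(5-7) eq(2,3) by auto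
    then have "nabla X0 Y0 p = Z p" using eq(1) V unfolding connection_eq_on_def by blast
    then show "nabla X0 Y0 p = Z' p" using eq(4) V(3,5) by auto
  qed
  show ?thesis
    using imp[of X Y Z X' Y' Z'] imp[of X' Y' Z' X Y Z] assms by auto
qed

context jet_nonlinear
begin

lemma bilinear_coeffs_jet_coeffs: "bilinear_coeffs (jet_coeffs K)"
  by (simp add: bilinear_coeffs_def bilinear_jet_coeffs)

text \<open>On pairs of basis vectors \<open>jet_coeffs\<close> has a single block, namely one of the nine families; so the two
  notions consist of the same nine families of equations.\<close>

lemma has_adapted_coefficients_iff:
  "has_adapted_coefficients A \<Gamma> nabla K \<longleftrightarrow> has_coeffs nabla (jet_coeffs K)"
proof -
  let ?E = "\<lambda>k u v. connection_eq_on (jet_chart A ` J) nabla (cdom k)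
      (\<lambda>p. frame k p v) (\<lambda>p. frame k p u) (\<lambda>p. frame k p (jet_coeffs K k p u v))"
  let ?C = "\<lambda>k. connection_eq_on (jet_atlas A) nabla (jet_dom A k)"
  have "?E k t_dir t_dir \<longleftrightarrow> ?C k (delta_t A \<Gamma> k) (delta_t A \<Gamma> k) (\<lambda>p f. G_bar K k p * delta_t A \<Gamma> k p f)"
    "?E k (x_dir i) t_dir \<longleftrightarrow> ?C k (delta_t A \<Gamma> k) (delta_x A \<Gamma> k i)
       (\<lambda>p f. \<Sum>r\<in>UNIV. G_x K k r i p * delta_x A \<Gamma> k r p f)"
    "?E k (y_dir i) t_dir \<longleftrightarrow> ?C k (delta_t A \<Gamma> k) (del_y A k i)
       (\<lambda>p f. \<Sum>r\<in>UNIV. G_y K k r i p * del_y A k r p f)"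
    "?E k t_dir (x_dir j) \<longleftrightarrow> ?C k (delta_x A \<Gamma> k j) (delta_t A \<Gamma> k) (\<lambda>p f. L_bar K k j p * delta_t A \<Gamma> k p f)"
    "?E k (x_dir i) (x_dir j) \<longleftrightarrow> ?C k (delta_x A \<Gamma> k j) (delta_x A \<Gamma> k i)
       (\<lambda>p f. \<Sum>r\<in>UNIV. L_x K k r i j p * delta_x A \<Gamma> k r p f)"
    "?E k (y_dir i) (x_dir j) \<longleftrightarrow> ?C k (delta_x A \<Gamma> k j) (del_y A k i)
       (\<lambda>p f. \<Sum>r\<in>UNIV. L_y K k r i j p * del_y A k r p f)"
    "?E k t_dir (y_dir j) \<longleftrightarrow> ?C k (del_y A k j) (delta_t A \<Gamma> k) (\<lambda>p f. C_bar K k j p * delta_t A \<Gamma> k p f)"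
    "?E k (x_dir i) (y_dir j) \<longleftrightarrow> ?C k (del_y A k j) (delta_x A \<Gamma> k i)
       (\<lambda>p f. \<Sum>r\<in>UNIV. C_x K k r i j p * delta_x A \<Gamma> k r p f)"
    "?E k (y_dir i) (y_dir j) \<longleftrightarrow> ?C k (del_y A k j) (del_y A k i)
       (\<lambda>p f. \<Sum>r\<in>UNIV. C_y K k r i j p * del_y A k r p f)" if "k \<in> J" for k i j
    unfolding jet_atlas_def jet_dom_def jet_coeffs_basis
    by (rule connection_eq_on_cong; simp add: frame_adapted[OF that] frame_expansion[OF that] fun_eq_iff)+
  then show ?thesis
    unfolding has_adapted_coefficients_def has_coeffs_def ball_Basis_jet Let_def by auto
qed


subsection \<open>The transformation rules\<close>

text \<open>The entries of the change of frames are \<open>dt'/dt\<close>, \<open>\<partial>x'/\<partial>x\<close> and \<open>(\<partial>x'/\<partial>x) (dt/dt')\<close>.  They do not depend on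
  \<open>y\<close>, so that the adapted direction and the coordinate direction with the same \<open>t\<close> and \<open>x\<close> components
  give the same derivative.  The mixed second derivatives are put into the order of the transformation
  rules.\<close>

lemma fderiv_chg_components:
  assumes k: "k \<in> J" and k': "k' \<in> J" and p: "p \<in> cdom k \<inter> cdom k'"
  shows "fderiv k (\<lambda>q. chg k k' q u) p v =
    (fst u * (fst v * d2_tt A k k' p),
     \<chi> r. \<Sum>i\<in>UNIV. fst (snd u) $ i * (\<Sum>j\<in>UNIV. fst (snd v) $ j * d2_xx A k k' r i j p),
     \<chi> r. \<Sum>i\<in>UNIV. snd (snd u) $ i * (d_xx A k k' r i p * (fst v * (d_tt A k k' p * d2_tt A k' k p))
       + (\<Sum>j\<in>UNIV. fst (snd v) $ j * d2_xx A k k' r i j p) * d_tt A k' k p))"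
proof -
  let ?w = "adapt k p v"
  have pk: "p \<in> cdom k" "p \<in> cdom k'" and pp: "p \<in> pts" using p in_pts[OF k] by auto
  have sm: "smooth_at p (\<lambda>q. chg k k' q u)"
    by (rule smooth_at_chg[OF smooth_at_const[OF pp] k k' pk])
  note sp = smooth_at_partials[OF k k' p]
  note part = cderiv_bounded_linear[OF _ sm k pk(1), of _ ?w, symmetric]
  have cong: "cderiv k (\<lambda>q. L (chg k k' q u)) p ?w = cderiv k f p ?w"
    if "\<And>q. q \<in> cdom k \<inter> cdom k' \<Longrightarrow> L (chg k k' q u) = f q" for L and f :: "'m jet \<Rightarrow> real"
    by (rule cderiv_cong[OF opn_overlap[OF k k'] p that k pk(1)])
  have dxx: "cderiv k (d_xx A k k' r i) p ?w = (\<Sum>j\<in>UNIV. fst (snd v) $ j * d2_xx A k k' r i j p)" for r i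
    using cderiv_d_xx[OF k k' p, of r i ?w] d2_xx_symmetric[OF k k' p] by simp
  have t: "fst (fderiv k (\<lambda>q. chg k k' q u) p v) = fst u * (fst v * d2_tt A k k' p)"
  proof -
    have "fst (fderiv k (\<lambda>q. chg k k' q u) p v) = cderiv k (\<lambda>q. fst u * d_tt A k k' q) p ?w"
      unfolding fderiv_def part[OF bounded_linear_parts(1)]
      by (rule cong) (simp add: chg_block[OF k k'] mult.commute)
    then show ?thesis
      by (simp add: cderiv_bounded_linear[OF bounded_linear_mult_right sp(1) k pk(1)] cderiv_d_tt[OF k k' p])
  qed
  have x: "fst (snd (fderiv k (\<lambda>q. chg k k' q u) p v)) $ r
      = (\<Sum>i\<in>UNIV. fst (snd u) $ i * (\<Sum>j\<in>UNIV. fst (snd v) $ j * d2_xx A k k' r i j p))" for r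
  proof -
    have "fst (snd (fderiv k (\<lambda>q. chg k k' q u) p v)) $ r
        = cderiv k (\<lambda>q. \<Sum>i\<in>UNIV. fst (snd u) $ i * d_xx A k k' r i q) p ?w"
      unfolding fderiv_def part[OF bounded_linear_parts(4)]
      by (rule cong) (simp add: chg_block[OF k k'] mult.commute)
    also have "\<dots> = (\<Sum>i\<in>UNIV. cderiv k (\<lambda>q. fst (snd u) $ i * d_xx A k k' r i q) p ?w)"
      by (intro cderiv_sum pp k pk smooth_at_bounded_linear[OF bounded_linear_mult_right] sp)
    finally show ?thesis
      by (simp add: cderiv_bounded_linear[OF bounded_linear_mult_right sp(2) k pk(1)] dxx)
  qed
  have y: "snd (snd (fderiv k (\<lambda>q. chg k k' q u) p v)) $ r
      = (\<Sum>i\<in>UNIV. snd (snd u) $ i * (d_xx A k k' r i p * (fst v * (d_tt A k k' p * d2_tt A k' k p))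
       + (\<Sum>j\<in>UNIV. fst (snd v) $ j * d2_xx A k k' r i j p) * d_tt A k' k p))" for r
  proof -
    have "snd (snd (fderiv k (\<lambda>q. chg k k' q u) p v)) $ r
        = cderiv k (\<lambda>q. \<Sum>i\<in>UNIV. snd (snd u) $ i * (d_xx A k k' r i q * d_tt A k' k q)) p ?w"
      unfolding fderiv_def part[OF bounded_linear_parts(5)]
      by (rule cong) (simp add: chg_block[OF k k'] mult.commute)
    also have "\<dots> = (\<Sum>i\<in>UNIV. cderiv k (\<lambda>q. snd (snd u) $ i * (d_xx A k k' r i q * d_tt A k' k q)) p ?w)"
      by (intro cderiv_sum pp k pk smooth_at_bounded_linear[OF bounded_linear_mult_right] smooth_at_mult sp)
    finally show ?thesis
      by (simp add: cderiv_bounded_linear[OF bounded_linear_mult_right smooth_at_mult[OF sp(2,3)] k pk(1)]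
          cderiv_bounded_bilinear[OF bounded_bilinear_mult sp(2,3) k pk(1)] dxx
          cderiv_d_tt_inverse[OF k k' p])
  qed
  show ?thesis by (simp add: prod_eq_iff vec_eq_iff t x y)
qed

text \<open>The vector that the transformation law of the coefficients in the chart \<open>k'\<close> prescribes in
  the chart \<open>k\<close>.\<close>

definition pulled_back ::
  "('m, 'n) adapted_comps \<Rightarrow> ('m, 'n) jet_index \<Rightarrow> ('m, 'n) jet_index \<Rightarrow> 'm jet \<Rightarrow>
   real \<times> (real ^ 'n) \<times> (real ^ 'n) \<Rightarrow> real \<times> (real ^ 'n) \<times> (real ^ 'n) \<Rightarrow>
   real \<times> (real ^ 'n) \<times> (real ^ 'n)" where
  "pulled_back K k k' p u v = chg k' k p (jet_coeffs K k' p (chg k k' p u) (chg k k' p v)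
     + fderiv k (\<lambda>q. chg k k' q u) p v)"

lemma coeffs_transform_iff:
  "coeffs_transform (jet_coeffs K) \<longleftrightarrow>
    (\<forall>k\<in>J. \<forall>k'\<in>J. \<forall>p\<in>cdom k \<inter> cdom k'. \<forall>u\<in>Basis. \<forall>v\<in>Basis. jet_coeffs K k p u v = pulled_back K k k' p u v)"
proof -
  have "chg k k' p w = z \<longleftrightarrow> w = chg k' k p z" if "k \<in> J" "k' \<in> J" "p \<in> cdom k \<inter> cdom k'" for k k' p w z
  proof -
    have "chg k' k p (chg k k' p w) = w" "chg k k' p (chg k' k p z) = z"
      using chg_chg[OF that(1,2), of p w] chg_chg[OF that(2,1), of p z] that(3) by blast+
    then show ?thesis by metis
  qed
  then show ?thesis unfolding coeffs_transform_def pulled_back_def by simp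
qed

text \<open>The right-hand sides of the nine transformation rules appear.  In the blocks for vertical vectors the
  factors \<open>dt'/dt\<close> and \<open>dt/dt'\<close> from the two changes of frames cancel, and contracting \<open>\<partial>x'/\<partial>x\<close> with its
  inverse gives the Kronecker symbol in the rule for \<open>G_y\<close>.\<close>

lemma pulled_back_basis:
  assumes k: "k \<in> J" and k': "k' \<in> J" and p: "p \<in> cdom k \<inter> cdom k'"
  shows "pulled_back K k k' p t_dir t_dir =
      (G_bar K k' p * d_tt A k k' p + d_tt A k' k p * d2_tt A k k' p, 0, 0)" (is ?tt)
    and "pulled_back K k k' p (x_dir i) t_dir = (0, \<chi> l. \<Sum>r\<in>UNIV. \<Sum>j\<in>UNIV.
              G_x K k' r j p * d_xx A k' k l r p * d_xx A k k' j i p * d_tt A k k' p, 0)" (is ?xt)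
    and "pulled_back K k k' p (y_dir i) t_dir = (0, 0, \<chi> l. (\<Sum>r\<in>UNIV. \<Sum>j\<in>UNIV.
              G_y K k' r j p * d_xx A k' k l r p * d_xx A k k' j i p * d_tt A k k' p)
           + (if i = l then 1 else 0) * (d_tt A k k' p)\<^sup>2 * d2_tt A k' k p)" (is ?yt)
    and "pulled_back K k k' p t_dir (x_dir j) = (\<Sum>l\<in>UNIV. L_bar K k' l p * d_xx A k k' l j p, 0, 0)" (is ?tx)
    and "pulled_back K k k' p (x_dir i) (x_dir j) = (0, \<chi> r. (\<Sum>s\<in>UNIV. \<Sum>a\<in>UNIV. \<Sum>b\<in>UNIV.
              L_x K k' s a b p * d_xx A k' k r s p * d_xx A k k' a i p * d_xx A k k' b j p)
           + (\<Sum>s\<in>UNIV. d_xx A k' k r s p * d2_xx A k k' s i j p), 0)" (is ?xx)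
    and "pulled_back K k k' p (y_dir i) (x_dir j) = (0, 0, \<chi> r. (\<Sum>s\<in>UNIV. \<Sum>a\<in>UNIV. \<Sum>b\<in>UNIV.
              L_y K k' s a b p * d_xx A k' k r s p * d_xx A k k' a i p * d_xx A k k' b j p)
           + (\<Sum>s\<in>UNIV. d_xx A k' k r s p * d2_xx A k k' s i j p))" (is ?yx)
    and "pulled_back K k k' p t_dir (y_dir i) =
           (\<Sum>j\<in>UNIV. C_bar K k' j p * d_xx A k k' j i p * d_tt A k' k p, 0, 0)" (is ?ty)
    and "pulled_back K k k' p (x_dir i) (y_dir j) = (0, \<chi> r. \<Sum>s\<in>UNIV. \<Sum>a\<in>UNIV. \<Sum>b\<in>UNIV.
              C_x K k' s a b p * d_xx A k' k r s p * d_xx A k k' a i p * d_xx A k k' b j p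
                * d_tt A k' k p, 0)" (is ?xy)
    and "pulled_back K k k' p (y_dir i) (y_dir j) = (0, 0, \<chi> r. \<Sum>s\<in>UNIV. \<Sum>a\<in>UNIV. \<Sum>b\<in>UNIV.
              C_y K k' s a b p * d_xx A k' k r s p * d_xx A k k' a i p * d_xx A k k' b j p
                * d_tt A k' k p)" (is ?yy)
proof -
  have p': "p \<in> cdom k' \<inter> cdom k" using p by auto
  have de: "d_tt A k' k p * d_tt A k k' p = 1" using partials_inverse(1)[OF k k' p] by (simp add: mult.commute)
  note defs = pulled_back_def fderiv_chg_components[OF k k' p] chg_block[OF k k' p] chg_block[OF k' k p']
    jet_coeffs_def prod_eq_iff vec_eq_iff
  show ?tt using de by (simp add: defs algebra_simps)
  show ?tx using de by (simp add: defs sum_distrib_left) (intro sum.cong refl, algebra)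
  show ?ty using de by (simp add: defs sum_distrib_left) (intro sum.cong refl, algebra)
  show ?xt by (simp add: defs sum_distrib_left mult_ac)
  show ?xx by (simp add: defs sum_distrib_left distrib_left sum.distrib mult_ac)
  show ?xy by (simp add: defs) (simp add: sum_distrib_left mult_ac)
  have cancel: "x * d_tt A k k' p * (y * d_tt A k' k p * z) = x * y * z"
    "x * d_tt A k k' p * (z * d_tt A k' k p) = x * z" for x y z
    using de by algebra+
  show ?yt
  proof -
    have 2: "x * d_tt A k k' p * (y * (d_tt A k k' p * m)) = (d_tt A k k' p)\<^sup>2 * m * (x * y)" for x y m
      by (simp add: power2_eq_square mult_ac)
    have "(\<Sum>s\<in>UNIV. d_xx A k' k l s p * d_tt A k k' p * (d_xx A k k' s i p * (d_tt A k k' p * d2_tt A k' k p)))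
       = (if i = l then 1 else 0) * (d_tt A k k' p)\<^sup>2 * d2_tt A k' k p" for l
      unfolding 2 sum_distrib_left[symmetric] partials_inverse(2)[OF k k' p] by (simp add: mult_ac)
    then show ?thesis
      by (simp add: defs distrib_left sum.distrib sum_distrib_left[of "_ * d_tt A k k' p"] cancel)
        (simp add: sum_distrib_left mult_ac)
  qed
  show ?yx
    by (simp add: defs distrib_left sum.distrib sum_distrib_left[of "_ * d_tt A k k' p"] cancel)
      (simp add: sum_distrib_left mult_ac)
  show ?yy
    by (simp add: defs distrib_left sum.distrib sum_distrib_left[of "_ * d_tt A k k' p"] cancel)
      (simp add: sum_distrib_left mult_ac)
qed

lemma transformation_rules_iff: "transformation_rules A K \<longleftrightarrow> coeffs_transform (jet_coeffs K)"
proof -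
  have "(\<forall>u\<in>Basis. \<forall>v\<in>Basis. jet_coeffs K k p u v = pulled_back K k k' p u v) \<longleftrightarrow>
        G_bar K k p = G_bar K k' p * d_tt A k k' p + d_tt A k' k p * d2_tt A k k' p \<and>
        (\<forall>l i. G_x K k l i p =
           (\<Sum>r\<in>UNIV. \<Sum>j\<in>UNIV.
              G_x K k' r j p * d_xx A k' k l r p * d_xx A k k' j i p * d_tt A k k' p)) \<and>
        (\<forall>l i. G_y K k l i p =
           (\<Sum>r\<in>UNIV. \<Sum>j\<in>UNIV.
              G_y K k' r j p * d_xx A k' k l r p * d_xx A k k' j i p * d_tt A k k' p)
           + (if i = l then 1 else 0) * (d_tt A k k' p)\<^sup>2 * d2_tt A k' k p) \<and>
        (\<forall>j. L_bar K k j p = (\<Sum>l\<in>UNIV. L_bar K k' l p * d_xx A k k' l j p)) \<and>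
        (\<forall>r i j. L_x K k r i j p =
           (\<Sum>s\<in>UNIV. \<Sum>a\<in>UNIV. \<Sum>b\<in>UNIV.
              L_x K k' s a b p * d_xx A k' k r s p * d_xx A k k' a i p * d_xx A k k' b j p)
           + (\<Sum>s\<in>UNIV. d_xx A k' k r s p * d2_xx A k k' s i j p)) \<and>
        (\<forall>r i j. L_y K k r i j p =
           (\<Sum>s\<in>UNIV. \<Sum>a\<in>UNIV. \<Sum>b\<in>UNIV.
              L_y K k' s a b p * d_xx A k' k r s p * d_xx A k k' a i p * d_xx A k k' b j p)
           + (\<Sum>s\<in>UNIV. d_xx A k' k r s p * d2_xx A k k' s i j p)) \<and>
        (\<forall>i. C_bar K k i p =
           (\<Sum>j\<in>UNIV. C_bar K k' j p * d_xx A k k' j i p * d_tt A k' k p)) \<and>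
        (\<forall>r i j. C_x K k r i j p =
           (\<Sum>s\<in>UNIV. \<Sum>a\<in>UNIV. \<Sum>b\<in>UNIV.
              C_x K k' s a b p * d_xx A k' k r s p * d_xx A k k' a i p * d_xx A k k' b j p
                * d_tt A k' k p)) \<and>
        (\<forall>r i j. C_y K k r i j p =
           (\<Sum>s\<in>UNIV. \<Sum>a\<in>UNIV. \<Sum>b\<in>UNIV.
              C_y K k' s a b p * d_xx A k' k r s p * d_xx A k k' a i p * d_xx A k k' b j p
                * d_tt A k' k p))"
    if "k \<in> J" "k' \<in> J" "p \<in> cdom k \<inter> cdom k'" for k k' p
    unfolding ball_Basis_jet jet_coeffs_basis pulled_back_basis[OF that] prod.inject vec_eq_iff vec_lambda_beta
    by (rule iffI; simp)
  then show ?thesis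
    unfolding coeffs_transform_iff transformation_rules_def jet_dom_def by simp
qed


section \<open>Connections and their adapted components\<close>

lemma local_functionD:
  "local_function A F \<Longrightarrow> k \<in> J \<Longrightarrow> p \<in> cdom k \<Longrightarrow> smooth_at p (F k)"
  using smooth_in_chart_iff unfolding local_function_def by blast

lemma local_functionI:
  assumes "\<And>k p. k \<in> J \<Longrightarrow> p \<in> cdom k \<Longrightarrow> smooth_at p (g k)"
  shows "local_function A (\<lambda>k p. if k \<in> J \<and> p \<in> cdom k then g k p else 0)"
  unfolding local_function_def
proof (intro conjI ballI)
  fix k assume k: "k \<in> J"
  show "smooth_in_chart (jet_chart A k) (\<lambda>p. if k \<in> J \<and> p \<in> cdom k then g k p else 0)"
    unfolding smooth_in_chart_iff[OF k]
  proof
    fix p assume p: "p \<in> cdom k"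
    show "smooth_at p (\<lambda>p. if k \<in> J \<and> p \<in> cdom k then g k p else 0)"
      by (rule smooth_at_cong[OF assms[OF k p] opn_cdom[OF k] p]) (simp add: k)
  qed
qed (simp add: jet_dom_def)

lemma local_function_ext:
  assumes "local_function A F" "local_function A F'" "\<And>k p. k \<in> J \<Longrightarrow> p \<in> cdom k \<Longrightarrow> F k p = F' k p"
  shows "F = F'"
proof (intro ext)
  fix k p
  show "F k p = F' k p"
  proof (cases "k \<in> J \<and> p \<in> cdom k")
    case False
    then have "F k p = 0" "F' k p = 0"
      using assms(1,2) unfolding local_function_def jet_dom_def by blast+
    then show ?thesis by simp
  qed (use assms(3) in blast)
qed

lemma local_componentsD:
  assumes "local_components A K"
  shows "local_function A (G_bar K)" "local_function A (\<lambda>k. G_x K k r i)" "local_function A (\<lambda>k. G_y K k r i)"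
    "local_function A (\<lambda>k. L_bar K k j)" "local_function A (\<lambda>k. L_x K k r i j)" "local_function A (\<lambda>k. L_y K k r i j)"
    "local_function A (\<lambda>k. C_bar K k j)" "local_function A (\<lambda>k. C_x K k r i j)" "local_function A (\<lambda>k. C_y K k r i j)"
  using assms by (simp_all add: local_components_def)

lemma smooth_jet_coeffs:
  assumes "local_components A K"
  shows "smooth_coeffs (jet_coeffs K)"
  unfolding smooth_coeffs_def ball_Basis_jet jet_coeffs_basis
proof (intro ballI conjI allI)
  fix k p assume k: "k \<in> J" "p \<in> cdom k"
  note c = smooth_at_const[OF in_pts[OF k]]
  have sm: "smooth_at p (G_bar K k)" "smooth_at p (G_x K k r i)" "smooth_at p (G_y K k r i)"
    "smooth_at p (L_bar K k j)" "smooth_at p (L_x K k r i j)" "smooth_at p (L_y K k r i j)"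
    "smooth_at p (C_bar K k j)" "smooth_at p (C_x K k r i j)" "smooth_at p (C_y K k r i j)" for r i j
    by (rule local_componentsD[OF assms, THEN local_functionD, OF k])+
  fix i j
  show "smooth_at p (\<lambda>q. (G_bar K k q, 0 :: real ^ 'n, 0 :: real ^ 'n))"
    "smooth_at p (\<lambda>q. (L_bar K k j q, 0 :: real ^ 'n, 0 :: real ^ 'n))"
    "smooth_at p (\<lambda>q. (C_bar K k j q, 0 :: real ^ 'n, 0 :: real ^ 'n))"
    "smooth_at p (\<lambda>q. (0 :: real, \<chi> r. G_x K k r i q, 0 :: real ^ 'n))"
    "smooth_at p (\<lambda>q. (0 :: real, \<chi> r. L_x K k r i j q, 0 :: real ^ 'n))"
    "smooth_at p (\<lambda>q. (0 :: real, \<chi> r. C_x K k r i j q, 0 :: real ^ 'n))"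
    "smooth_at p (\<lambda>q. (0 :: real, 0 :: real ^ 'n, \<chi> r. G_y K k r i q))"
    "smooth_at p (\<lambda>q. (0 :: real, 0 :: real ^ 'n, \<chi> r. L_y K k r i j q))"
    "smooth_at p (\<lambda>q. (0 :: real, 0 :: real ^ 'n, \<chi> r. C_y K k r i j q))"
    by (intro smooth_at_Pair smooth_at_vec in_pts[OF k] c sm)+
qed

lemma components_unique:
  assumes "local_components A K" "local_components A K'"
    and "has_coeffs nabla (jet_coeffs K)" "has_coeffs nabla (jet_coeffs K')"
  shows "K = K'"
proof -
  have eq: "jet_coeffs K k p u v = jet_coeffs K' k p u v"
    if "k \<in> J" "p \<in> cdom k" "u \<in> Basis" "v \<in> Basis" for k p u v
    by (rule coeffs_unique[OF assms(3,4) that])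
  have dirs: "t_dir \<in> Basis" "x_dir i \<in> Basis" "y_dir i \<in> Basis" for i :: 'n
    using ball_Basis_jet[of "\<lambda>u. u \<in> Basis"] by auto
  note e = eq[OF _ _ dirs(1) dirs(1)] eq[OF _ _ dirs(2) dirs(1)] eq[OF _ _ dirs(3) dirs(1)]
    eq[OF _ _ dirs(1) dirs(2)] eq[OF _ _ dirs(2) dirs(2)] eq[OF _ _ dirs(3) dirs(2)]
    eq[OF _ _ dirs(1) dirs(3)] eq[OF _ _ dirs(2) dirs(3)] eq[OF _ _ dirs(3) dirs(3)]
  have comps: "G_bar K k p = G_bar K' k p" "G_x K k r i p = G_x K' k r i p" "G_y K k r i p = G_y K' k r i p"
    "L_bar K k j p = L_bar K' k j p" "L_x K k r i j p = L_x K' k r i j p" "L_y K k r i j p = L_y K' k r i j p"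
    "C_bar K k j p = C_bar K' k j p" "C_x K k r i j p = C_x K' k r i j p" "C_y K k r i j p = C_y K' k r i j p"
    if "k \<in> J" "p \<in> cdom k" for k p r i j
    using e[OF that] by (simp_all add: jet_coeffs_basis vec_eq_iff)
  note loc = local_componentsD[OF assms(1)] local_componentsD[OF assms(2)]
  have "G_bar K = G_bar K'" by (rule local_function_ext[OF _ _ comps(1)]) (rule loc)+
  moreover have "(\<lambda>k. G_x K k r i) = (\<lambda>k. G_x K' k r i)" for r i
    by (rule local_function_ext[OF _ _ comps(2)]) (rule loc)+
  moreover have "(\<lambda>k. G_y K k r i) = (\<lambda>k. G_y K' k r i)" for r i
    by (rule local_function_ext[OF _ _ comps(3)]) (rule loc)+
  moreover have "(\<lambda>k. L_bar K k j) = (\<lambda>k. L_bar K' k j)" for j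
    by (rule local_function_ext[OF _ _ comps(4)]) (rule loc)+
  moreover have "(\<lambda>k. L_x K k r i j) = (\<lambda>k. L_x K' k r i j)" for r i j
    by (rule local_function_ext[OF _ _ comps(5)]) (rule loc)+
  moreover have "(\<lambda>k. L_y K k r i j) = (\<lambda>k. L_y K' k r i j)" for r i j
    by (rule local_function_ext[OF _ _ comps(6)]) (rule loc)+
  moreover have "(\<lambda>k. C_bar K k j) = (\<lambda>k. C_bar K' k j)" for j
    by (rule local_function_ext[OF _ _ comps(7)]) (rule loc)+
  moreover have "(\<lambda>k. C_x K k r i j) = (\<lambda>k. C_x K' k r i j)" for r i j
    by (rule local_function_ext[OF _ _ comps(8)]) (rule loc)+
  moreover have "(\<lambda>k. C_y K k r i j) = (\<lambda>k. C_y K' k r i j)" for r i j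
    by (rule local_function_ext[OF _ _ comps(9)]) (rule loc)+
  ultimately show ?thesis
    by (intro adapted_comps.equality) (auto simp: fun_eq_iff)
qed

text \<open>The coefficients of a connection for which the three projections are parallel preserve the blocks of
  their first argument.  So they are given by nine families of functions, which are set to \<open>0\<close> outside
  the domains of the charts.\<close>

lemma components_exist:
  assumes nabla: "gamma_linear_connection A \<Gamma> nabla"
  obtains K where "local_components A K" "has_coeffs nabla (jet_coeffs K)"
proof -
  have conn: "conn nabla" using nabla by (simp add: gamma_linear_connection_def jet_atlas_def)
  obtain \<omega> where \<omega>: "bilinear_coeffs \<omega>" "smooth_coeffs \<omega>" "has_coeffs nabla \<omega>"
    by (rule coeffs_exist[OF conn])
  define loc :: "(('m, 'n) jet_index \<Rightarrow> 'm jet \<Rightarrow> real) \<Rightarrow> ('m, 'n) jet_index \<Rightarrow> 'm jet \<Rightarrow> real"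
    where "loc g = (\<lambda>k p. if k \<in> J \<and> p \<in> cdom k then g k p else 0)" for g
  define K where "K = \<lparr>G_bar = loc (\<lambda>k p. fst (\<omega> k p t_dir t_dir)),
    G_x = (\<lambda>k r i. loc (\<lambda>k p. fst (snd (\<omega> k p (x_dir i) t_dir)) $ r) k),
    G_y = (\<lambda>k r i. loc (\<lambda>k p. snd (snd (\<omega> k p (y_dir i) t_dir)) $ r) k),
    L_bar = (\<lambda>k j. loc (\<lambda>k p. fst (\<omega> k p t_dir (x_dir j))) k),
    L_x = (\<lambda>k r i j. loc (\<lambda>k p. fst (snd (\<omega> k p (x_dir i) (x_dir j))) $ r) k),
    L_y = (\<lambda>k r i j. loc (\<lambda>k p. snd (snd (\<omega> k p (y_dir i) (x_dir j))) $ r) k),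
    C_bar = (\<lambda>k j. loc (\<lambda>k p. fst (\<omega> k p t_dir (y_dir j))) k),
    C_x = (\<lambda>k r i j. loc (\<lambda>k p. fst (snd (\<omega> k p (x_dir i) (y_dir j))) $ r) k),
    C_y = (\<lambda>k r i j. loc (\<lambda>k p. snd (snd (\<omega> k p (y_dir i) (y_dir j))) $ r) k)\<rparr>"
  have dirs: "t_dir \<in> Basis" "x_dir i \<in> Basis" "y_dir i \<in> Basis" for i :: 'n
    using ball_Basis_jet[of "\<lambda>u. u \<in> Basis"] by auto
  have sm: "smooth_at p (\<lambda>q. \<omega> k q u v)" if "k \<in> J" "p \<in> cdom k" "u \<in> Basis" "v \<in> Basis" for k p u v
    using \<omega>(2) that by (simp add: smooth_coeffs_def)
  have lf: "local_function A (loc (\<lambda>k p. L (\<omega> k p u v)))"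
    if "bounded_linear L" "u \<in> Basis" "v \<in> Basis" for L u v
    unfolding loc_def by (intro local_functionI smooth_at_bounded_linear[OF that(1)] sm that(2,3))
  have K: "local_components A K"
    unfolding local_components_def K_def adapted_comps.simps
    by (intro conjI allI lf bounded_linear_parts dirs)
  have P: "\<omega> k p (Q u) v = Q (\<omega> k p u v)"
    if "Q \<in> {part_t, part_x, part_y}" "k \<in> J" "p \<in> cdom k" "u \<in> Basis" "v \<in> Basis" for Q k p u v
    using gamma_linear_iff[OF conn \<omega>(3,1)] nabla that by blast
  have eq: "jet_coeffs K k p u v = \<omega> k p u v" if k: "k \<in> J" "p \<in> cdom k" and v: "v \<in> Basis" "u \<in> Basis" for k p u v
  proof -
    have t: "\<omega> k p t_dir v = part_t (\<omega> k p t_dir v)"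
      using P[of part_t k p t_dir v] k v dirs by simp
    have x: "\<omega> k p (x_dir i) v = part_x (\<omega> k p (x_dir i) v)" for i
      using P[of part_x k p "x_dir i" v] k v dirs by simp
    have y: "\<omega> k p (y_dir i) v = part_y (\<omega> k p (y_dir i) v)" for i
      using P[of part_y k p "y_dir i" v] k v dirs by simp
    have K': "jet_coeffs K k p t_dir v = part_t (\<omega> k p t_dir v) \<and>
      (\<forall>i. jet_coeffs K k p (x_dir i) v = part_x (\<omega> k p (x_dir i) v)) \<and>
      (\<forall>i. jet_coeffs K k p (y_dir i) v = part_y (\<omega> k p (y_dir i) v))"
    proof -
      have "\<forall>v\<in>Basis. jet_coeffs K k p t_dir v = part_t (\<omega> k p t_dir v) \<and>
        (\<forall>i. jet_coeffs K k p (x_dir i) v = part_x (\<omega> k p (x_dir i) v)) \<and>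
        (\<forall>i. jet_coeffs K k p (y_dir i) v = part_y (\<omega> k p (y_dir i) v))"
        unfolding ball_Basis_jet jet_coeffs_basis using k
        by (simp add: K_def loc_def part_defs vec_eq_iff)
      then show ?thesis using v(1) by blast
    qed
    have "\<forall>u\<in>Basis. jet_coeffs K k p u v = \<omega> k p u v"
      unfolding ball_Basis_jet using K' t x y by metis
    then show ?thesis using v(2) by blast
  qed
  have "has_coeffs nabla (jet_coeffs K)"
  proof (rule has_coeffsI)
    fix k V p and u v :: "real \<times> (real ^ 'n) \<times> (real ^ 'n)" and X Y
    assume H: "k \<in> J" "u \<in> Basis" "v \<in> Basis" "X \<in> VF" "Y \<in> VF" "opn V" "V \<subseteq> cdom k" "p \<in> V"
      "\<And>q. q \<in> V \<Longrightarrow> X q = frame k q v" "\<And>q. q \<in> V \<Longrightarrow> Y q = frame k q u"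
    have p: "p \<in> cdom k" using H by auto
    show "nabla X Y p = frame k p (jet_coeffs K k p u v)"
      unfolding eq[OF H(1) p H(3,2)] by (rule has_coeffsD[OF \<omega>(3) H])
  qed
  with K show thesis by (rule that)
qed

lemma gamma_linear_jet_coeffs:
  assumes "conn nabla" "has_coeffs nabla (jet_coeffs K)"
  shows "gamma_linear_connection A \<Gamma> nabla"
  unfolding gamma_linear_iff[OF assms bilinear_coeffs_jet_coeffs] by (simp add: jet_coeffs_parts)

end


theorem theorem2p7:
  fixes A :: "('m, real ^ 'n::finite) chart set"
    and \<Gamma> :: "('m, 'n) nonlinear_comps"
  assumes "smooth_manifold A"
    and "nonlinear_connection A \<Gamma>"
  shows
    "(\<forall>nabla K. gamma_linear_connection A \<Gamma> nabla \<and> has_adapted_coefficients A \<Gamma> nabla K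
        \<longrightarrow> transformation_rules A K)
     \<and>
     (\<forall>nabla. gamma_linear_connection A \<Gamma> nabla \<longrightarrow>
        (\<exists>!K. local_components A K \<and> transformation_rules A K \<and>
              has_adapted_coefficients A \<Gamma> nabla K))
     \<and>
     (\<forall>K. local_components A K \<and> transformation_rules A K \<longrightarrow>
        (\<exists>!nabla. gamma_linear_connection A \<Gamma> nabla \<and> has_adapted_coefficients A \<Gamma> nabla K))"
proof -
  interpret jet_nonlinear A \<Gamma> by standard (rule assms)+
  have conn: "conn nabla" if "gamma_linear_connection A \<Gamma> nabla" for nabla
    using that by (simp add: gamma_linear_connection_def jet_atlas_def)
  have rules: "transformation_rules A K"
    if "gamma_linear_connection A \<Gamma> nabla" "has_coeffs nabla (jet_coeffs K)" for nabla K
    unfolding transformation_rules_iff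
    by (rule coeffs_transform_necessary[OF conn[OF that(1)] that(2) bilinear_coeffs_jet_coeffs])
  show ?thesis
    unfolding has_adapted_coefficients_iff
  proof (intro conjI allI impI, elim conjE)
    fix nabla K
    assume "gamma_linear_connection A \<Gamma> nabla" "has_coeffs nabla (jet_coeffs K)"
    then show "transformation_rules A K" by (rule rules)
  next
    fix nabla assume nabla: "gamma_linear_connection A \<Gamma> nabla"
    obtain K where K: "local_components A K" "has_coeffs nabla (jet_coeffs K)"
      by (rule components_exist[OF nabla])
    show "\<exists>!K. local_components A K \<and> transformation_rules A K \<and> has_coeffs nabla (jet_coeffs K)"
    proof (rule ex1I[of _ K])
      show "local_components A K \<and> transformation_rules A K \<and> has_coeffs nabla (jet_coeffs K)"
        using K rules[OF nabla K(2)] by blast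
    qed (use components_unique[OF _ K(1) _ K(2)] in blast)
  next
    fix K assume K: "local_components A K \<and> transformation_rules A K"
    note \<omega> = bilinear_coeffs_jet_coeffs[of K] smooth_jet_coeffs[of K] transformation_rules_iff[of K, THEN iffD1]
    have c: "conn (conn_of (jet_coeffs K))" "has_coeffs (conn_of (jet_coeffs K)) (jet_coeffs K)"
      using conn_of_conn[OF \<omega>] conn_of_has_coeffs[OF \<omega>(1,3)] K by blast+
    show "\<exists>!nabla. gamma_linear_connection A \<Gamma> nabla \<and> has_coeffs nabla (jet_coeffs K)"
    proof (rule ex1I[of _ "conn_of (jet_coeffs K)"])
      show "gamma_linear_connection A \<Gamma> (conn_of (jet_coeffs K)) \<and> has_coeffs (conn_of (jet_coeffs K)) (jet_coeffs K)"
        using gamma_linear_jet_coeffs[OF c] c(2) by blast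
    qed (use conn_unique[OF conn c(1) _ c(2) \<omega>(1)] in blast)
  qed
qed


end
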